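(* Let $n\ge 3$ be an odd integer. There is a seed of the Grassmannian cluster algebra $\mathcal{A}_{n-1,2n}$ such that, after freezing and subsequently trivializing the $n$ cluster variables $\Delta_I$ with $I\subset\{2,4,\ldots,2n\}$, $|I|=n-1$ (all of which belong to this seed), the resulting seed coincides with the seed obtained from the initial seed $(\tilde{\mathbf y}_{D_n^\dagger},Q_{\mathcal{CM}_n})$ of the cluster algebra $\mathcal{CM}_n$ by trivializing the single frozen variable $y_{(\emptyset;\emptyset)}$. Here the variables of the two seeds are identified via $\Delta_{I(P;Q)}\leftrightarrow y_{(P;Q)}$, $(P;Q)\in D_n^\dagger$, and under this identification the quivers (including which vertices are frozen) coincide. Consequently, the cluster algebra structures generated by these two seeds coincide.
   Context: All cluster algebras are skew-symmetric of geometric type over $\mathbb{C}$; a seed consists of an extended cluster (mutable and frozen variables) and a quiver without loops and oriented 2-cycles whose vertices are labelled by these variables; arrows between frozen vertices are always omitted. The cluster algebra is the algebra over the polynomial ring in the frozen variables generated by all cluster variables obtained by mutation. Freezing a mutable variable means declaring it (and its vertex) frozen and deleting arrows between frozen vertices. Trivializing a frozen variable means deleting it and its vertex with all incident arrows (equivalently setting it equal to $1$). **Circular pairs.** Boundary nodes $1,\dots,n$ are placed clockwise on a circle, indices mod $n$. A circular pair is $(P;Q)=(p_1,\dots,p_k;q_1,\dots,q_k)$ with $P,Q$ disjoint ordered $k$-tuples such that $p_1,\dots,p_k,q_k,\dots,q_1$ occur in clockwise cyclic order. It is contiguous if it has the form $(a,a+1,\dots,a+k-1;\,b+k-1,\dots,b+1,b)$.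 The pair symmetric to $(P;Q)$ is $(\widetilde Q;\widetilde P)=(q_k,\dots,q_1;p_k,\dots,p_1)$. For odd $n$, $D_n$ is the set of central circular pairs $(j,j+1,\dots,j+k-1;\ \tfrac{n-1}{2}+k+j-1,\dots,\tfrac{n-1}{2}+j)$, $1\le k\le\frac{n-1}{2}$, $1\le j\le n$; those with $k=\frac{n-1}{2}$ are called maximal. $D_n^\dagger$ is the union of $D_n$ and of the set of pairs symmetric to elements of $D_n$. We also allow the empty pair $(\emptyset;\emptyset)$. **The set $I(P;Q)$.** For a contiguous circular pair $(P;Q)$ of size $k\ge1$ choose integer representatives $p_1<\dots<p_k<q_k<\dots<q_1<p_1+n$. Then $I(P;Q)\subset[2n]$, $|I(P;Q)|=n-1$, is the reduction mod $2n$ of $$\{2p_1-1,2p_1,\dots,2p_k-2,2p_k-1\}\cup\{2p_k,2p_k+2,\dots,2q_k-4\}\cup\{2p_1-2,2p_1-4,\dots,2(q_1-n)+2\}$$ (the last two sets consist of even numbers and may be empty). **Cluster algebra $\mathcal{A}_{k,m}$ (Scott).** A plabic graph is a planar bipartite graph embedded in a disk with $m$ degree-one boundary vertices labelled clockwise $1,\dots,m$ and interior vertices coloured black/white, edges between interior vertices joining different colours. The zig-zag path (strand) starting at boundary vertex $i$ turns maximally right at black and maximally left at white vertices until it reaches a boundary vertex $\tau(i)$. The graph is reduced if strands have no self-intersections, there are no closed strands, and no two strands form an oriented lens. A $\pi_{k,m}$-diagram is a reduced plabic graph with $\tau(i)=i+k \pmod m$ for all $i$, its faces labelled by Scott's rule: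 $i$ belongs to the label of a face iff the circuit formed by the $i$-th zig-zag path followed by the clockwise boundary arc from $\tau(i)$ to $i$ does not wind around that face. Every label is a $k$-subset of $[m]$. The associated seed has a variable $\Delta_K$ for every face label $K$; variables of faces adjacent to the boundary are frozen; its quiver has a vertex in every face and, for each edge separating two faces, an arrow between them, oriented clockwise around black and counterclockwise around white vertices (2-cycles cancelled). All $\pi_{k,m}$-diagrams give seeds of one cluster algebra $\mathcal{A}_{k,m}$, which is isomorphic to the homogeneous coordinate ring $\mathbb{C}[\mathrm{Gr}(k,m)]$ with $\Delta_K$ the Plücker coordinates. **Cluster algebra $\mathcal{CM}_n$ ($n$ odd).** The initial seed has variables $\tilde{\mathbf y}_{D_n^\dagger}=\{y_{(P;Q)}:(P;Q)\in D_n^\dagger\}\cup\{y_{(\emptyset;\emptyset)}\}$; the frozen ones are those with $(P;Q)$ maximal or symmetric to a maximal pair, and $y_{(\emptyset;\emptyset)}$. Consider the Grassmann–Plücker relation $$N^{a,c}N^{b,d}=N^{a,d}N^{b,c}+N^{ab,cd}N^{\emptyset,\emptyset},$$ where $N=M(R;S)$ is the submatrix of a matrix $M$ with rows $R$ and columns $S$ for a circular pair $(R;S)$, $N^{X,Y}$ is the minor with rows $X$ and columns $Y$ deleted, row $a$ is above row $b$ and column $c$ is to the left of column $d$. For each mutable $(P;Q)\in D_n^\dagger$ there is a unique such relation in which $(P;Q)$ indexes one of the left-hand factors and the four right-hand factors are indexed by elements of $D_n^\dagger\cup\{(\emptyset;\emptyset)\}$. In $Q_{\mathcal{CM}_n}$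 the vertex $(P;Q)$ is joined by an edge to each of these four vertices, and there are no other edges. $Q_{\mathcal{CM}_n}$ is embedded in the plane with pairs of size $k$ on the circle of radius $k$ centred at $(\emptyset;\emptyset)$ and edges going along circles or radially; the edges are oriented so that incoming and outgoing arrows alternate around each mutable vertex (i.e. at each mutable vertex the two edges to vertices of the same size have one direction and the two radial edges the other). Either of the two such orientations (which differ by reversing all arrows) may be chosen. *)

theory Defs
  imports
    "HOL-Library.Poly_Mapping"
    "HOL-Library.Product_Lexorder"
    "HOL-Library.List_Lexorder"
    "HOL-Computational_Algebra.Fraction_Field"
    "HOL-Combinatorics.Orbits"
    "Jordan_Normal_Form.Determinant"
begin

section \<open>Seeds and cluster algebras\<close>

text \<open>The field of rational functions over the complex numbers in variables indexed by \<open>'v\<close>;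
  the linear order on \<open>'v\<close> is only used by the library to show that polynomials form a domain.\<close>

type_synonym 'v ratfun = "(('v \<Rightarrow>\<^sub>0 nat) \<Rightarrow>\<^sub>0 complex) fract"

definition scalar :: "complex \<Rightarrow> 'v::linorder ratfun" where
  "scalar c = Fract (Poly_Mapping.single 0 c) 1"

definition indet :: "'v \<Rightarrow> 'v::linorder ratfun" where
  "indet v = Fract (Poly_Mapping.single (Poly_Mapping.single v 1) 1) 1"

text \<open>A quiver without loops and 2-cycles is encoded by the skew-symmetric integer function
  \<open>arrows S u v\<close>, the number of arrows \<open>u \<rightarrow> v\<close> minus the number of arrows \<open>v \<rightarrow> u\<close>.
  The extended cluster is the family \<open>var S v\<close>, where \<open>v\<close> is a vertex; the values of \<open>var S\<close> at other
  points are irrelevant.\<close>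

record ('v, 'f) seed =
  mutable :: "'v set"
  frozen :: "'v set"
  arrows :: "'v \<Rightarrow> 'v \<Rightarrow> int"
  var :: "'v \<Rightarrow> 'f"

definition verts :: "('v, 'f) seed \<Rightarrow> 'v set" where
  "verts S = mutable S \<union> frozen S"

definition mutate :: "'v \<Rightarrow> ('v, 'f::field) seed \<Rightarrow> ('v, 'f) seed" where
  "mutate v S = S\<lparr>
     arrows := (\<lambda>u w.
       if u = v \<or> w = v then - arrows S u w
       else if u \<in> frozen S \<and> w \<in> frozen S then 0
       else arrows S u w + max 0 (arrows S u v) * max 0 (arrows S v w)
                         - max 0 (arrows S w v) * max 0 (arrows S v u)),
     var := (var S)(v :=
       ((\<Prod>u\<in>verts S. var S u ^ nat (arrows S u v)) +
        (\<Prod>u\<in>verts S. var S u ^ nat (arrows S v u))) / var S v)\<rparr>"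

inductive_set mutation_class :: "('v, 'f::field) seed \<Rightarrow> ('v, 'f) seed set"
  for S :: "('v, 'f::field) seed" where
  initial: "S \<in> mutation_class S"
| mutation: "T \<in> mutation_class S \<Longrightarrow> v \<in> mutable T \<Longrightarrow> mutate v T \<in> mutation_class S"

inductive_set cluster_algebra :: "('v, 'w::linorder ratfun) seed \<Rightarrow> 'w ratfun set"
  for S :: "('v, 'w::linorder ratfun) seed" where
  scalar: "scalar c \<in> cluster_algebra S"
| frozen_var: "v \<in> frozen S \<Longrightarrow> var S v \<in> cluster_algebra S"
| cluster_var: "T \<in> mutation_class S \<Longrightarrow> v \<in> mutable T \<Longrightarrow> var T v \<in> cluster_algebra S"
| add: "a \<in> cluster_algebra S \<Longrightarrow> b \<in> cluster_algebra S \<Longrightarrow> a + b \<in> cluster_algebra S"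
| mult: "a \<in> cluster_algebra S \<Longrightarrow> b \<in> cluster_algebra S \<Longrightarrow> a * b \<in> cluster_algebra S"

definition freeze :: "'v set \<Rightarrow> ('v, 'f) seed \<Rightarrow> ('v, 'f) seed" where
  "freeze U S =
     (let F = frozen S \<union> (U \<inter> mutable S)
      in S\<lparr>mutable := mutable S - U, frozen := F,
           arrows := (\<lambda>u v. if u \<in> F \<and> v \<in> F then 0 else arrows S u v)\<rparr>)"

definition trivialize :: "'v set \<Rightarrow> ('v, 'f) seed \<Rightarrow> ('v, 'f) seed" where
  "trivialize U S =
     (let W = U \<inter> frozen S
      in S\<lparr>frozen := frozen S - W,
           arrows := (\<lambda>u v. if u \<in> W \<or> v \<in> W then 0 else arrows S u v)\<rparr>)"

text \<open>The relation \<open>R\<close> is the identification of the variables of the two seeds.\<close>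

definition seeds_coincide ::
    "('f \<times> 'g) set \<Rightarrow> ('v, 'f) seed \<Rightarrow> ('w, 'g) seed \<Rightarrow> bool" where
  "seeds_coincide R S T \<longleftrightarrow>
     (\<exists>\<phi>. bij_betw \<phi> (verts S) (verts T) \<and>
          \<phi> ` mutable S = mutable T \<and> \<phi> ` frozen S = frozen T \<and>
          (\<forall>v\<in>verts S. (var S v, var T (\<phi> v)) \<in> R) \<and>
          (\<forall>u\<in>verts S. \<forall>v\<in>verts S. arrows T (\<phi> u) (\<phi> v) = arrows S u v))"

text \<open>The seeds \<open>S\<close> and \<open>T\<close> may live in different ambient fields.  Their cluster algebra structures
  coincide if the identification \<open>R\<close> of the initial variables is induced by an isomorphism of
  \<open>\<complex>\<close>-algebras between the cluster algebras that matches all seeds.\<close>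

definition cluster_structures_coincide ::
    "('a::linorder ratfun \<times> 'b::linorder ratfun) set \<Rightarrow>
     ('v, 'a ratfun) seed \<Rightarrow> ('w, 'b ratfun) seed \<Rightarrow> bool" where
  "cluster_structures_coincide R S T \<longleftrightarrow>
     (\<exists>\<theta>. bij_betw \<theta> (cluster_algebra S) (cluster_algebra T) \<and>
          (\<forall>c. \<theta> (scalar c) = scalar c) \<and>
          (\<forall>a\<in>cluster_algebra S. \<forall>b\<in>cluster_algebra S.
             \<theta> (a + b) = \<theta> a + \<theta> b \<and> \<theta> (a * b) = \<theta> a * \<theta> b) \<and>
          (\<forall>(a, b)\<in>R. \<theta> a = b) \<and>
          (let \<Theta> = {(a, \<theta> a) |a. a \<in> cluster_algebra S} in
             (\<forall>S'\<in>mutation_class S. \<exists>T'\<in>mutation_class T. seeds_coincide \<Theta> S' T') \<and>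
             (\<forall>T'\<in>mutation_class T. \<exists>S'\<in>mutation_class S. seeds_coincide \<Theta> S' T')))"

section \<open>Plabic graphs\<close>

text \<open>Representative of \<open>x\<close> modulo \<open>N\<close> in \<open>{1..N}\<close>.\<close>

definition wrap :: "nat \<Rightarrow> int \<Rightarrow> nat" where
  "wrap N x = nat ((x - 1) mod int N) + 1"

text \<open>A plabic graph is given by its rotation system.  A dart is an edge together with one of its
  directions; \<open>opp\<close> reverses a dart, and \<open>rot\<close> maps a dart to the next one in clockwise order with
  the same tail.  The dart \<open>bdry i\<close> is the one leaving the boundary vertex \<open>i\<close>; \<open>black\<close> consists of
  the darts whose tail is a black vertex, and the other darts, except for the \<open>bdry i\<close>, have white
  tails.\<close>

record plabic =
  darts :: "nat set"
  opp :: "nat \<Rightarrow> nat"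
  rot :: "nat \<Rightarrow> nat"
  bdry :: "nat \<Rightarrow> nat"
  black :: "nat set"

text \<open>The graph together with the boundary circle of the disk: \<open>CW i\<close> is the arc from the boundary
  vertex \<open>i\<close> clockwise to \<open>i + 1\<close>, and \<open>CCW i\<close> is the arc from \<open>i\<close> counterclockwise to \<open>i - 1\<close>.
  The clockwise order around the boundary vertex \<open>i\<close> is \<open>CW i\<close>, \<open>Edge (bdry i)\<close>, \<open>CCW i\<close>.\<close>

datatype disk_dart = Edge nat | CW nat | CCW nat

definition disk_darts :: "nat \<Rightarrow> plabic \<Rightarrow> disk_dart set" where
  "disk_darts m G = Edge ` darts G \<union> CW ` {1..m} \<union> CCW ` {1..m}"

fun disk_opp :: "nat \<Rightarrow> plabic \<Rightarrow> disk_dart \<Rightarrow> disk_dart" where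
  "disk_opp m G (Edge d) = Edge (opp G d)"
| "disk_opp m G (CW i) = CCW (wrap m (int i + 1))"
| "disk_opp m G (CCW i) = CW (wrap m (int i - 1))"

fun disk_rot :: "nat \<Rightarrow> plabic \<Rightarrow> disk_dart \<Rightarrow> disk_dart" where
  "disk_rot m G (Edge d) =
     (if d \<in> bdry G ` {1..m} then CCW (inv_into {1..m} (bdry G) d) else Edge (rot G d))"
| "disk_rot m G (CW i) = Edge (bdry G i)"
| "disk_rot m G (CCW i) = CW i"

text \<open>A face is represented by the set of darts that have it on their left.\<close>

definition left_face :: "nat \<Rightarrow> plabic \<Rightarrow> disk_dart \<Rightarrow> disk_dart set" where
  "left_face m G d = orbit (disk_rot m G \<circ> disk_opp m G) d"

definition outer_face :: "nat \<Rightarrow> plabic \<Rightarrow> disk_dart set" where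
  "outer_face m G = left_face m G (CW 1)"

definition faces :: "nat \<Rightarrow> plabic \<Rightarrow> disk_dart set set" where
  "faces m G = left_face m G ` disk_darts m G - {outer_face m G}"

definition boundary_faces :: "nat \<Rightarrow> plabic \<Rightarrow> disk_dart set set" where
  "boundary_faces m G = left_face m G ` CCW ` {1..m}"

text \<open>A connected rotation system is a map on the sphere iff V + F = E + 2.  Since the outer
  face consists of the boundary circle, this means that the graph is embedded in the disk.\<close>

definition embedded_in_disk :: "nat \<Rightarrow> plabic \<Rightarrow> bool" where
  "embedded_in_disk m G \<longleftrightarrow>
     (\<forall>d\<in>disk_darts m G. \<forall>e\<in>disk_darts m G.
        (d, e) \<in> {(x, y). x \<in> disk_darts m G \<and> (y = disk_rot m G x \<or> y = disk_opp m G x)}\<^sup>*) \<and>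
     card (orbit (disk_rot m G) ` disk_darts m G) + card (left_face m G ` disk_darts m G)
       = card ((\<lambda>d. {d, disk_opp m G d}) ` disk_darts m G) + 2"

definition inner_edge :: "nat \<Rightarrow> plabic \<Rightarrow> nat \<Rightarrow> bool" where
  "inner_edge m G d \<longleftrightarrow> d \<in> darts G \<and> d \<notin> bdry G ` {1..m} \<and> opp G d \<notin> bdry G ` {1..m}"

definition plabic_graph :: "nat \<Rightarrow> plabic \<Rightarrow> bool" where
  "plabic_graph m G \<longleftrightarrow>
     finite (darts G) \<and>
     opp G permutes darts G \<and> (\<forall>d\<in>darts G. opp G d \<noteq> d \<and> opp G (opp G d) = d) \<and>
     rot G permutes darts G \<and>
     inj_on (bdry G) {1..m} \<and> bdry G ` {1..m} \<subseteq> darts G \<and>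
     (\<forall>i\<in>{1..m}. rot G (bdry G i) = bdry G i) \<and>
     black G \<subseteq> darts G - bdry G ` {1..m} \<and>
     (\<forall>d\<in>darts G. rot G d \<in> black G \<longleftrightarrow> d \<in> black G) \<and>
     (\<forall>d. inner_edge m G d \<longrightarrow> (opp G d \<in> black G \<longleftrightarrow> d \<notin> black G)) \<and>
     embedded_in_disk m G"

text \<open>After arriving along \<open>d\<close> at an interior vertex, the zig-zag path continues along the dart
  preceding \<open>opp d\<close> in clockwise order (maximal right turn) at a black vertex and along the dart
  following it (maximal left turn) at a white one.\<close>

definition zigzag_step :: "plabic \<Rightarrow> nat \<Rightarrow> nat" where
  "zigzag_step G d =
     (if opp G d \<in> black G then inv_into UNIV (rot G) (opp G d) else rot G (opp G d))"

definition strand :: "nat \<Rightarrow> plabic \<Rightarrow> nat \<Rightarrow> nat list" where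
  "strand m G i = map (\<lambda>t. (zigzag_step G ^^ t) (bdry G i))
     [0..<Suc (LEAST t. opp G ((zigzag_step G ^^ t) (bdry G i)) \<in> bdry G ` {1..m})]"

definition strand_end :: "nat \<Rightarrow> plabic \<Rightarrow> nat \<Rightarrow> nat" where
  "strand_end m G i = inv_into {1..m} (bdry G) (opp G (last (strand m G i)))"

text \<open>Drawn as curves, two strands cross exactly in the middle of the inner edges, where they
  traverse the same edge in opposite directions.\<close>

definition self_intersecting :: "nat \<Rightarrow> plabic \<Rightarrow> nat list \<Rightarrow> bool" where
  "self_intersecting m G s \<longleftrightarrow> (\<exists>d\<in>set s. opp G d \<in> set s \<and> inner_edge m G d)"

text \<open>Since zig-zag steps are injective, a zig-zag path in a finite graph that never reaches
  the boundary is periodic.\<close>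

definition has_closed_strand :: "nat \<Rightarrow> plabic \<Rightarrow> bool" where
  "has_closed_strand m G \<longleftrightarrow>
     (\<exists>d\<in>darts G. \<forall>t. opp G ((zigzag_step G ^^ t) d) \<notin> bdry G ` {1..m})"

text \<open>The forbidden lens is the one excluded by Postnikov and Scott: two strands cross at two points
  A and B, and both run from A to B.  (Bigons formed by strands running in opposite directions do
  occur in reduced graphs, for example at bivalent vertices.)\<close>

definition oriented_lens :: "plabic \<Rightarrow> nat list \<Rightarrow> nat list \<Rightarrow> bool" where
  "oriented_lens G s t \<longleftrightarrow>
     (\<exists>a b c d. a < b \<and> b < length s \<and> c < d \<and> d < length t \<and>
        s ! a = opp G (t ! c) \<and> s ! b = opp G (t ! d))"

definition reduced :: "nat \<Rightarrow> plabic \<Rightarrow> bool" where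
  "reduced m G \<longleftrightarrow>
     (\<forall>i\<in>{1..m}. \<not> self_intersecting m G (strand m G i)) \<and>
     \<not> has_closed_strand m G \<and>
     (\<forall>i\<in>{1..m}. \<forall>j\<in>{1..m}. i \<noteq> j \<longrightarrow> \<not> oriented_lens G (strand m G i) (strand m G j))"

definition pi_diagram :: "nat \<Rightarrow> nat \<Rightarrow> plabic \<Rightarrow> bool" where
  "pi_diagram k m G \<longleftrightarrow>
     plabic_graph m G \<and> reduced m G \<and> (\<forall>i\<in>{1..m}. strand_end m G i = wrap m (int i + int k))"

definition circuit :: "nat \<Rightarrow> plabic \<Rightarrow> nat \<Rightarrow> disk_dart list" where
  "circuit m G i = map Edge (strand m G i) @
     map (\<lambda>t. CW (wrap m (int (strand_end m G i) + int t)))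
       [0..<nat ((int i - int (strand_end m G i)) mod int m)]"

text \<open>The winding numbers of a closed walk around the faces: they vanish on the outer face, and
  the one to the left of a dart exceeds the one to its right by the signed number of times the walk
  traverses the dart.  These conditions determine \<open>w\<close> on all faces.\<close>

definition winding_numbers ::
    "nat \<Rightarrow> plabic \<Rightarrow> disk_dart list \<Rightarrow> (disk_dart set \<Rightarrow> int) \<Rightarrow> bool" where
  "winding_numbers m G C w \<longleftrightarrow>
     w (outer_face m G) = 0 \<and>
     (\<forall>d\<in>disk_darts m G.
        w (left_face m G d) - w (left_face m G (disk_opp m G d)) =
        int (count_list C d) - int (count_list C (disk_opp m G d)))"

definition face_label :: "nat \<Rightarrow> plabic \<Rightarrow> disk_dart set \<Rightarrow> nat set" where
  "face_label m G f = {i\<in>{1..m}. \<exists>w. winding_numbers m G (circuit m G i) w \<and> w f = 0}"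

section \<open>The Grassmannian cluster algebra\<close>

text \<open>The Pluecker coordinates are realized as the maximal minors of the generic k \<open>\<times>\<close> m matrix
  with entries \<open>indet (i, j)\<close>, i < k, 1 \<open>\<le>\<close> j \<open>\<le>\<close> m.\<close>

definition plucker :: "nat \<Rightarrow> nat set \<Rightarrow> (nat \<times> nat) ratfun" where
  "plucker k K = det (mat k k (\<lambda>(i, j). indet (i, sorted_list_of_set K ! j)))"

text \<open>For a dart with black tail, the arrow crossing its edge clockwise around that tail goes from
  the face on the left to the face on the right; at the other end it runs counterclockwise around a
  white vertex.  Edges without a black end meet the boundary and separate frozen faces.\<close>

definition plabic_arrows :: "nat \<Rightarrow> plabic \<Rightarrow> nat set \<Rightarrow> nat set \<Rightarrow> nat" where
  "plabic_arrows m G K L =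
     card {d \<in> black G. face_label m G (left_face m G (Edge d)) = K \<and>
                         face_label m G (left_face m G (Edge (opp G d))) = L}"

definition plabic_seed :: "nat \<Rightarrow> nat \<Rightarrow> plabic \<Rightarrow> (nat set, (nat \<times> nat) ratfun) seed" where
  "plabic_seed k m G =
     (let F = face_label m G ` boundary_faces m G in
      \<lparr>mutable = face_label m G ` (faces m G - boundary_faces m G),
       frozen = F,
       arrows = (\<lambda>K L. if K \<in> F \<and> L \<in> F then 0
                       else int (plabic_arrows m G K L) - int (plabic_arrows m G L K)),
       var = plucker k\<rparr>)"

definition grassmannian_seeds ::
    "nat \<Rightarrow> nat \<Rightarrow> (nat set, (nat \<times> nat) ratfun) seed set" where
  "grassmannian_seeds k m = (\<Union>G\<in>{G. pi_diagram k m G}. mutation_class (plabic_seed k m G))"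

section \<open>Circular pairs and the cluster algebra of circular minors\<close>

type_synonym cpair = "nat list \<times> nat list"

definition circular_pair :: "nat \<Rightarrow> cpair \<Rightarrow> bool" where
  "circular_pair n = (\<lambda>(P, Q).
     length P = length Q \<and> set P \<union> set Q \<subseteq> {1..n} \<and>
     (\<exists>r. sorted_wrt (<) (rotate r (P @ rev Q))))"

definition central_pair :: "nat \<Rightarrow> nat \<Rightarrow> nat \<Rightarrow> cpair" where
  "central_pair n k j =
     (map (\<lambda>i. wrap n (int j + int i)) [0..<k],
      map (\<lambda>i. wrap n (int ((n - 1) div 2 + k + j) - 1 - int i)) [0..<k])"

definition symmetric_pair :: "cpair \<Rightarrow> cpair" where
  "symmetric_pair = (\<lambda>(P, Q). (rev Q, rev P))"

definition pair_size :: "cpair \<Rightarrow> nat" where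
  "pair_size p = length (fst p)"

definition central_pairs :: "nat \<Rightarrow> cpair set" where
  "central_pairs n = {central_pair n k j |k j. k \<in> {1..(n - 1) div 2} \<and> j \<in> {1..n}}"

definition D_dagger :: "nat \<Rightarrow> cpair set" where
  "D_dagger n = central_pairs n \<union> symmetric_pair ` central_pairs n"

definition cm_mutable :: "nat \<Rightarrow> cpair set" where
  "cm_mutable n = {p \<in> D_dagger n. pair_size p \<noteq> (n - 1) div 2}"

text \<open>The set I(P;Q), with representatives of P and Q in \<open>{p\<^sub>1..<p\<^sub>1 + n}\<close>; the choice of \<open>p\<^sub>1\<close>
  modulo n does not matter, as the result is reduced modulo 2n.\<close>

definition I_set :: "nat \<Rightarrow> cpair \<Rightarrow> nat set" where
  "I_set n = (\<lambda>(P, Q).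
     let p1 = int (hd P);
         rep = (\<lambda>x. p1 + (int x - p1) mod int n);
         pk = rep (last P);
         qk = rep (last Q);
         q1 = rep (hd Q)
     in wrap (2 * n) `
          ({2 * p1 - 1..2 * pk - 1} \<union>
           {x \<in> {2 * pk..2 * qk - 4}. even x} \<union>
           {x \<in> {2 * (q1 - int n) + 2..2 * p1 - 2}. even x}))"

definition delete_at :: "nat set \<Rightarrow> 'a list \<Rightarrow> 'a list" where
  "delete_at A xs = nths xs (- A)"

text \<open>\<open>L\<close> and \<open>M\<close> are the sets of pairs indexing the left-hand and right-hand factors of the
  Grassmann-Pluecker relation for the rows a, b and columns c, d (given by their positions) of the
  submatrix with rows R and columns S.\<close>

definition gp_relation :: "nat \<Rightarrow> cpair set \<Rightarrow> cpair set \<Rightarrow> bool" where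
  "gp_relation n L M \<longleftrightarrow>
     (\<exists>R S a b c d. circular_pair n (R, S) \<and>
        a < b \<and> b < length R \<and> c < d \<and> d < length S \<and>
        L = {(delete_at {a} R, delete_at {c} S), (delete_at {b} R, delete_at {d} S)} \<and>
        M = {(delete_at {a} R, delete_at {d} S), (delete_at {b} R, delete_at {c} S),
             (delete_at {a, b} R, delete_at {c, d} S), (R, S)})"

definition cm_exchange_neighbour :: "nat \<Rightarrow> cpair \<Rightarrow> cpair \<Rightarrow> bool" where
  "cm_exchange_neighbour n p q \<longleftrightarrow>
     p \<in> cm_mutable n \<and>
     (\<exists>L M. gp_relation n L M \<and> p \<in> L \<and> M \<subseteq> D_dagger n \<union> {([], [])} \<and> q \<in> M)"

definition cm_edge :: "nat \<Rightarrow> cpair \<Rightarrow> cpair \<Rightarrow> bool" where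
  "cm_edge n p q \<longleftrightarrow> cm_exchange_neighbour n p q \<or> cm_exchange_neighbour n q p"

text \<open>The two edges along the circle and the two radial edges at a mutable vertex alternate in
  the planar embedding; so the orientation alternates iff edges to pairs of the same size have one
  direction and all others the opposite one.  There are two such orientations, opposite to each
  other.\<close>

definition cm_quivers :: "nat \<Rightarrow> (cpair \<Rightarrow> cpair \<Rightarrow> int) set" where
  "cm_quivers n = {B.
     (\<forall>p q. B q p = - B p q) \<and>
     (\<forall>p q. \<bar>B p q\<bar> = (if cm_edge n p q then 1 else 0)) \<and>
     (\<forall>p\<in>cm_mutable n. \<exists>s\<in>{1, -1}. \<forall>q. cm_edge n p q \<longrightarrow>
        B p q = (if pair_size q = pair_size p then s else - s))}"

definition cm_seed :: "nat \<Rightarrow> (cpair \<Rightarrow> cpair \<Rightarrow> int) \<Rightarrow> (cpair, cpair ratfun) seed" where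
  "cm_seed n B =
     \<lparr>mutable = cm_mutable n,
      frozen = (D_dagger n - cm_mutable n) \<union> {([], [])},
      arrows = B,
      var = indet\<rparr>"

end

theory Submission
  imports Defs "HOL-Library.Countable"
begin

text \<open>Write \<open>n = 2 * h + 1\<close>.  The seed is that of an explicit plabic graph: the square grid on an
  annulus with \<open>h\<close> circles and \<open>2 * n\<close> rays, every second ray being joined to one more vertex in
  the centre.  The face in ring \<open>k\<close> at angle \<open>t\<close> has as label \<open>k\<close> consecutive odd numbers together
  with all even numbers except \<open>k + 1\<close> consecutive ones around the opposite point; for \<open>k = 0\<close> these
  are the \<open>n\<close> even sets, and for \<open>k > 0\<close> they are the sets \<open>I(P;Q)\<close> of the central circular pairs
  of size \<open>k\<close> and their symmetric pairs.

  The cluster structures are identified by the map of fields that sends \<open>y(P;Q)\<close> to the Pluecker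
  coordinate of \<open>I(P;Q)\<close>.  It exists because these coordinates are algebraically independent: with
  the even columns fixed, any prescribed nonzero values are attained by choosing the odd columns
  ring by ring, since an entry of an odd column that enters a minor of ring \<open>k\<close> for the first time
  does so with a minor of ring \<open>k - 1\<close> as its coefficient.\<close>

section \<open>Evaluation of polynomials\<close>

text \<open>No exchange relation among Pluecker coordinates is ever computed. Mutation is a formula
  in the ambient field, so a field homomorphism that matches two initial seeds matches all their
  mutations. It has to start from the field of the \<open>y\<close> variables, which are free there;
  its inverse is only defined on the image. Hence algebraic independence is the point at issue, and
  a bijection of labels alone would not do.

  The angle is chosen so that central pairs and their symmetric pairs alternate around each ring,
  and so that membership of \<open>j\<close> in the label at angle \<open>t\<close> depends only on
  \<open>t - j\<close> modulo \<open>2 * n\<close> and on the parity of \<open>j\<close>. Strands,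
  winding numbers and labels are then compared by linear inequalities for this one residue.

  Ring 0 is exceptional: only every second ray reaches the centre, so its \<open>2 * n\<close>
  angles give just \<open>n\<close> faces. These carry the even sets. Removing them on one side and
  the empty pair on the other leaves the same grid of rings \<open>1\<close> to \<open>h\<close>,
  with chessboard parity deciding every arrow.\<close>

definition monom_eval :: "('v \<Rightarrow> 'a::comm_ring_1) \<Rightarrow> ('v \<Rightarrow>\<^sub>0 nat) \<Rightarrow> 'a" where
  "monom_eval f m = (\<Prod>v\<in>Poly_Mapping.keys m. f v ^ poly_mapping.lookup m v)"

text \<open>The coefficient map \<open>c\<close> is a parameter so that one notion covers numerical
  evaluation (\<open>c\<close> the identity) and substitution of polynomials for the variables
  (\<open>c\<close> the embedding of constants).\<close>

definition poly_eval ::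
    "(complex \<Rightarrow> 'a::comm_ring_1) \<Rightarrow> ('v \<Rightarrow> 'a) \<Rightarrow> (('v \<Rightarrow>\<^sub>0 nat) \<Rightarrow>\<^sub>0 complex) \<Rightarrow> 'a" where
  "poly_eval c f P = (\<Sum>m\<in>Poly_Mapping.keys P. c (poly_mapping.lookup P m) * monom_eval f m)"

lemma monom_eval_superset:
  assumes "finite V" "Poly_Mapping.keys m \<subseteq> V"
  shows "monom_eval f m = (\<Prod>v\<in>V. f v ^ poly_mapping.lookup m v)"
  unfolding monom_eval_def
  by (rule prod.mono_neutral_left) (use assms in \<open>auto simp: in_keys_iff\<close>)

lemma monom_eval_add: "monom_eval f (m + m') = monom_eval f m * monom_eval f m'"
proof -
  let ?V = "Poly_Mapping.keys m \<union> Poly_Mapping.keys m'"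
  have "Poly_Mapping.keys (m + m') \<subseteq> ?V"
    by (rule Poly_Mapping.keys_add)
  then show ?thesis
    by (simp add: monom_eval_superset[of ?V] lookup_add power_add prod.distrib)
qed

lemma poly_eval_superset:
  assumes "comm_ring_hom c" "finite M" "Poly_Mapping.keys P \<subseteq> M"
  shows "poly_eval c f P = (\<Sum>m\<in>M. c (poly_mapping.lookup P m) * monom_eval f m)"
proof -
  interpret comm_ring_hom c by fact
  show ?thesis unfolding poly_eval_def
    by (rule sum.mono_neutral_left) (use assms in \<open>auto simp: in_keys_iff\<close>)
qed

lemma poly_eval_single:
  assumes "comm_ring_hom c"
  shows "poly_eval c f (Poly_Mapping.single m a) = c a * monom_eval f m"
proof -
  interpret comm_ring_hom c by fact
  show ?thesis
    by (simp add: poly_eval_superset[OF assms, of "{m}"])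
qed

lemma poly_eval_add:
  assumes "comm_ring_hom c"
  shows "poly_eval c f (P + Q) = poly_eval c f P + poly_eval c f Q"
proof -
  interpret comm_ring_hom c by fact
  let ?M = "Poly_Mapping.keys P \<union> Poly_Mapping.keys Q"
  have "Poly_Mapping.keys (P + Q) \<subseteq> ?M"
    by (rule Poly_Mapping.keys_add)
  then show ?thesis
    by (simp add: poly_eval_superset[OF assms, of ?M] lookup_add hom_add distrib_right sum.distrib)
qed

lemma poly_mapping_eq_sum_single:
  "P = (\<Sum>m\<in>Poly_Mapping.keys P. Poly_Mapping.single m (poly_mapping.lookup P m))"
  by (rule poly_mapping_eqI)
    (auto simp: lookup_sum lookup_single when_def in_keys_iff)

text \<open>Writing both factors as sums of single terms reduces multiplicativity to that of
  \<open>monom_eval\<close> and of \<open>c\<close>.\<close>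

lemma comm_ring_hom_poly_eval:
  assumes "comm_ring_hom c"
  shows "comm_ring_hom (poly_eval c f)"
proof -
  interpret c: comm_ring_hom c by fact
  have zero: "poly_eval c f 0 = 0"
    by (simp add: poly_eval_def)
  have sum: "poly_eval c f (sum g A) = (\<Sum>a\<in>A. poly_eval c f (g a))" for g :: "'x \<Rightarrow> _" and A
    by (induction A rule: infinite_finite_induct) (auto simp: zero poly_eval_add[OF assms])
  have mult: "poly_eval c f (P * Q) = poly_eval c f P * poly_eval c f Q" for P Q
  proof -
    have "P * Q = (\<Sum>m\<in>Poly_Mapping.keys P. \<Sum>m'\<in>Poly_Mapping.keys Q.
        Poly_Mapping.single (m + m') (poly_mapping.lookup P m * poly_mapping.lookup Q m'))"
      by (subst poly_mapping_eq_sum_single[of P], subst poly_mapping_eq_sum_single[of Q])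
        (simp add: sum_product mult_single)
    also have "poly_eval c f \<dots> = poly_eval c f P * poly_eval c f Q"
      unfolding sum poly_eval_single[OF assms] poly_eval_def[of c f P] poly_eval_def[of c f Q]
        sum_product monom_eval_add c.hom_mult
      by (simp add: ac_simps)
    finally show ?thesis .
  qed
  have one: "poly_eval c f 1 = 1"
    using poly_eval_single[OF assms, of f 0 1] by (simp add: monom_eval_def)
  show ?thesis
    by unfold_locales (auto simp: zero one mult poly_eval_add[OF assms])
qed

lemma poly_eval_var:
  assumes "comm_ring_hom c"
  shows "poly_eval c f (Poly_Mapping.single (Poly_Mapping.single v 1) 1) = f v"
proof -
  interpret comm_ring_hom c by fact
  show ?thesis
    by (simp add: poly_eval_single[OF assms] monom_eval_def)
qed

lemma hom_poly_eval:
  assumes "comm_ring_hom g"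
  shows "g (poly_eval c f P) = poly_eval (\<lambda>x. g (c x)) (\<lambda>v. g (f v)) P"
proof -
  interpret comm_ring_hom g by fact
  show ?thesis
    by (simp add: poly_eval_def monom_eval_def hom_sum hom_mult hom_prod hom_power)
qed

lemma comm_ring_hom_const: "comm_ring_hom (Poly_Mapping.single 0 :: complex \<Rightarrow> ('v \<Rightarrow>\<^sub>0 nat) \<Rightarrow>\<^sub>0 complex)"
  by unfold_locales (auto simp: single_add mult_single)

lemma comm_ring_hom_ident: "comm_ring_hom (\<lambda>x::'a::comm_ring_1. x)"
  by unfold_locales auto

text \<open>Mixed radix expansion, with bases exceeding the exponents that occur.\<close>

lemma separating_weights:
  assumes "finite V" "finite M"
  shows "\<exists>g :: 'v \<Rightarrow> nat. \<forall>m\<in>M. \<forall>m'\<in>M.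
    (\<Sum>v\<in>V. poly_mapping.lookup m v * g v) = (\<Sum>v\<in>V. poly_mapping.lookup m' v * g v) \<longrightarrow>
    (\<forall>v\<in>V. poly_mapping.lookup m v = poly_mapping.lookup m' v)"
  using assms(1)
proof induction
  case (insert x V)
  then obtain g where g: "\<And>m m'. m \<in> M \<Longrightarrow> m' \<in> M \<Longrightarrow>
    (\<Sum>v\<in>V. poly_mapping.lookup m v * g v) = (\<Sum>v\<in>V. poly_mapping.lookup m' v * g v) \<Longrightarrow>
    (\<forall>v\<in>V. poly_mapping.lookup m v = poly_mapping.lookup m' v)"
    by blast
  define B where "B = Suc (\<Sum>m\<in>M. poly_mapping.lookup m x)"
  have B: "poly_mapping.lookup m x < B" if "m \<in> M" for m
    unfolding B_def using member_le_sum[OF that, of "\<lambda>m. poly_mapping.lookup m x"] assms(2)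
    by (simp add: less_Suc_eq_le)
  define g' where "g' = (\<lambda>v. if v = x then 1 else B * g v)"
  have *: "(\<Sum>v\<in>insert x V. poly_mapping.lookup m v * g' v) =
      poly_mapping.lookup m x + B * (\<Sum>v\<in>V. poly_mapping.lookup m v * g v)" for m
  proof -
    have "(\<Sum>v\<in>V. poly_mapping.lookup m v * g' v) = (\<Sum>v\<in>V. B * (poly_mapping.lookup m v * g v))"
      by (rule sum.cong) (use insert.hyps in \<open>auto simp: g'_def\<close>)
    then show ?thesis
      using insert.hyps by (simp add: g'_def sum_distrib_left)
  qed
  have "\<forall>v\<in>insert x V. poly_mapping.lookup m v = poly_mapping.lookup m' v"
    if m: "m \<in> M" "m' \<in> M" and eq: "(\<Sum>v\<in>insert x V. poly_mapping.lookup m v * g' v) =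
      (\<Sum>v\<in>insert x V. poly_mapping.lookup m' v * g' v)" for m m'
  proof -
    let ?s = "\<lambda>m. \<Sum>v\<in>V. poly_mapping.lookup m v * g v"
    have eq': "poly_mapping.lookup m x + B * ?s m = poly_mapping.lookup m' x + B * ?s m'"
      using eq unfolding * .
    from arg_cong[OF eq', of "\<lambda>y. y mod B"] have 1: "poly_mapping.lookup m x = poly_mapping.lookup m' x"
      using B[OF m(1)] B[OF m(2)] by simp
    with eq' B[OF m(1)] have "?s m = ?s m'"
      by simp
    with g[OF m] 1 show ?thesis
      by blast
  qed
  then show ?case
    by blast
qed auto

text \<open>On the curve with coordinates \<open>s ^ g v\<close> the monomials of \<open>P\<close>
  become distinct powers of \<open>s\<close>, since the weights separate them. So \<open>P\<close>
  restricts to a nonzero polynomial in \<open>s\<close>, and some nonzero \<open>s\<close> is not a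
  root of it.\<close>

lemma nonzero_on_torus:
  fixes P :: "('v \<Rightarrow>\<^sub>0 nat) \<Rightarrow>\<^sub>0 complex"
  assumes "P \<noteq> 0"
  shows "\<exists>a. (\<forall>v. a v \<noteq> 0) \<and> poly_eval (\<lambda>x. x) a P \<noteq> 0"
proof -
  define M where "M = Poly_Mapping.keys P"
  define V where "V = \<Union>(Poly_Mapping.keys ` M)"
  have finM: "finite M" by (simp add: M_def)
  then have fin: "finite V" by (simp add: V_def)
  obtain g :: "'v \<Rightarrow> nat" where g: "\<forall>m\<in>M. \<forall>m'\<in>M.
    (\<Sum>v\<in>V. poly_mapping.lookup m v * g v) = (\<Sum>v\<in>V. poly_mapping.lookup m' v * g v) \<longrightarrow>
    (\<forall>v\<in>V. poly_mapping.lookup m v = poly_mapping.lookup m' v)"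
    using separating_weights[OF fin finM] by (rule exE)
  define d where "d = (\<lambda>m. \<Sum>v\<in>V. poly_mapping.lookup m v * g v)"
  have inj: "inj_on d M"
  proof (rule inj_onI)
    fix m m' assume m: "m \<in> M" "m' \<in> M" "d m = d m'"
    then have *: "\<forall>v\<in>V. poly_mapping.lookup m v = poly_mapping.lookup m' v"
      using g unfolding d_def by blast
    show "m = m'"
    proof (rule poly_mapping_eqI)
      fix v
      show "poly_mapping.lookup m v = poly_mapping.lookup m' v"
      proof (cases "v \<in> V")
        case False
        then have "v \<notin> Poly_Mapping.keys m" "v \<notin> Poly_Mapping.keys m'"
          using m by (auto simp: V_def)
        then show ?thesis by (simp add: in_keys_iff)
      qed (use * in blast)
    qed
  qed
  define p where "p = (\<Sum>m\<in>M. monom (poly_mapping.lookup P m) (d m))"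
  obtain m0 where m0: "m0 \<in> M"
    using assms unfolding M_def by fastforce
  \<comment> \<open>Nothing cancels in degree \<open>d m0\<close>, because \<open>d\<close> is
    injective on the monomials of \<open>P\<close>.\<close>
  have "poly.coeff p (d m0) = (\<Sum>m\<in>M. if m = m0 then poly_mapping.lookup P m else 0)"
    unfolding p_def coeff_sum
    by (rule sum.cong) (use inj m0 in \<open>auto dest: inj_onD\<close>)
  also have "\<dots> \<noteq> 0"
    using m0 finM by (simp add: M_def in_keys_iff)
  finally have "p \<noteq> 0"
    by auto
  then have "finite ({s. poly p s = 0} \<union> {0})"
    by (simp add: poly_roots_finite)
  then obtain s where s: "s \<notin> {s. poly p s = 0} \<union> {0}"
    using ex_new_if_finite[OF infinite_UNIV_char_0] by blast
  have "monom_eval (\<lambda>v. s ^ g v) m = s ^ d m" if "m \<in> M" for m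
  proof -
    have "monom_eval (\<lambda>v. s ^ g v) m = (\<Prod>v\<in>V. (s ^ g v) ^ poly_mapping.lookup m v)"
      by (rule monom_eval_superset) (use that fin in \<open>auto simp: V_def\<close>)
    also have "\<dots> = s ^ d m"
      by (simp add: d_def power_sum mult.commute flip: power_mult)
    finally show ?thesis .
  qed
  then have "poly_eval (\<lambda>x. x) (\<lambda>v. s ^ g v) P = poly p s"
    by (simp add: poly_eval_def p_def poly_sum poly_monom flip: M_def)
  with s show ?thesis
    by (intro exI[of _ "\<lambda>v. s ^ g v"]) auto
qed

text \<open>If the substitution killed a nonzero \<open>P\<close>, take a point \<open>c\<close> of
  the torus where \<open>P\<close> does not vanish and an \<open>a\<close> at which \<open>F\<close>
  takes the values \<open>c\<close>. Evaluating the substituted polynomial at \<open>a\<close>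
  returns the nonzero value of \<open>P\<close> at \<open>c\<close>.\<close>

lemma inj_poly_eval_if_torus_surj:
  fixes F :: "'v \<Rightarrow> ('w::linorder \<Rightarrow>\<^sub>0 nat) \<Rightarrow>\<^sub>0 complex"
  assumes surj: "\<And>c :: 'v \<Rightarrow> complex. (\<And>v. c v \<noteq> 0) \<Longrightarrow> \<exists>a. \<forall>v. poly_eval (\<lambda>x. x) a (F v) = c v"
  shows "inj (poly_eval (Poly_Mapping.single 0) F)"
proof -
  interpret comm_ring_hom "poly_eval (Poly_Mapping.single 0) F"
    by (rule comm_ring_hom_poly_eval[OF comm_ring_hom_const])
  have "P = 0" if P: "poly_eval (Poly_Mapping.single 0) F P = 0" for P
  proof (rule ccontr)
    assume "P \<noteq> 0"
    then obtain c where c: "\<And>v. c v \<noteq> 0" "poly_eval (\<lambda>x. x) c P \<noteq> 0"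
      using nonzero_on_torus by blast
    obtain a where a: "\<And>v. poly_eval (\<lambda>x. x) a (F v) = c v"
      using surj[of c] c(1) by blast
    have "poly_eval (\<lambda>x. x) a (poly_eval (Poly_Mapping.single 0) F P) = poly_eval (\<lambda>x. x) c P"
      by (simp add: hom_poly_eval[OF comm_ring_hom_poly_eval[OF comm_ring_hom_ident]] a
          poly_eval_single[OF comm_ring_hom_ident] monom_eval_def)
    then show False
      using c P by (simp add: poly_eval_def)
  qed
  then show ?thesis
    by (metis (no_types, lifting) eq_iff_diff_eq_0 hom_minus injI)
qed

text \<open>A ring map passes to fractions only if nonzero denominators stay nonzero. The value is
  therefore defined through a chosen representative, and is independent of the choice for injective
  \<open>g\<close>.\<close>

definition fract_map :: "('a::idom \<Rightarrow> 'b::idom) \<Rightarrow> 'a fract \<Rightarrow> 'b fract" where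
  "fract_map g q = (SOME r. \<exists>a b. b \<noteq> 0 \<and> q = Fract a b \<and> r = Fract (g a) (g b))"

lemma fract_map_Fract:
  assumes "comm_ring_hom g" "inj g" "b \<noteq> 0"
  shows "fract_map g (Fract a b) = Fract (g a) (g b)"
proof -
  interpret comm_ring_hom g by fact
  have nz: "g x \<noteq> 0" if "x \<noteq> 0" for x
    using that assms(2) by (metis hom_zero injD)
  have "\<exists>r a' b'. b' \<noteq> 0 \<and> Fract a b = Fract a' b' \<and> r = Fract (g a') (g b')"
    using assms(3) by blast
  from someI_ex[OF this] obtain a' b' where *: "b' \<noteq> 0" "Fract a b = Fract a' b'"
      "fract_map g (Fract a b) = Fract (g a') (g b')"
    unfolding fract_map_def by auto
  then have "a * b' = a' * b"
    using assms(3) by (simp add: eq_fract)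
  then have "g a * g b' = g a' * g b"
    by (metis hom_mult)
  with * nz assms(3) show ?thesis
    by (simp add: eq_fract)
qed

lemma comm_ring_hom_fract_map:
  assumes "comm_ring_hom g" "inj g"
  shows "comm_ring_hom (fract_map g)"
proof -
  interpret comm_ring_hom g by fact
  note F = fract_map_Fract[OF assms]
  have nz: "g x \<noteq> 0" if "x \<noteq> 0" for x
    using that assms(2) by (metis hom_zero injD)
  show ?thesis
  proof
    show "fract_map g (x + y) = fract_map g x + fract_map g y" for x y
      by (cases x; cases y) (simp add: F nz hom_add hom_mult)
    show "fract_map g (x * y) = fract_map g x * fract_map g y" for x y
      by (cases x; cases y) (simp add: F nz hom_mult)
    show "fract_map g 0 = 0" "fract_map g 1 = 1"
      unfolding Zero_fract_def One_fract_def by (simp_all add: F)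
  qed
qed

lemma comm_ring_hom_to_fract: "comm_ring_hom (\<lambda>a. Fract a 1)"
  by unfold_locales (auto simp: Zero_fract_def One_fract_def)

section \<open>Cluster structures under field embeddings\<close>

lemma inj_field_hom:
  fixes \<psi> :: "'a::field \<Rightarrow> 'b::field"
  assumes "comm_ring_hom \<psi>"
  shows "inj \<psi>"
proof (rule injI)
  interpret comm_ring_hom \<psi> by fact
  fix x y assume "\<psi> x = \<psi> y"
  then have "\<psi> (x - y) = 0"
    by (simp add: hom_minus)
  then have "x - y = 0"
    by (metis hom_mult hom_one mult_zero_left right_inverse zero_neq_one)
  then show "x = y" by simp
qed

text \<open>The map \<open>\<psi>\<close> goes from the field of \<open>T\<close> to that of
  \<open>S\<close>. Variables are compared by equations under one map rather than by a relation,
  which is what lets the property survive mutation.\<close>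

definition seed_match ::
    "('w \<Rightarrow> 'v) \<Rightarrow> ('g \<Rightarrow> 'f) \<Rightarrow> ('w, 'g) seed \<Rightarrow> ('v, 'f) seed \<Rightarrow> bool" where
  "seed_match \<phi> \<psi> T S \<longleftrightarrow>
     bij_betw \<phi> (verts T) (verts S) \<and>
     \<phi> ` mutable T = mutable S \<and> \<phi> ` frozen T = frozen S \<and>
     (\<forall>v\<in>verts T. var S (\<phi> v) = \<psi> (var T v)) \<and>
     (\<forall>u\<in>verts T. \<forall>v\<in>verts T. arrows S (\<phi> u) (\<phi> v) = arrows T u v)"

lemma mutate_sel [simp]:
  "mutable (mutate v S) = mutable S" "frozen (mutate v S) = frozen S"
  "verts (mutate v S) = verts S"
  by (simp_all add: mutate_def verts_def)

text \<open>The exchange formula uses only field operations and products over all vertices, so a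
  field homomorphism carries it along the bijection \<open>\<phi>\<close>. That
  \<open>\<phi>\<close> reflects frozenness enters in the rule deleting arrows between frozen
  vertices.\<close>

lemma seed_match_mutate:
  fixes \<psi> :: "'g::field \<Rightarrow> 'f::field"
  assumes \<psi>: "comm_ring_hom \<psi>" and m: "seed_match \<phi> \<psi> T S" and v: "v \<in> mutable T"
  shows "seed_match \<phi> \<psi> (mutate v T) (mutate (\<phi> v) S)"
proof -
  interpret comm_ring_hom \<psi> by fact
  have inv: "\<psi> (inverse x) = inverse (\<psi> x)" for x
  proof (cases "x = 0")
    case False
    then have "\<psi> x * \<psi> (inverse x) = 1"
      by (metis hom_mult hom_one right_inverse)
    then show ?thesis
      by (metis inverse_unique)
  qed simp
  have bij: "bij_betw \<phi> (verts T) (verts S)" and mu: "\<phi> ` mutable T = mutable S"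
    and fr: "\<phi> ` frozen T = frozen S"
    and var: "\<And>v. v \<in> verts T \<Longrightarrow> var S (\<phi> v) = \<psi> (var T v)"
    and arr: "\<And>u v. u \<in> verts T \<Longrightarrow> v \<in> verts T \<Longrightarrow> arrows S (\<phi> u) (\<phi> v) = arrows T u v"
    using m by (auto simp: seed_match_def)
  have vV: "v \<in> verts T" and sub: "frozen T \<subseteq> verts T"
    using v by (auto simp: verts_def)
  have inj: "inj_on \<phi> (verts T)"
    using bij by (rule bij_betw_imp_inj_on)
  have eq: "\<phi> u = \<phi> w \<longleftrightarrow> u = w" if "u \<in> verts T" "w \<in> verts T" for u w
    using inj that by (auto dest: inj_onD)
  have frm: "\<phi> u \<in> frozen S \<longleftrightarrow> u \<in> frozen T" if "u \<in> verts T" for u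
    using inj that sub unfolding fr[symmetric] by (auto dest: inj_onD)
  have P1: "(\<Prod>u\<in>verts S. var S u ^ nat (arrows S u (\<phi> v))) = \<psi> (\<Prod>u\<in>verts T. var T u ^ nat (arrows T u v))"
    unfolding hom_prod hom_power using var arr vV
    by (subst prod.reindex_bij_betw[OF bij, symmetric]) (auto intro!: prod.cong)
  have P2: "(\<Prod>u\<in>verts S. var S u ^ nat (arrows S (\<phi> v) u)) = \<psi> (\<Prod>u\<in>verts T. var T u ^ nat (arrows T v u))"
    unfolding hom_prod hom_power using var arr vV
    by (subst prod.reindex_bij_betw[OF bij, symmetric]) (auto intro!: prod.cong)
  have "var (mutate (\<phi> v) S) (\<phi> u) = \<psi> (var (mutate v T) u)" if "u \<in> verts T" for u
    using that eq[OF that vV] P1 P2 var[OF that] var[OF vV]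
    by (simp add: mutate_def hom_mult hom_add divide_inverse inv)
  moreover have "arrows (mutate (\<phi> v) S) (\<phi> u) (\<phi> w) = arrows (mutate v T) u w"
    if "u \<in> verts T" "w \<in> verts T" for u w
    using that eq[OF that(1) vV] eq[OF that(2) vV]
    by (simp add: mutate_def frm arr vV)
  ultimately show ?thesis
    using bij mu fr by (auto simp: seed_match_def)
qed

lemma seed_match_mutation_class:
  fixes \<psi> :: "'g::field \<Rightarrow> 'f::field"
  assumes \<psi>: "comm_ring_hom \<psi>" and m: "seed_match \<phi> \<psi> T S"
  shows "T' \<in> mutation_class T \<Longrightarrow> \<exists>S'\<in>mutation_class S. seed_match \<phi> \<psi> T' S'"
    and "S' \<in> mutation_class S \<Longrightarrow> \<exists>T'\<in>mutation_class T. seed_match \<phi> \<psi> T' S'"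
proof -
  show "\<exists>S'\<in>mutation_class S. seed_match \<phi> \<psi> T' S'" if "T' \<in> mutation_class T"
    using that
  proof induction
    case initial
    then show ?case using m mutation_class.initial by blast
  next
    case (mutation T' v)
    then obtain S' where S': "S' \<in> mutation_class S" "seed_match \<phi> \<psi> T' S'"
      by blast
    then have "\<phi> v \<in> mutable S'"
      using mutation.hyps by (auto simp: seed_match_def)
    with S' mutation.hyps show ?case
      by (meson \<psi> mutation_class.mutation seed_match_mutate)
  qed
  show "\<exists>T'\<in>mutation_class T. seed_match \<phi> \<psi> T' S'" if "S' \<in> mutation_class S"
    using that
  proof induction
    case initial
    then show ?case using m mutation_class.initial by blast
  next
    case (mutation S' w)
    then obtain T' where T': "T' \<in> mutation_class T" "seed_match \<phi> \<psi> T' S'"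
      by blast
    then obtain v where "v \<in> mutable T'" "w = \<phi> v"
      using mutation.hyps unfolding seed_match_def by (metis image_iff)
    with T' show ?case
      by (meson \<psi> mutation_class.mutation seed_match_mutate)
  qed
qed

lemma mutation_class_frozen:
  assumes "T \<in> mutation_class S" "mutable S \<inter> frozen S = {}"
  shows "mutable T = mutable S \<and> frozen T = frozen S \<and> (\<forall>v\<in>frozen S. var T v = var S v)"
  using assms(1)
proof induction
  case (mutation T v)
  then have "\<forall>u\<in>frozen S. u \<noteq> v"
    using assms(2) by auto
  with mutation.IH show ?case
    by (auto simp: mutate_def)
qed auto

lemma var_in_cluster_algebra:
  assumes "T \<in> mutation_class S" "mutable S \<inter> frozen S = {}" "v \<in> verts T"
  shows "var T v \<in> cluster_algebra S"
  using mutation_class_frozen[OF assms(1,2)] assms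
  by (auto simp: verts_def intro: cluster_algebra.cluster_var cluster_algebra.frozen_var
      simp flip: ball_simps)

text \<open>Each inclusion is an induction over the generation of one algebra; generators correspond
  because every mutated seed on either side has a matching one on the other.\<close>

lemma seed_match_cluster_algebra:
  fixes \<psi> :: "'b::linorder ratfun \<Rightarrow> 'a::linorder ratfun"
  assumes \<psi>: "comm_ring_hom \<psi>" and sc: "\<And>c. \<psi> (scalar c) = scalar c"
    and m: "seed_match \<phi> \<psi> T S"
  shows "cluster_algebra S = \<psi> ` cluster_algebra T"
proof -
  interpret comm_ring_hom \<psi> by fact
  have "\<psi> a \<in> cluster_algebra S" if "a \<in> cluster_algebra T" for a
    using that
  proof induction
    case (scalar c)
    then show ?case using sc cluster_algebra.scalar by metis
  next
    case (frozen_var v)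
    then have "\<psi> (var T v) = var S (\<phi> v)" "\<phi> v \<in> frozen S"
      using m by (auto simp: seed_match_def verts_def)
    then show ?case by (metis cluster_algebra.frozen_var)
  next
    case (cluster_var T' v)
    then obtain S' where S': "S' \<in> mutation_class S" "seed_match \<phi> \<psi> T' S'"
      using seed_match_mutation_class(1)[OF \<psi> m] by blast
    then have "\<psi> (var T' v) = var S' (\<phi> v)" "\<phi> v \<in> mutable S'"
      using cluster_var by (auto simp: seed_match_def verts_def)
    with S' show ?case by (metis cluster_algebra.cluster_var)
  qed (auto simp: hom_add hom_mult intro: cluster_algebra.add cluster_algebra.mult)
  moreover have "a \<in> \<psi> ` cluster_algebra T" if "a \<in> cluster_algebra S" for a
    using that
  proof induction
    case (scalar c)
    then show ?case using sc cluster_algebra.scalar by (metis imageI)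
  next
    case (frozen_var w)
    then obtain v where "v \<in> frozen T" "w = \<phi> v"
      using m unfolding seed_match_def by (metis image_iff)
    then have "var S w = \<psi> (var T v)"
      using m by (auto simp: seed_match_def verts_def)
    moreover have "var T v \<in> cluster_algebra T"
      using \<open>v \<in> frozen T\<close> by (rule cluster_algebra.frozen_var)
    ultimately show ?case by simp
  next
    case (cluster_var S' w)
    then obtain T' where T': "T' \<in> mutation_class T" "seed_match \<phi> \<psi> T' S'"
      using seed_match_mutation_class(2)[OF \<psi> m] by blast
    then obtain v where "v \<in> mutable T'" "w = \<phi> v"
      using cluster_var unfolding seed_match_def by (metis image_iff)
    then have "var S' w = \<psi> (var T' v)"
      using T' by (auto simp: seed_match_def verts_def)
    moreover have "var T' v \<in> cluster_algebra T"
      using T'(1) \<open>v \<in> mutable T'\<close> by (rule cluster_algebra.cluster_var)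
    ultimately show ?case by simp
  next
    case (add a b)
    then show ?case by (auto simp flip: hom_add intro: cluster_algebra.add)
  next
    case (mult a b)
    then show ?case by (auto simp flip: hom_mult intro: cluster_algebra.mult)
  qed
  ultimately show ?thesis by blast
qed

text \<open>\<open>seeds_coincide\<close> asks for a vertex map from \<open>S\<close> to
  \<open>T\<close>, against the direction of \<open>\<phi>\<close>, so the bijection is inverted
  here.\<close>

lemma seed_match_seeds_coincide:
  assumes m: "seed_match \<phi> \<psi> T S" and R: "\<And>v. v \<in> verts T \<Longrightarrow> (\<psi> (var T v), var T v) \<in> R"
  shows "seeds_coincide R S T"
proof -
  define \<chi> where "\<chi> = inv_into (verts T) \<phi>"
  have bij: "bij_betw \<phi> (verts T) (verts S)" and mu: "\<phi> ` mutable T = mutable S"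
    and fr: "\<phi> ` frozen T = frozen S"
    and var: "\<And>v. v \<in> verts T \<Longrightarrow> var S (\<phi> v) = \<psi> (var T v)"
    and arr: "\<And>u v. u \<in> verts T \<Longrightarrow> v \<in> verts T \<Longrightarrow> arrows S (\<phi> u) (\<phi> v) = arrows T u v"
    using m by (auto simp: seed_match_def)
  have bij': "bij_betw \<chi> (verts S) (verts T)"
    unfolding \<chi>_def using bij by (rule bij_betw_inv_into)
  have \<chi>: "\<chi> (\<phi> v) = v" if "v \<in> verts T" for v
    unfolding \<chi>_def using bij that by (simp add: bij_betw_inv_into_left)
  have \<phi>: "\<phi> (\<chi> w) = w" and \<chi>V: "\<chi> w \<in> verts T" if "w \<in> verts S" for w
    using bij bij' that by (auto simp: \<chi>_def bij_betw_inv_into_right bij_betw_apply)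
  have im: "\<chi> ` \<phi> ` A = A" if "A \<subseteq> verts T" for A
    using that \<chi> by (force simp: image_image)
  have "\<chi> ` mutable S = mutable T" "\<chi> ` frozen S = frozen T"
    unfolding mu[symmetric] fr[symmetric] by (rule im; simp add: verts_def)+
  moreover have "(var S w, var T (\<chi> w)) \<in> R" if "w \<in> verts S" for w
    using var[OF \<chi>V[OF that]] R[OF \<chi>V[OF that]] \<phi>[OF that] by simp
  moreover have "arrows T (\<chi> u) (\<chi> w) = arrows S u w" if "u \<in> verts S" "w \<in> verts S" for u w
    using arr[OF \<chi>V[OF that(1)] \<chi>V[OF that(2)]] \<phi>[OF that(1)] \<phi>[OF that(2)] by simp
  ultimately show ?thesis
    using bij' unfolding seeds_coincide_def by blast
qed

lemma seed_match_cluster_structures_coincide: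
  fixes \<psi> :: "'b::linorder ratfun \<Rightarrow> 'a::linorder ratfun"
  assumes \<psi>: "comm_ring_hom \<psi>" and sc: "\<And>c. \<psi> (scalar c) = scalar c"
    and m: "seed_match \<phi> \<psi> T S" and disj: "mutable T \<inter> frozen T = {}"
    and R: "\<And>a b. (a, b) \<in> R \<Longrightarrow> a = \<psi> b"
  shows "cluster_structures_coincide R S T"
proof -
  interpret comm_ring_hom \<psi> by fact
  have inj: "inj \<psi>"
    by (rule inj_field_hom[OF \<psi>])
  \<comment> \<open>Only the values on the range of \<open>\<psi>\<close> are meaningful; the
    cluster algebra of \<open>S\<close> lies inside it.\<close>
  define \<theta> where "\<theta> = inv_into UNIV \<psi>"
  have \<theta>: "\<theta> (\<psi> x) = x" for x
    unfolding \<theta>_def using inj by simp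
  note CA = seed_match_cluster_algebra[OF \<psi> sc m]
  let ?\<Theta> = "{(a, \<theta> a) |a. a \<in> cluster_algebra S}"
  have coin: "seeds_coincide ?\<Theta> S' T'" if "T' \<in> mutation_class T" "seed_match \<phi> \<psi> T' S'" for S' T'
    by (rule seed_match_seeds_coincide[OF that(2)])
      (use var_in_cluster_algebra[OF that(1) disj] \<theta> in \<open>auto simp: CA\<close>)
  have "bij_betw \<theta> (cluster_algebra S) (cluster_algebra T)"
    unfolding CA using inj by (auto simp: bij_betw_def \<theta> image_image inj_on_def)
  moreover have "\<theta> (scalar c) = scalar c" for c
    by (metis \<theta> sc)
  moreover have "\<theta> (a + b) = \<theta> a + \<theta> b \<and> \<theta> (a * b) = \<theta> a * \<theta> b"
    if "a \<in> cluster_algebra S" "b \<in> cluster_algebra S" for a b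
    using that unfolding CA by (auto simp: \<theta> simp flip: hom_add hom_mult)
  moreover have "\<forall>(a, b)\<in>R. \<theta> a = b"
    using R \<theta> by auto
  moreover have "\<forall>S'\<in>mutation_class S. \<exists>T'\<in>mutation_class T. seeds_coincide ?\<Theta> S' T'"
    using seed_match_mutation_class(2)[OF \<psi> m] coin by blast
  moreover have "\<forall>T'\<in>mutation_class T. \<exists>S'\<in>mutation_class S. seeds_coincide ?\<Theta> S' T'"
    using seed_match_mutation_class(1)[OF \<psi> m] coin by blast
  ultimately show ?thesis
    unfolding cluster_structures_coincide_def Let_def by blast
qed

section \<open>Prescribing minors of a matrix\<close>

text \<open>The column index comes first in \<open>a\<close>, so that replacing a column is a
  function update. Lists rather than sets admit columns in any order and repeated columns.\<close>

definition list_minor :: "(nat \<Rightarrow> nat \<Rightarrow> 'a::comm_ring_1) \<Rightarrow> nat list \<Rightarrow> 'a" where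
  "list_minor a xs = det (mat (length xs) (length xs) (\<lambda>(i, j). a (xs ! j) i))"

definition col_minor :: "(nat \<Rightarrow> nat \<Rightarrow> 'a::comm_ring_1) \<Rightarrow> nat set \<Rightarrow> 'a" where
  "col_minor a K = list_minor a (sorted_list_of_set K)"

lemma list_minor_cong:
  assumes "\<And>x. x \<in> set xs \<Longrightarrow> a x = b x"
  shows "list_minor a xs = list_minor b xs"
  unfolding list_minor_def using assms
  by (intro arg_cong[of _ _ det] cong_mat) auto

lemma list_minor_map: "list_minor a (map f xs) = list_minor (a \<circ> f) xs"
  unfolding list_minor_def by (simp, intro arg_cong[of _ _ det] cong_mat) auto

lemma col_minor_cong:
  assumes "finite K" "\<And>x. x \<in> K \<Longrightarrow> a x = b x"
  shows "col_minor a K = col_minor b K"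
  unfolding col_minor_def by (rule list_minor_cong) (use assms in auto)

text \<open>Transposition turns the reordering of columns into one of rows. The sign is left open,
  since the later applications only ask whether a minor vanishes.\<close>

lemma list_minor_permute:
  assumes "mset xs = mset ys"
  shows "list_minor a xs = list_minor a ys \<or> list_minor a xs = - list_minor a ys"
proof -
  let ?n = "length ys"
  obtain p where p: "p permutes {..<?n}" "permute_list p ys = xs"
    using mset_eq_permutation[OF assms] by blast
  have len: "length xs = ?n"
    using assms by (metis size_mset)
  define A where "A = mat ?n ?n (\<lambda>(j, i). a (ys ! j) i)"
  have A: "A \<in> carrier_mat ?n ?n"
    by (simp add: A_def)
  have p': "p permutes {0..<?n}"
    using p(1) by (simp add: atLeast0LessThan)
  have bound: "p j < ?n" if "j < ?n" for j
    using permutes_in_image[OF p(1), of j] that by simp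
  have "list_minor a xs = det (transpose_mat (mat ?n ?n (\<lambda>(i, j). A $$ (p i, j))))"
    unfolding list_minor_def len
    by (intro arg_cong[of _ _ det] eq_matI)
      (auto simp: A_def bound simp flip: p(2) intro!: arg_cong2[of _ _ _ _ a] permute_list_nth[OF p(1)])
  also have "\<dots> = signof p * det A"
    by (subst det_transpose[of _ ?n]) (auto simp: det_permute_rows[OF A p'])
  also have "det A = list_minor a ys"
    unfolding list_minor_def
    by (subst det_transpose[OF A, symmetric], intro arg_cong[of _ _ det] eq_matI) (auto simp: A_def)
  finally show ?thesis
    by (auto simp: sign_def split: if_splits)
qed

text \<open>In the Laplace expansion along column \<open>x\<close> the cofactors do not involve this
  column, so the minor is a fixed linear form in its entries. Filling the column with zeros serves
  to name the cofactors.\<close>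

lemma list_minor_linear:
  assumes "distinct xs" "x \<in> set xs"
  shows "list_minor (a(x := \<lambda>i. \<Sum>y\<in>Y. z y * b y i)) xs = (\<Sum>y\<in>Y. z y * list_minor (a(x := b y)) xs)"
proof -
  let ?n = "length xs"
  obtain j where j: "j < ?n" "xs ! j = x"
    using assms(2) by (auto simp: in_set_conv_nth)
  have ne: "xs ! j' \<noteq> x" if "j' < ?n" "j' \<noteq> j" for j'
    using assms(1) j that by (auto simp: nth_eq_iff_index_eq)
  let ?M = "\<lambda>c. mat ?n ?n (\<lambda>(i, j). (a(x := c)) (xs ! j) i)"
  define D where "D = (\<lambda>i. cofactor (?M (\<lambda>_. 0)) i j)"
  have cof: "cofactor (?M c) i j = D i" if "i < ?n" for c i
    unfolding cofactor_def D_def mat_delete_def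
    by (intro arg_cong2[of _ _ _ _ "(*)"] arg_cong[of _ _ det] cong_mat)
      (use ne j(1) in \<open>auto\<close>)
  have exp: "list_minor (a(x := c)) xs = (\<Sum>i<?n. c i * D i)" for c
  proof -
    have "list_minor (a(x := c)) xs = (\<Sum>i<?n. ?M c $$ (i, j) * cofactor (?M c) i j)"
      unfolding list_minor_def by (rule laplace_expansion_column) (use j in auto)
    also have "\<dots> = (\<Sum>i<?n. c i * D i)"
      by (rule sum.cong) (use j cof in auto)
    finally show ?thesis .
  qed
  show ?thesis
    unfolding exp sum_distrib_right sum_distrib_left
    by (subst sum.swap) (simp add: mult.assoc)
qed

lemma col_minor_linear:
  assumes "finite K" "x \<in> K"
  shows "col_minor (a(x := \<lambda>i. \<Sum>y\<in>Y. z y * b y i)) K = (\<Sum>y\<in>Y. z y * col_minor (a(x := b y)) K)"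
  unfolding col_minor_def by (rule list_minor_linear) (use assms in auto)

lemma col_minor_add_mult:
  assumes "finite K" "x \<in> K"
  shows "col_minor (a(x := \<lambda>i. a x i + z * b i)) K = col_minor a K + z * col_minor (a(x := b)) K"
proof -
  \<comment> \<open>A sum of two terms, indexed by the booleans.\<close>
  let ?z = "\<lambda>y. if y then 1 else z" and ?b = "\<lambda>y. if y then a x else b"
  have "col_minor (a(x := \<lambda>i. \<Sum>y\<in>UNIV. ?z y * ?b y i)) K = (\<Sum>y\<in>UNIV. ?z y * col_minor (a(x := ?b y)) K)"
    by (rule col_minor_linear[OF assms])
  then show ?thesis
    by (simp add: UNIV_bool add.commute)
qed

lemma col_minor_repeated:
  assumes "finite K" "x \<in> K" "y \<in> K" "x \<noteq> y"
  shows "col_minor (a(x := a y)) K = 0"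
proof -
  define xs where "xs = sorted_list_of_set K"
  have "x \<in> set xs" "y \<in> set xs"
    using assms by (auto simp: xs_def)
  then obtain i j where ij: "i < length xs" "xs ! i = x" "j < length xs" "xs ! j = y"
    by (metis in_set_conv_nth)
  show ?thesis
    unfolding col_minor_def list_minor_def xs_def[symmetric]
    by (rule det_identical_columns[of _ "length xs" i j]) (use ij assms in \<open>auto intro!: eq_vecI\<close>)
qed

text \<open>The copy of column \<open>y\<close> stands at the place of \<open>x\<close> instead of
  its sorted place, and moving it there may cost a sign.\<close>

lemma col_minor_exchange:
  assumes "finite K" "x \<in> K" "y \<notin> K"
  shows "col_minor (a(x := a y)) K = col_minor a (insert y (K - {x})) \<or>
    col_minor (a(x := a y)) K = - col_minor a (insert y (K - {x}))"
proof -
  define xs where "xs = sorted_list_of_set K"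
  have xs: "distinct xs" "set xs = K"
    using assms by (auto simp: xs_def)
  let ?f = "id(x := y)"
  let ?ys = "sorted_list_of_set (insert y (K - {x}))"
  have "inj_on ?f K"
    using assms by (auto simp: inj_on_def)
  then have dist: "distinct (map ?f xs)"
    using xs by (simp add: distinct_map)
  have "set (map ?f xs) = insert y (K - {x})"
    using assms(2) by (simp only: set_map xs(2) fun_upd_image if_True image_id id_apply)
  also have "\<dots> = set ?ys"
    by (rule set_sorted_list_of_set[symmetric]) (use assms(1) in simp)
  finally have *: "mset (map ?f xs) = mset ?ys"
    using set_eq_iff_mset_eq_distinct[OF dist, of ?ys] by simp
  have "col_minor (a(x := a y)) K = list_minor a (map ?f xs)"
    unfolding col_minor_def xs_def[symmetric] list_minor_map
    by (rule list_minor_cong) auto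
  then show ?thesis
    using list_minor_permute[OF *, of a] by (simp add: col_minor_def)
qed

text \<open>Adding a multiple of column \<open>e p\<close> to column \<open>x p\<close> changes, among the minors of level at most
  that of \<open>p\<close>, only the one with index \<open>p\<close>, and this one by a nonzero multiple.\<close>

lemma prescribed_minors:
  fixes a0 :: "nat \<Rightarrow> nat \<Rightarrow> 'a::field" and level :: "'p \<Rightarrow> nat"
  assumes "finite P"
    and "\<And>p. p \<in> P \<Longrightarrow> finite (L p) \<and> x p \<in> L p \<and> x p \<notin> F \<and> e p \<in> F \<and> e p \<notin> L p"
    and "\<And>p q. p \<in> P \<Longrightarrow> q \<in> P \<Longrightarrow> q \<noteq> p \<Longrightarrow> level q \<le> level p \<Longrightarrow> x p \<in> L q \<Longrightarrow> e p \<in> L q"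
    and "\<And>p. p \<in> P \<Longrightarrow> (\<exists>q\<in>P. level q < level p \<and> insert (e p) (L p - {x p}) = L q) \<or>
      insert (e p) (L p - {x p}) \<subseteq> F \<and> col_minor a0 (insert (e p) (L p - {x p})) \<noteq> 0"
    and "\<And>p. p \<in> P \<Longrightarrow> c p \<noteq> 0"
  shows "\<exists>a. (\<forall>y\<in>F. a y = a0 y) \<and> (\<forall>p\<in>P. col_minor a (L p) = c p)"
  using assms
\<comment> \<open>Indices are inserted in order of nondecreasing level, so every minor already
  adjusted has level at most that of the new index.\<close>
proof (induction P rule: finite_ranking_induct[where f = level])
  case empty
  then show ?case by blast
next
  case (insert p P)
  show ?case
  proof (cases "p \<in> P")
    case True
    then have eq: "insert p P = P"
      by blast
    show ?thesis
      unfolding eq by (rule insert.IH; (rule insert.prems[unfolded eq]; assumption)?)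
  next
    case False
    have "\<exists>a. (\<forall>y\<in>F. a y = a0 y) \<and> (\<forall>p\<in>P. col_minor a (L p) = c p)"
    proof (rule insert.IH)
      \<comment> \<open>The witness cannot be \<open>p\<close>, whose level is at least that of
        \<open>r\<close>.\<close>
      show "(\<exists>q\<in>P. level q < level r \<and> insert (e r) (L r - {x r}) = L q) \<or>
        insert (e r) (L r - {x r}) \<subseteq> F \<and> col_minor a0 (insert (e r) (L r - {x r})) \<noteq> 0" if "r \<in> P" for r
        using insert.prems(3)[of r] insert.hyps(2)[OF that] that by fastforce
    qed (use insert.prems in blast)+
    then obtain a where a: "\<And>y. y \<in> F \<Longrightarrow> a y = a0 y" "\<And>q. q \<in> P \<Longrightarrow> col_minor a (L q) = c q"
      by blast
    have p: "finite (L p)" "x p \<in> L p" "x p \<notin> F" "e p \<in> F" "e p \<notin> L p" and ne: "x p \<noteq> e p"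
      using insert.prems(1)[of p] by auto
    let ?K = "insert (e p) (L p - {x p})"
    let ?d = "col_minor (a(x p := a (e p))) (L p)"
    have "col_minor a ?K \<noteq> 0"
    proof -
      consider q where "q \<in> insert p P" "level q < level p" "?K = L q"
        | "?K \<subseteq> F" "col_minor a0 ?K \<noteq> 0"
        using insert.prems(3)[of p] by blast
      then show ?thesis
      proof cases
        case 1
        then show ?thesis
          using a(2)[of q] insert.prems(4)[of q] by auto
      next
        case 2
        then have "col_minor a ?K = col_minor a0 ?K"
          using a(1) p(1) by (intro col_minor_cong) auto
        with 2 show ?thesis by simp
      qed
    qed
    then have d: "?d \<noteq> 0"
      using col_minor_exchange[OF p(1,2,5), of a] by auto
    \<comment> \<open>The minor of \<open>L p\<close> is affine in the multiplier with slope
      \<open>?d\<close>, which up to sign is the minor after the exchange and hence nonzero.\<close>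
    define z where "z = (c p - col_minor a (L p)) / ?d"
    define a' where "a' = a(x p := \<lambda>i. a (x p) i + z * a (e p) i)"
    have "col_minor a' (L p) = c p"
      unfolding a'_def col_minor_add_mult[OF p(1,2)] using d by (simp add: z_def)
    moreover have "col_minor a' (L q) = c q" if q: "q \<in> P" for q
    proof (cases "x p \<in> L q")
      case True
      have fin: "finite (L q)"
        using insert.prems(1)[of q] q by blast
      have "e p \<in> L q"
        using insert.prems(2)[of p q] insert.hyps(2)[OF q] False q True by auto
      then have "col_minor a' (L q) = col_minor a (L q)"
        unfolding a'_def col_minor_add_mult[OF fin True]
        using col_minor_repeated[OF fin True _ ne, of a] by simp
      then show ?thesis using a(2)[OF q] by simp
    next
      case False
      then have "col_minor a' (L q) = col_minor a (L q)"
        using insert.prems(1)[of q] q by (intro col_minor_cong) (auto simp: a'_def)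
      then show ?thesis using a(2)[OF q] by simp
    qed
    moreover have "a' y = a0 y" if "y \<in> F" for y
      using a(1)[OF that] p(3) that by (auto simp: a'_def)
    ultimately have "(\<forall>y\<in>F. a' y = a0 y) \<and> (\<forall>q\<in>insert p P. col_minor a' (L q) = c q)"
      by simp
    then show ?thesis
      by (intro exI[of _ a'])
  qed
qed

text \<open>The columns with indices \<open>2, 4, \<dots>, 2 * (d + 1)\<close> are the unit vectors and the negative of
  their sum, so that any \<open>d\<close> of them are independent.\<close>

definition even_columns :: "nat \<Rightarrow> nat \<Rightarrow> nat \<Rightarrow> 'a::comm_ring_1" where
  "even_columns d y i = (if y = 2 * d + 2 then - 1 else if y = 2 * i + 2 then 1 else 0)"

text \<open>Leaving out the last column gives the identity matrix. Otherwise the last column is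
  expanded as minus the sum of the unit vectors: all terms but one repeat a column, and the
  remaining one is the identity minor up to sign.\<close>

lemma even_columns_minor:
  assumes c: "c \<in> {1..d + 1}"
  shows "col_minor (even_columns d :: nat \<Rightarrow> nat \<Rightarrow> 'a::field) ((\<lambda>x. 2 * x) ` ({1..d + 1} - {c})) \<noteq> 0"
proof -
  let ?a = "even_columns d :: nat \<Rightarrow> nat \<Rightarrow> 'a"
  let ?K = "\<lambda>c. (\<lambda>x. 2 * x) ` ({1..d + 1} - {c})"
  have last: "col_minor ?a (?K (d + 1)) = 1"
  proof -
    have "sorted_list_of_set (?K (d + 1)) = map (\<lambda>i. 2 * i + 2) [0..<d]"
    proof (rule sorted_distinct_set_unique)
      show "set (sorted_list_of_set (?K (d + 1))) = set (map (\<lambda>i. 2 * i + 2) [0..<d])"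
      proof -
        have "{1..d + 1} - {d + 1} = Suc ` {0..<d}"
          unfolding image_Suc_atLeastLessThan by auto
        then show ?thesis
          by (simp add: image_image del: image_Suc_atLeastLessThan)
      qed
      show "sorted (map (\<lambda>i. 2 * i + 2) [0..<d])" "distinct (map (\<lambda>i. 2 * i + 2) [0..<d])"
        by (auto simp: sorted_iff_nth_mono distinct_map inj_on_def)
    qed auto
    then have "col_minor ?a (?K (d + 1)) = det (1\<^sub>m d)"
      unfolding col_minor_def list_minor_def
      by (intro arg_cong[of _ _ det] eq_matI) (auto simp: even_columns_def)
    then show ?thesis by simp
  qed
  show ?thesis
  proof (cases "c = d + 1")
    case True
    then show ?thesis using last by simp
  next
    case False
    let ?x = "2 * (d + 1)" and ?y = "2 * c"
    have fin: "finite (?K c)" by simp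
    have x: "?x \<in> ?K c" using False by (intro image_eqI[of _ _ "d + 1"]) auto
    have y: "?y \<notin> ?K c" by auto
    \<comment> \<open>The relation between the columns holds in the first \<open>d\<close> rows,
      which are the rows of the minor.\<close>
    have "?a ?x i = (\<Sum>w\<in>{1..d}. - 1 * ?a (2 * w) i)" if "i < d" for i
    proof -
      have "(\<Sum>w\<in>{1..d}. - 1 * ?a (2 * w) i) = (\<Sum>w\<in>{1..d}. if w = i + 1 then - 1 else 0)"
        by (rule sum.cong) (auto simp: even_columns_def)
      also have "\<dots> = - 1"
        using that by simp
      finally show ?thesis
        by (simp add: even_columns_def)
    qed
    moreover have card: "card (?K c) = d"
      using c by (subst card_image) (auto simp: inj_on_def)
    ultimately have "col_minor ?a (?K c) = col_minor (?a(?x := \<lambda>i. \<Sum>w\<in>{1..d}. - 1 * ?a (2 * w) i)) (?K c)"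
      unfolding col_minor_def list_minor_def
      by (intro arg_cong[of _ _ det] cong_mat) (auto simp: card)
    also have "\<dots> = (\<Sum>w\<in>{1..d}. - 1 * col_minor (?a(?x := ?a (2 * w))) (?K c))"
      by (rule col_minor_linear[OF fin x])
    also have "\<dots> = (\<Sum>w\<in>{1..d}. if w = c then - col_minor (?a(?x := ?a ?y)) (?K c) else 0)"
    proof (rule sum.cong)
      fix w assume w: "w \<in> {1..d}"
      show "- 1 * col_minor (?a(?x := ?a (2 * w))) (?K c) =
        (if w = c then - col_minor (?a(?x := ?a ?y)) (?K c) else 0)"
      proof (cases "w = c")
        case False
        then have "2 * w \<in> ?K c" using w by auto
        then show ?thesis
          using col_minor_repeated[OF fin x, of "2 * w" ?a] w False by simp
      qed simp
    qed simp
    also have "\<dots> = - col_minor (?a(?x := ?a ?y)) (?K c)"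
      using c False by simp
    finally have *: "col_minor ?a (?K c) = - col_minor (?a(?x := ?a ?y)) (?K c)" .
    have "insert ?y (?K c - {?x}) = ?K (d + 1)"
      using c False by auto
    with col_minor_exchange[OF fin x y, of ?a] last
    have "col_minor (?a(?x := ?a ?y)) (?K c) \<noteq> 0"
      by auto
    with * show ?thesis by simp
  qed
qed

section \<open>Face labels\<close>

text \<open>An explicit case distinction in place of \<open>mod\<close> hands the later statements
  about cyclic windows to linear arithmetic.\<close>

lemma mod_add_small:
  fixes \<delta> c N :: int
  assumes "0 \<le> \<delta>" "\<delta> < N" "- N \<le> c" "c \<le> N"
  shows "(\<delta> + c) mod N = (if \<delta> + c < 0 then \<delta> + c + N else if \<delta> + c < N then \<delta> + c else \<delta> + c - N)"
proof -
  have "(\<delta> + c) mod N = (\<delta> + c + N) mod N" "(\<delta> + c) mod N = (\<delta> + c - N) mod N"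
    by (simp_all add: mod_diff_eq)
  with assms show ?thesis
    by (smt (verit, best) mod_pos_pos_trivial)
qed

lemma even_mod_even: "even (N::int) \<Longrightarrow> even (x mod N) \<longleftrightarrow> even x"
  by (simp add: dvd_mod_iff)

lemma wrap_range: "N > 0 \<Longrightarrow> wrap N x \<in> {1..N}"
  by (auto simp: wrap_def nat_less_iff Suc_le_eq)

lemma int_wrap: "N > 0 \<Longrightarrow> int (wrap N x) = (x - 1) mod int N + 1"
  by (simp add: wrap_def)

lemma wrap_cong: "N > 0 \<Longrightarrow> wrap N x = wrap N y \<longleftrightarrow> x mod int N = y mod int N"
proof -
  assume N: "N > 0"
  have "wrap N x = wrap N y \<longleftrightarrow> (x - 1) mod int N = (y - 1) mod int N"
    using int_wrap[OF N, of x] int_wrap[OF N, of y] by (metis add_right_cancel of_nat_eq_iff)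
  also have "\<dots> \<longleftrightarrow> x mod int N = y mod int N"
    by (metis diff_add_cancel mod_add_left_eq mod_diff_left_eq)
  finally show ?thesis .
qed

lemma wrap_mod: "N > 0 \<Longrightarrow> int (wrap N x) mod int N = x mod int N"
  unfolding int_wrap by (metis diff_add_cancel mod_add_left_eq)

lemma wrap_of_range: "i \<in> {1..N} \<Longrightarrow> wrap N (int i) = i"
  by (auto simp: wrap_def)

locale annulus =
  fixes n h :: nat
  assumes n_eq: "n = 2 * h + 1" and h_pos: "h \<ge> 1"
begin

abbreviation N :: int where "N \<equiv> 2 * int n"

lemma int_n: "int n = 2 * int h + 1"
  using n_eq by simp

lemma N_pos: "N > 0" and N_pos': "2 * n > 0"
  using n_eq by simp_all

text \<open>The faces of the plabic graph constructed below are indexed by a ring \<open>k \<le> h\<close> and an angle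
  \<open>t\<close> modulo \<open>2 * n\<close>, and \<open>lab k t\<close> is the label of the face \<open>(k, t)\<close>: the even elements missing
  from it lie in \<open>{t - k..t + k + 1}\<close>, its odd elements in \<open>{t + n - k + 1..t + n + k}\<close>.\<close>

definition in_lab :: "nat \<Rightarrow> int \<Rightarrow> int \<Rightarrow> bool" where
  "in_lab k t j \<longleftrightarrow>
     (if even j then \<not> (t - j + int k + 1) mod N < 2 * int k + 2
      else (t - j + int n + int k) mod N < 2 * int k)"

definition lab :: "nat \<Rightarrow> int \<Rightarrow> nat set" where
  "lab k t = {i \<in> {1..2 * n}. in_lab k t (int i)}"

text \<open>The parity of \<open>j\<close> is a separate condition because the residue of
  \<open>t - j\<close> fixes only the parity of the difference.\<close>

lemma in_lab_cong:
  assumes "(t - j) mod N = (t' - j') mod N" "even j \<longleftrightarrow> even j'"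
  shows "in_lab k t j \<longleftrightarrow> in_lab k t' j'"
proof -
  have "(t - j + c) mod N = (t' - j' + c) mod N" for c
    using assms(1) by (metis mod_add_left_eq)
  from this[of "int k + 1"] this[of "int n + int k"] assms(2) show ?thesis
    by (simp add: in_lab_def add.assoc)
qed

lemma even_wrap: "even (int (wrap (2 * n) j)) \<longleftrightarrow> even j"
  using wrap_mod[OF N_pos', of j] even_mod_even[of N] by (metis dvd_triv_left of_nat_mult of_nat_numeral)

lemma in_lab_wrap: "in_lab k t (int (wrap (2 * n) j)) \<longleftrightarrow> in_lab k t j"
  by (rule in_lab_cong)
    (use even_wrap wrap_mod[OF N_pos', of j] in \<open>auto intro: mod_diff_cong\<close>)

lemma wrap_in_lab: "wrap (2 * n) j \<in> lab k t \<longleftrightarrow> in_lab k t j"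
  using wrap_range[OF N_pos', of j] by (simp add: lab_def in_lab_wrap)

lemma in_lab_diff: "in_lab k t j \<longleftrightarrow>
    (if even j then \<not> ((t - j) mod N + (int k + 1)) mod N < 2 * int k + 2
      else ((t - j) mod N + (int n + int k)) mod N < 2 * int k)"
  unfolding in_lab_def mod_add_left_eq by (simp add: add.assoc)

lemma lab_mod: "lab k (t mod N) = lab k t"
proof -
  have "in_lab k (t mod N) j = in_lab k t j" for j
    by (rule in_lab_cong) (auto simp: mod_diff_left_eq)
  then show ?thesis
    by (simp add: lab_def)
qed

text \<open>Passing from ring \<open>k - 1\<close> to ring \<open>k\<close> replaces the even element \<open>old_elt k t\<close> by the odd
  element \<open>new_elt k t\<close>.\<close>

definition new_elt :: "nat \<Rightarrow> int \<Rightarrow> int" where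
  "new_elt k t = (if even (t - int k) then t + int n + int k else t + int n - int k + 1)"

definition old_elt :: "nat \<Rightarrow> int \<Rightarrow> int" where
  "old_elt k t = (if even (t - int k) then t - int k else t + int k + 1)"

lemma odd_n: "odd n" using n_eq by simp

lemma odd_new_elt: "odd (new_elt k t)" and even_old_elt: "even (old_elt k t)"
  using odd_n by (auto simp: new_elt_def old_elt_def)

lemma new_elt_in_lab: "1 \<le> k \<Longrightarrow> k \<le> h \<Longrightarrow> in_lab k t (new_elt k t)"
  using odd_new_elt[of k t] int_n by (auto simp: in_lab_def new_elt_def)

lemma old_elt_notin_lab: "k \<le> h \<Longrightarrow> \<not> in_lab k t (old_elt k t)"
  using even_old_elt[of k t] int_n by (auto simp: in_lab_def old_elt_def)

text \<open>Going inward by one ring shortens both windows by one position at each end. At the two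
  ends of a window the parities differ, so exactly one even number is regained and exactly one odd
  number is lost. With \<open>\<delta>\<close> the residue of \<open>t - j\<close> everything is a
  linear condition on \<open>\<delta>\<close>.\<close>

lemma lab_step:
  assumes k: "1 \<le> k" "k \<le> h"
  shows "in_lab (k - 1) t j \<longleftrightarrow>
    (j - old_elt k t) mod N = 0 \<or> in_lab k t j \<and> (j - new_elt k t) mod N \<noteq> 0"
proof -
  define \<delta> where "\<delta> = (t - j) mod N"
  have \<delta>: "0 \<le> \<delta>" "\<delta> < N"
    using N_pos by (auto simp: \<delta>_def)
  have par: "even \<delta> \<longleftrightarrow> even (t - j)"
    unfolding \<delta>_def by (rule even_mod_even) simp
  have eq: "(j - (t + c)) mod N = 0 \<longleftrightarrow> (\<delta> + c) mod N = 0" for c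
  proof -
    have "(\<delta> + c) mod N = (- (j - (t + c))) mod N"
      unfolding \<delta>_def mod_add_left_eq by (simp add: algebra_simps)
    then show ?thesis
      by (metis add.inverse_inverse dvd_minus_iff mod_0_imp_dvd dvd_imp_mod_0)
  qed
  have k': "int (k - 1) = int k - 1"
    using k by simp
  have e: "(j - old_elt k t) mod N = 0 \<longleftrightarrow> (\<delta> + (if even (t - int k) then - int k else int k + 1)) mod N = 0"
    using eq[of "- int k"] eq[of "int k + 1"] by (simp add: old_elt_def add.assoc)
  have x: "(j - new_elt k t) mod N = 0 \<longleftrightarrow>
      (\<delta> + (if even (t - int k) then int n + int k else int n - int k + 1)) mod N = 0"
    using eq[of "int n + int k"] eq[of "int n - int k + 1"] by (simp add: new_elt_def algebra_simps)
  have m: "(\<delta> + c) mod N = (if \<delta> + c < 0 then \<delta> + c + N else if \<delta> + c < N then \<delta> + c else \<delta> + c - N)"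
    if "- N \<le> c" "c \<le> N" for c
    by (rule mod_add_small) (use \<delta> that in auto)
  have ik: "1 \<le> int k" "int k \<le> int h"
    using k by simp_all
  have parn: "even (int n - 1)"
    using int_n by simp
  show ?thesis
  proof (cases "even j")
    case True
    have "(j - new_elt k t) mod N \<noteq> 0"
      using True odd_new_elt[of k t] by (metis dvd_add_right_iff diff_add_cancel dvd_mult_left even_mult_iff
          even_numeral mod_0_imp_dvd)
    moreover have "in_lab (k - 1) t j \<longleftrightarrow> \<not> (\<delta> < int k \<or> N - int k \<le> \<delta>)"
      using True k \<delta> m[of "int k"] int_n unfolding in_lab_diff k' \<delta>_def[symmetric] by (auto split: if_splits)
    moreover have "in_lab k t j \<longleftrightarrow> \<not> (\<delta> < int k + 1 \<or> N - int k - 1 \<le> \<delta>)"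
      using True k \<delta> m[of "int k + 1"] int_n unfolding in_lab_diff \<delta>_def[symmetric] by (auto split: if_splits)
    moreover have "(j - old_elt k t) mod N = 0 \<longleftrightarrow> \<delta> = (if even (t - int k) then int k else N - int k - 1)"
      using e k \<delta> m[of "int k + 1"] m[of "- int k"] int_n by (auto split: if_splits)
    moreover have "\<delta> \<noteq> (if even (t - int k) then N - int k - 1 else int k)"
      using par True by auto
    ultimately show ?thesis
      using ik int_n \<delta> by (smt (verit))
  next
    case False
    have "(j - old_elt k t) mod N \<noteq> 0"
      using False even_old_elt[of k t] by (metis dvd_add_right_iff diff_add_cancel dvd_mult_left even_mult_iff
          even_numeral mod_0_imp_dvd)
    moreover have "in_lab (k - 1) t j \<longleftrightarrow> int n - int k + 1 \<le> \<delta> \<and> \<delta> < int n + int k - 1"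
      using False k \<delta> m[of "int n + int k - 1"] int_n unfolding in_lab_diff k' \<delta>_def[symmetric]
      by (auto split: if_splits simp: algebra_simps)
    moreover have "in_lab k t j \<longleftrightarrow> int n - int k \<le> \<delta> \<and> \<delta> < int n + int k"
      using False k \<delta> m[of "int n + int k"] int_n unfolding in_lab_diff \<delta>_def[symmetric]
      by (auto split: if_splits)
    moreover have "(j - new_elt k t) mod N = 0 \<longleftrightarrow> \<delta> = (if even (t - int k) then int n - int k else int n + int k - 1)"
      using x k \<delta> m[of "int n + int k"] m[of "int n - int k + 1"] int_n by (auto split: if_splits)
    moreover have "\<delta> \<noteq> (if even (t - int k) then int n + int k - 1 else int n - int k)"
      using par False parn by auto
    ultimately show ?thesis
      using ik int_n \<delta> by (smt (verit))
  qed
qed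

lemma wrap_eq_iff: "i \<in> {1..2 * n} \<Longrightarrow> i = wrap (2 * n) j \<longleftrightarrow> (int i - j) mod N = 0"
  using wrap_cong[OF N_pos', of "int i" j] wrap_of_range[of i "2 * n"]
  by (simp add: mod_eq_dvd_iff dvd_eq_mod_eq_0)

lemma lab_pred:
  assumes k: "1 \<le> k" "k \<le> h"
  shows "insert (wrap (2 * n) (old_elt k t)) (lab k t - {wrap (2 * n) (new_elt k t)}) = lab (k - 1) t"
proof -
  have W: "wrap (2 * n) (old_elt k t) \<in> {1..2 * n}"
    by (rule wrap_range[OF N_pos'])
  show ?thesis
  proof (rule Set.set_eqI)
    fix i
    show "i \<in> insert (wrap (2 * n) (old_elt k t)) (lab k t - {wrap (2 * n) (new_elt k t)}) \<longleftrightarrow>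
        i \<in> lab (k - 1) t"
    proof (cases "i \<in> {1..2 * n}")
      case True
      then show ?thesis
        using lab_step[OF k, of t "int i"] by (auto simp: wrap_eq_iff lab_def)
    next
      case False
      then have "i \<noteq> wrap (2 * n) (old_elt k t)"
        using W by metis
      with False show ?thesis
        unfolding lab_def by auto
    qed
  qed
qed

text \<open>The angles \<open>t'\<close> at which ring \<open>k'\<close> contains the new element
  form one arc, those at which it misses the old element another. For \<open>k' \<le> k\<close>
  these arcs are disjoint, except that for \<open>k' = k\<close> they share the single angle
  \<open>t\<close>. This is the triangularity needed in \<open>prescribed_minors\<close>.\<close>

lemma lab_triangular:
  assumes k: "1 \<le> k" "k \<le> h" "k' \<le> k" and ne: "k' \<noteq> k \<or> (t' - t) mod N \<noteq> 0"
    and new: "in_lab k' t' (new_elt k t)"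
  shows "in_lab k' t' (old_elt k t)"
proof (rule ccontr)
  assume old: "\<not> in_lab k' t' (old_elt k t)"
  define \<delta> where "\<delta> = (t' - t) mod N"
  have \<delta>: "0 \<le> \<delta>" "\<delta> < N"
    using N_pos by (auto simp: \<delta>_def)
  have m: "(t' - t + c) mod N = (if \<delta> + c < 0 then \<delta> + c + N else if \<delta> + c < N then \<delta> + c else \<delta> + c - N)"
    if "- N \<le> c" "c \<le> N" for c
    unfolding mod_add_small[OF \<delta> that, symmetric] by (simp add: \<delta>_def mod_add_left_eq)
  have new': "(t' - new_elt k t + int n + int k') mod N < 2 * int k'"
    and old': "(t' - old_elt k t + int k' + 1) mod N < 2 * int k' + 2"
    using new old odd_new_elt[of k t] even_old_elt[of k t] by (auto simp: in_lab_def)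
  show False
  proof (cases "even (t - int k)")
    case True
    have "(t' - t + (int k' - int k)) mod N < 2 * int k'" "(t' - t + (int k + int k' + 1)) mod N < 2 * int k' + 2"
      using True new' old' by (simp_all add: new_elt_def old_elt_def algebra_simps)
    then show False
      using m[of "int k' - int k"] m[of "int k + int k' + 1"] ne k \<delta> int_n
      unfolding \<delta>_def[symmetric] by (auto split: if_splits)
  next
    case False
    have "(t' - t + (int k' + int k - 1)) mod N < 2 * int k'" "(t' - t + (int k' - int k)) mod N < 2 * int k' + 2"
      using False new' old' by (simp_all add: new_elt_def old_elt_def algebra_simps)
    then show False
      using m[of "int k' + int k - 1"] m[of "int k' - int k"] ne k \<delta> int_n
      unfolding \<delta>_def[symmetric] by (auto split: if_splits)
  qed
qed

text \<open>In ring 0 the window of missing even numbers consists of \<open>t\<close> and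
  \<open>t + 1\<close>; the value is half of the even one.\<close>

definition missing_even :: "int \<Rightarrow> nat" where
  "missing_even t = wrap (2 * n) (if even t then t else t + 1) div 2"

lemma missing_even: "missing_even t \<in> {1..n}"
  "2 * missing_even t = wrap (2 * n) (if even t then t else t + 1)"
proof -
  let ?j = "if even t then t else t + 1"
  have ev: "even (wrap (2 * n) ?j)"
    using even_wrap[of ?j] by simp
  then show eq: "2 * missing_even t = wrap (2 * n) ?j"
    by (simp add: missing_even_def)
  show "missing_even t \<in> {1..n}"
    using wrap_range[OF N_pos', of ?j] unfolding eq[symmetric] by auto
qed

lemma lab_0: "lab 0 t = (\<lambda>x. 2 * x) ` ({1..n} - {missing_even t})"
proof -
  have *: "i \<in> lab 0 t \<longleftrightarrow> even i \<and> i \<noteq> 2 * missing_even t" if i: "i \<in> {1..2 * n}" for i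
  proof -
    define \<delta> where "\<delta> = (t - int i) mod N"
    have \<delta>: "0 \<le> \<delta>" "\<delta> < N"
      using N_pos by (auto simp: \<delta>_def)
    have par: "even \<delta> \<longleftrightarrow> even (t - int i)"
      unfolding \<delta>_def by (rule even_mod_even) simp
    have m: "(t - int i + 1) mod N = (if \<delta> + 1 < N then \<delta> + 1 else 0)"
    proof -
      have "(\<delta> + 1) mod N = (if \<delta> + 1 < N then \<delta> + 1 else 0)"
        by (subst mod_add_small[OF \<delta>]) (use \<delta> int_n in auto)
      then show ?thesis
        by (simp add: \<delta>_def mod_add_left_eq)
    qed
    have "i = wrap (2 * n) t \<longleftrightarrow> \<delta> = 0" "i = wrap (2 * n) (t + 1) \<longleftrightarrow> (t - int i + 1) mod N = 0"
      using i by (simp_all add: wrap_eq_iff \<delta>_def mod_eq_0_iff_dvd, metis dvd_minus_iff minus_diff_eq,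
        smt (verit) dvd_minus_iff)
    then have w: "i = wrap (2 * n) (if even t then t else t + 1) \<longleftrightarrow> \<delta> = (if even t then 0 else N - 1)"
      using m \<delta> by auto
    have "i \<in> lab 0 t \<longleftrightarrow> even i \<and> \<delta> \<noteq> 0 \<and> \<delta> \<noteq> N - 1"
    proof -
      have "\<not> (t - int i + int n) mod N < 0"
        using pos_mod_sign[OF N_pos] by (metis not_less)
      moreover have "(t - int i + 1) mod N < 2 \<longleftrightarrow> \<delta> = 0 \<or> \<delta> = N - 1"
        unfolding m using \<delta> by auto
      ultimately show ?thesis
        using i by (simp add: lab_def in_lab_def)
    qed
    moreover have "\<delta> \<noteq> (if even t then N - 1 else 0)" if "even i"
      using par that by auto
    ultimately show ?thesis
      unfolding missing_even(2) w by auto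
  qed
  have "lab 0 t = {i \<in> {1..2 * n}. even i \<and> i \<noteq> 2 * missing_even t}"
    using * by (auto simp: lab_def)
  also have "\<dots> = (\<lambda>x. 2 * x) ` ({1..n} - {missing_even t})"
    by (auto elim!: evenE)
  finally show ?thesis .
qed

lemma finite_lab [simp]: "finite (lab k t)"
  by (simp add: lab_def)

text \<open>Ring 0 omits one of the \<open>n\<close> even numbers, and each further ring exchanges
  one element for another.\<close>

lemma card_lab: "k \<le> h \<Longrightarrow> card (lab k t) = n - 1"
proof (induction k)
  case 0
  have "card (lab 0 t) = card ({1..n} - {missing_even t})"
    unfolding lab_0 by (rule card_image) (auto simp: inj_on_def)
  then show ?case
    using missing_even(1)[of t] by simp
next
  case (Suc k)
  have "wrap (2 * n) (new_elt (Suc k) t) \<in> lab (Suc k) t" "wrap (2 * n) (old_elt (Suc k) t) \<notin> lab (Suc k) t"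
    unfolding wrap_in_lab using Suc.prems new_elt_in_lab[of "Suc k" t] old_elt_notin_lab[of "Suc k" t] by auto
  then have "card (insert (wrap (2 * n) (old_elt (Suc k) t)) (lab (Suc k) t - {wrap (2 * n) (new_elt (Suc k) t)})) =
      card (lab (Suc k) t)"
    using card_Suc_Diff1[OF finite_lab] by simp
  then have "card (lab (Suc k) t) = card (lab k t)"
    using lab_pred[of "Suc k" t] Suc.prems by simp
  then show ?case
    using Suc by simp
qed

text \<open>An instance of \<open>prescribed_minors\<close> with the ring as level and the even
  numbers as fixed columns. The exchange leads from ring 1 to ring 0, where all columns are fixed,
  and from a higher ring to a label of the preceding one.\<close>

lemma prescribed_label_minors:
  fixes c :: "nat \<times> int \<Rightarrow> 'a::field"
  assumes "\<And>p. c p \<noteq> 0"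
  shows "\<exists>a. \<forall>k\<in>{1..h}. \<forall>t\<in>{0..<N}. col_minor a (lab k t) = c (k, t)"
proof -
  let ?P = "{1..h} \<times> {0..<N}"
  let ?x = "\<lambda>(k, t). wrap (2 * n) (new_elt k t)" and ?e = "\<lambda>(k, t). wrap (2 * n) (old_elt k t)"
  have "\<exists>a. (\<forall>y\<in>Collect even. a y = even_columns (n - 1) y) \<and> (\<forall>p\<in>?P. col_minor a (case p of (k, t) \<Rightarrow> lab k t) = c p)"
  proof (rule prescribed_minors[where level = fst and x = ?x and e = ?e], goal_cases)
    case (2 p)
    then show ?case
      using even_wrap odd_new_elt even_old_elt
      by (auto simp: wrap_in_lab new_elt_in_lab old_elt_notin_lab)
  next
    case (3 p q)
    obtain k t k' t' where p: "p = (k, t)" and q: "q = (k', t')"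
      by fastforce
    have "k' \<noteq> k \<or> (t' - t) mod N \<noteq> 0"
    proof (rule ccontr)
      assume "\<not> ?thesis"
      then have "k' = k" "N dvd t' - t"
        by auto
      then have "t' mod N = t mod N"
        by (simp add: mod_eq_dvd_iff)
      with 3(1-3) \<open>k' = k\<close> show False
        by (simp add: p q)
    qed
    with 3 lab_triangular[of k k' t' t] show ?case
      by (auto simp: p q wrap_in_lab)
  next
    case (4 p)
    obtain k t where p: "p = (k, t)"
      by fastforce
    have k: "1 \<le> k" "k \<le> h"
      using 4 by (auto simp: p)
    have eq: "insert (?e p) ((case p of (k, t) \<Rightarrow> lab k t) - {?x p}) = lab (k - 1) t"
      using lab_pred[OF k, of t] by (simp add: p)
    show ?case
    proof (cases "k = 1")
      case True
      have "col_minor (even_columns (n - 1) :: _ \<Rightarrow> _ \<Rightarrow> 'a) (lab 0 t) \<noteq> 0"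
        using even_columns_minor[of "missing_even t" "n - 1"] missing_even(1)[of t] n_eq
        unfolding lab_0 by simp
      moreover have "lab 0 t \<subseteq> Collect even"
        by (auto simp: lab_0)
      ultimately show ?thesis
        unfolding eq using True by simp
    next
      case False
      then show ?thesis
        unfolding eq using 4 k by (intro disjI1 bexI[of _ "(k - 1, t)"]) (auto simp: p)
    qed
  next
    case 1
    show ?case by simp
  next
    case (5 p)
    show ?case by (rule assms)
  qed
  then obtain a where "\<forall>p\<in>?P. col_minor a (case p of (k, t) \<Rightarrow> lab k t) = c p"
    by blast
  then show ?thesis
    by (intro exI[of _ a]) auto
qed

end

section \<open>Central circular pairs\<close>

context annulus
begin

text \<open>The rows run upwards from \<open>p\<close> and the columns downwards to
  \<open>q\<close>. With integers \<open>p\<close> and \<open>q\<close>, passing to the symmetric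
  pair simply exchanges them.\<close>

definition cpair_at :: "nat \<Rightarrow> int \<Rightarrow> int \<Rightarrow> cpair" where
  "cpair_at k p q = (map (\<lambda>i. wrap n (p + int i)) [0..<k], map (\<lambda>i. wrap n (q + int k - 1 - int i)) [0..<k])"

text \<open>Chosen so that \<open>I_set n (pair k t) = lab k t\<close>; ring \<open>0\<close> consists of the empty pair.\<close>

definition pair :: "nat \<Rightarrow> int \<Rightarrow> cpair" where
  "pair k t = cpair_at k ((t - int k) div 2 + int h + 2) ((t - int k + 1) div 2 + 1)"

section \<open>Central pairs and their symmetric pairs indexed by size and angle\<close>

lemma n_pos: "n > 0"
  using n_eq by simp

lemma wrap_n_eq: "wrap n x = wrap n y \<longleftrightarrow> int n dvd x - y"
  by (simp add: wrap_cong[OF n_pos] mod_eq_dvd_iff)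

lemma wrap_n_int: "int n dvd int (wrap n x) - x"
  using wrap_mod[OF n_pos, of x] by (simp add: mod_eq_dvd_iff)

lemma pair_size_cpair_at [simp]: "pair_size (cpair_at k p q) = k"
  by (simp add: cpair_at_def pair_size_def)

lemma pair_size_pair [simp]: "pair_size (pair k t) = k"
  by (simp add: pair_def)

lemma pair_0 [simp]: "pair 0 t = ([], [])"
  by (simp add: pair_def cpair_at_def)

lemma cpair_at_cong:
  assumes "int n dvd p - p'" "int n dvd q - q'"
  shows "cpair_at k p q = cpair_at k p' q'"
proof -
  have "wrap n (p + x) = wrap n (p' + x)" "wrap n (q + x) = wrap n (q' + x)" for x
    using assms by (simp_all add: wrap_n_eq)
  from this(1) this(2)[of "int k - 1 - int _"] show ?thesis
    by (simp add: cpair_at_def add_diff_eq)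
qed

lemma cpair_at_eq_iff: "1 \<le> k \<Longrightarrow> cpair_at k p q = cpair_at k' p' q' \<longleftrightarrow> k = k' \<and> int n dvd p - p' \<and> int n dvd q - q'"
proof
  assume k: "1 \<le> k" and eq: "cpair_at k p q = cpair_at k' p' q'"
  then have kk: "k = k'"
    by (metis pair_size_cpair_at)
  have "map (\<lambda>i. wrap n (p + int i)) [0..<k] ! 0 = map (\<lambda>i. wrap n (p' + int i)) [0..<k] ! 0"
    "map (\<lambda>i. wrap n (q + int k - 1 - int i)) [0..<k] ! (k - 1) = map (\<lambda>i. wrap n (q' + int k - 1 - int i)) [0..<k] ! (k - 1)"
    using eq unfolding kk by (simp_all only: cpair_at_def prod.inject)
  with k kk show "k = k' \<and> int n dvd p - p' \<and> int n dvd q - q'"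
    by (simp add: wrap_n_eq)
qed (auto intro: cpair_at_cong)

lemma half_n: "(n - 1) div 2 = h" "(n - Suc 0) div 2 = h"
  using n_eq by simp_all

lemma central_pair_cpair_at: "central_pair n k j = cpair_at k (int j) (int j + int h)"
  by (simp add: central_pair_def cpair_at_def half_n add_ac)

lemma symmetric_cpair_at: "symmetric_pair (cpair_at k p q) = cpair_at k q p"
  by (auto simp: symmetric_pair_def cpair_at_def rev_nth algebra_simps intro!: nth_equalityI arg_cong[of _ _ "wrap n"])

lemma pair_mod: "pair k (t mod N) = pair k t"
proof -
  define z where "z = t div N"
  have t: "t = t mod N + 2 * (int n * z)"
    by (simp only: z_def mult.assoc[symmetric] mod_mult_div_eq)
  have "(t - int k) div 2 = (t mod N - int k) div 2 + int n * z"
    "(t - int k + 1) div 2 = (t mod N - int k + 1) div 2 + int n * z"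
    by (subst t; simp add: algebra_simps)+
  then show ?thesis
    unfolding pair_def by (intro cpair_at_cong) simp_all
qed

text \<open>With \<open>u = t - int k\<close>, the difference of \<open>(u + 1) div 2\<close> and
  \<open>u div 2\<close> is the parity of \<open>u\<close>. Their residues modulo
  \<open>n > 1\<close> therefore reveal this parity, and then \<open>u\<close> modulo
  \<open>2 * n\<close>.\<close>

lemma pair_eq_iff:
  assumes "1 \<le> k"
  shows "pair k t = pair k' t' \<longleftrightarrow> k = k' \<and> t mod N = t' mod N"
proof
  assume eq: "pair k t = pair k' t'"
  then have k: "k = k'"
    by (metis pair_size_pair)
  define u u' where "u = t - int k" and "u' = t' - int k"
  have d: "int n dvd u div 2 - u' div 2" "int n dvd (u + 1) div 2 - (u' + 1) div 2"
    using eq cpair_at_eq_iff[OF assms] unfolding pair_def k u_def u'_def by (auto simp: k)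
  then have d2: "int n dvd ((u + 1) div 2 - (u' + 1) div 2) - (u div 2 - u' div 2)"
    by (rule dvd_diff[rotated])
  have "even u \<longleftrightarrow> even u'"
  proof (rule ccontr)
    assume "\<not> ?thesis"
    then have "((u + 1) div 2 - (u' + 1) div 2) - (u div 2 - u' div 2) \<in> {1, - 1}"
      by (auto elim!: evenE oddE)
    with d2 have "int n dvd 1"
      by auto
    then show False
      using int_n h_pos by simp
  qed
  then have "u - u' = 2 * (u div 2 - u' div 2)"
    by (auto elim!: evenE oddE)
  moreover have "N dvd 2 * (u div 2 - u' div 2)"
    by (rule mult_dvd_mono[OF dvd_refl d(1)])
  ultimately have "N dvd u - u'"
    by (simp only:)
  then show "k = k' \<and> t mod N = t' mod N"
    using k by (simp add: u_def u'_def mod_eq_dvd_iff)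
next
  assume "k = k' \<and> t mod N = t' mod N"
  then show "pair k t = pair k' t'"
    by (metis pair_mod)
qed

text \<open>Modulo \<open>n\<close> the offset from \<open>p\<close> to \<open>q\<close> is
  \<open>h\<close> when \<open>t - int k\<close> is even, which gives the central pairs, and
  \<open>h + 1\<close> when it is odd, which gives their symmetric pairs.\<close>

lemma pair_shape:
  obtains p q where "pair k t = cpair_at k p q" "pair k t = cpair_at k p (if even (t - int k) then p + int h else p + int h + 1)"
    "p = (t - int k) div 2 + int h + 2" "q = (t - int k + 1) div 2 + 1"
proof
  let ?p = "(t - int k) div 2 + int h + 2" and ?q = "(t - int k + 1) div 2 + 1"
  show "pair k t = cpair_at k ?p ?q"
    by (simp add: pair_def)
  have "int n dvd ?q - (if even (t - int k) then ?p + int h else ?p + int h + 1)"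
  proof -
    have "?q - (if even (t - int k) then ?p + int h else ?p + int h + 1) = - int n"
      using int_n by (auto elim!: evenE oddE simp del: even_diff)
    then show ?thesis by simp
  qed
  then show "pair k t = cpair_at k ?p (if even (t - int k) then ?p + int h else ?p + int h + 1)"
    unfolding pair_def by (intro cpair_at_cong) simp_all
qed simp_all

lemma cpair_at_is_pair:
  assumes "int n dvd q - p - int h \<or> int n dvd q - p - int h - 1"
  shows "\<exists>t. cpair_at k p q = pair k t"
proof -
  have e: "(2 * m) div 2 = m" "(2 * m + 1) div 2 = m" "(2 * m + 1 + 1) div 2 = m + 1" for m :: int
    by simp_all
  \<comment> \<open>Inverts the formula for the first row in \<open>pair\<close>: \<open>m\<close>
    is the value of \<open>(t - int k) div 2\<close>, and the two alternatives correspond to even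
    and odd \<open>t - int k\<close>.\<close>
  define m where "m = p - int h - 2"
  from assms show ?thesis
  proof
    assume d: "int n dvd q - p - int h"
    have "int n dvd (q - p - int h) + int n"
      using d by simp
    also have "(q - p - int h) + int n = q - (m + 1)"
      using int_n by (simp add: m_def)
    finally have "cpair_at k p q = cpair_at k (m + int h + 2) (m + 1)"
      by (intro cpair_at_cong) (simp_all add: m_def)
    then have "cpair_at k p q = pair k (2 * m + int k)"
      unfolding pair_def by (simp add: e)
    then show ?thesis by blast
  next
    assume d: "int n dvd q - p - int h - 1"
    have "int n dvd (q - p - int h - 1) + int n"
      using d by simp
    also have "(q - p - int h - 1) + int n = q - (m + 2)"
      using int_n by (simp add: m_def)
    finally have "cpair_at k p q = cpair_at k (m + int h + 2) (m + 2)"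
      by (intro cpair_at_cong) (simp_all add: m_def)
    moreover have "2 * m + 1 + int k - int k = 2 * m + 1" "m + 1 + 1 = m + 2"
      by simp_all
    ultimately have "cpair_at k p q = pair k (2 * m + 1 + int k)"
      unfolding pair_def by (simp only: e)
    then show ?thesis by blast
  qed
qed

lemma D_dagger_eq: "D_dagger n = {pair k t |k t. 1 \<le> k \<and> k \<le> h}"
proof
  show "D_dagger n \<subseteq> {pair k t |k t. 1 \<le> k \<and> k \<le> h}"
  proof
    fix x assume "x \<in> D_dagger n"
    then obtain y where y: "y \<in> central_pairs n" "x = y \<or> x = symmetric_pair y"
      unfolding D_dagger_def by blast
    then obtain k j where k: "1 \<le> k" "k \<le> h" "y = central_pair n k j"
      by (auto simp: central_pairs_def half_n)
    with y have x: "x = central_pair n k j \<or> x = symmetric_pair (central_pair n k j)"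
      by simp
    have "\<exists>t. cpair_at k (int j) (int j + int h) = pair k t"
      by (rule cpair_at_is_pair) simp
    moreover have "\<exists>t. cpair_at k (int j + int h) (int j) = pair k t"
    proof (rule cpair_at_is_pair)
      have "int j - (int j + int h) - int h - 1 = - int n"
        using int_n by simp
      then show "int n dvd int j - (int j + int h) - int h \<or> int n dvd int j - (int j + int h) - int h - 1"
        by simp
    qed
    ultimately obtain t where "x = pair k t"
      using x unfolding central_pair_cpair_at symmetric_cpair_at by metis
    with k(1,2) show "x \<in> {pair k t |k t. 1 \<le> k \<and> k \<le> h}"
      by blast
  qed
  show "{pair k t |k t. 1 \<le> k \<and> k \<le> h} \<subseteq> D_dagger n"
  proof
    fix x assume "x \<in> {pair k t |k t. 1 \<le> k \<and> k \<le> h}"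
    then obtain k t where k: "1 \<le> k" "k \<le> h" and x: "x = pair k t"
      by blast
    obtain p where p: "pair k t = cpair_at k p (if even (t - int k) then p + int h else p + int h + 1)"
      using pair_shape[of k t] by metis
    have central: "central_pair n k j \<in> central_pairs n" if "j \<in> {1..n}" for j
      using that k by (auto simp: central_pairs_def half_n)
    have "pair k t \<in> D_dagger n"
    proof (cases "even (t - int k)")
      case True
      have "pair k t = central_pair n k (wrap n p)"
        unfolding p central_pair_cpair_at using True wrap_n_int[of p]
        by (auto intro!: cpair_at_cong simp: dvd_diff_commute)
      then show ?thesis
        using central[of "wrap n p"] wrap_range[OF n_pos, of p] unfolding D_dagger_def by simp
    next
      case False
      let ?q = "p + int h + 1"
      have "p - (int (wrap n ?q) + int h) = - (int (wrap n ?q) - ?q) - int n"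
        using int_n by simp
      then have "int n dvd p - (int (wrap n ?q) + int h)"
        using wrap_n_int[of ?q] by (metis dvd_diff dvd_minus_iff dvd_refl)
      then have "pair k t = symmetric_pair (central_pair n k (wrap n ?q))"
        unfolding p central_pair_cpair_at symmetric_cpair_at using False wrap_n_int[of ?q]
        by (auto intro!: cpair_at_cong simp: dvd_diff_commute)
      then show ?thesis
        using central[of "wrap n ?q"] wrap_range[OF n_pos, of ?q] unfolding D_dagger_def by blast
    qed
    then show "x \<in> D_dagger n"
      by (simp add: x)
  qed
qed

lemma cpair_at_in_D_dagger:
  assumes "cpair_at k p q \<in> D_dagger n"
  shows "1 \<le> k \<and> k \<le> h \<and> (int n dvd q - p - int h \<or> int n dvd q - p - int h - 1)"
proof -
  obtain k' t where k': "1 \<le> k'" "k' \<le> h" "cpair_at k p q = pair k' t"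
    using assms unfolding D_dagger_eq by blast
  then have "k' = k"
    by (metis pair_size_cpair_at pair_size_pair)
  with k' have k: "1 \<le> k" "k \<le> h" and t: "cpair_at k p q = pair k t"
    by simp_all
  obtain p' where "pair k t = cpair_at k p' (if even (t - int k) then p' + int h else p' + int h + 1)"
    using pair_shape[of k t] by metis
  with t have "cpair_at k p q = cpair_at k p' (if even (t - int k) then p' + int h else p' + int h + 1)"
    by simp
  then have d: "int n dvd p - p'" "int n dvd q - (if even (t - int k) then p' + int h else p' + int h + 1)"
    using cpair_at_eq_iff[OF k(1)] by auto
  then have "int n dvd (q - (if even (t - int k) then p' + int h else p' + int h + 1)) - (p - p')"
    by (rule dvd_diff[rotated])
  then have "int n dvd q - p - int h \<or> int n dvd q - p - int h - 1"
    by (cases "even (t - int k)") (simp_all add: algebra_simps)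
  with k show ?thesis by blast
qed

section \<open>Deleting rows and columns of contiguous pairs\<close>

lemma nths_map_upt: "nths (map f [0..<r]) A = map f (filter (\<lambda>i. i \<in> A) [0..<r])"
  by (induction r) (auto simp: nths_append)

lemma filter_upt_neq: "a < r \<Longrightarrow> filter (\<lambda>i. i \<noteq> a) [0..<r] = [0..<a] @ [Suc a..<r]"
proof -
  assume a: "a < r"
  then have "[0..<r] = [0..<a] @ a # [Suc a..<r]"
    by (metis less_imp_add_positive upt_add_eq_append upt_conv_Cons zero_le le_add1 nat_less_le add_0)
  moreover have "filter (\<lambda>i. i \<noteq> a) [0..<a] = [0..<a]" "filter (\<lambda>i. i \<noteq> a) [Suc a..<r] = [Suc a..<r]"
    by (auto simp: filter_id_conv)
  ultimately show ?thesis
    by simp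
qed

lemma delete_at_one: "a < r \<Longrightarrow> delete_at {a} (map f [0..<r]) = map f ([0..<a] @ [Suc a..<r])"
  by (simp add: delete_at_def nths_map_upt filter_upt_neq)

lemma delete_at_first: "0 < r \<Longrightarrow> delete_at {0} (map f [0..<r]) = map (\<lambda>i. f (Suc i)) [0..<r - 1]"
  by (cases r) (simp_all add: delete_at_one map_Suc_upt[symmetric] del: upt_Suc)

lemma delete_at_last: "0 < r \<Longrightarrow> delete_at {r - 1} (map f [0..<r]) = map f [0..<r - 1]"
  by (simp add: delete_at_one)

lemma delete_at_both: "1 < r \<Longrightarrow> delete_at {0, r - 1} (map f [0..<r]) = map (\<lambda>i. f (Suc i)) [0..<r - 2]"
proof -
  assume r: "1 < r"
  have "filter (\<lambda>i. i \<noteq> 0 \<and> i \<noteq> r - 1) [0..<r] = filter (\<lambda>i. i \<noteq> 0) (filter (\<lambda>i. i \<noteq> r - 1) [0..<r])"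
    by (simp add: conj_commute)
  also have "\<dots> = filter (\<lambda>i. i \<noteq> 0) [0..<r - 1]"
    using r by (simp add: filter_upt_neq)
  also have "\<dots> = [0..<0] @ [Suc 0..<r - 1]"
    by (rule filter_upt_neq) (use r in simp)
  also have "\<dots> = map Suc [0..<r - 2]"
    using r by (simp add: map_Suc_upt Suc_diff_Suc numeral_2_eq_2)
  finally show ?thesis
    by (simp add: delete_at_def nths_map_upt)
qed

text \<open>Deleting an interior element leaves a jump by two steps where the result has a single
  step, and these differ modulo \<open>n \<ge> 3\<close>. The sign \<open>s\<close> covers both the
  ascending rows and the descending columns.\<close>

lemma delete_at_contiguous:
  assumes s: "s = 1 \<or> s = - 1" and a: "a < r"
    and eq: "delete_at {a} (map (\<lambda>i. wrap n (x + s * int i)) [0..<r]) = map (\<lambda>i. wrap n (y + s * int i)) [0..<r - 1]"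
  shows "a = 0 \<or> a = r - 1"
proof (rule ccontr)
  assume "\<not> ?thesis"
  then have a': "0 < a" "a < r - 1" "a - 1 < r - 1"
    using a by auto
  let ?f = "\<lambda>i. wrap n (x + s * int i)" and ?g = "\<lambda>i. wrap n (y + s * int i)"
  have "map ?f ([0..<a] @ [Suc a..<r]) = map ?g [0..<r - 1]"
    using eq delete_at_one[OF a, of ?f] by simp
  then have *: "map ?f ([0..<a] @ [Suc a..<r]) ! i = map ?g [0..<r - 1] ! i" for i
    by simp
  have "?f (a - 1) = ?g (a - 1)" "?f (a + 1) = ?g a"
    using *[of "a - 1"] *[of a] a' by (auto simp: nth_append)
  then have "int n dvd (x + s * int (a + 1)) - (y + s * int a)" "int n dvd (x + s * int (a - 1)) - (y + s * int (a - 1))"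
    by (simp_all only: wrap_n_eq)
  then have "int n dvd ((x + s * int (a + 1)) - (y + s * int a)) - ((x + s * int (a - 1)) - (y + s * int (a - 1)))"
    by (rule dvd_diff)
  then have "int n dvd s"
    by (simp add: algebra_simps)
  then show False
    using s int_n h_pos by auto
qed

text \<open>Columns are listed downwards: deleting the first one removes the largest and keeps
  \<open>q\<close>, deleting the last one raises \<open>q\<close>.\<close>

lemma delete_at_cpair_at:
  assumes "1 < r" "cpair_at r p q = (R, S)"
  shows "(delete_at {0} R, delete_at {0} S) = cpair_at (r - 1) (p + 1) q"
    and "(delete_at {r - 1} R, delete_at {r - 1} S) = cpair_at (r - 1) p (q + 1)"
    and "(delete_at {0} R, delete_at {r - 1} S) = cpair_at (r - 1) (p + 1) (q + 1)"
    and "(delete_at {r - 1} R, delete_at {0} S) = cpair_at (r - 1) p q"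
    and "(delete_at {0, r - 1} R, delete_at {0, r - 1} S) = cpair_at (r - 2) (p + 1) (q + 1)"
proof -
  have R: "R = map (\<lambda>i. wrap n (p + int i)) [0..<r]" and S: "S = map (\<lambda>i. wrap n (q + int r - 1 - int i)) [0..<r]"
    using assms(2) by (simp_all add: cpair_at_def)
  have r: "0 < r" "int (r - 1) = int r - 1" "int (r - 2) = int r - 2"
    using assms(1) by auto
  note d = delete_at_first[OF r(1)] delete_at_last[OF r(1)] delete_at_both[OF assms(1)]
  show "(delete_at {0} R, delete_at {0} S) = cpair_at (r - 1) (p + 1) q"
    "(delete_at {r - 1} R, delete_at {r - 1} S) = cpair_at (r - 1) p (q + 1)"
    "(delete_at {0} R, delete_at {r - 1} S) = cpair_at (r - 1) (p + 1) (q + 1)"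
    "(delete_at {r - 1} R, delete_at {0} S) = cpair_at (r - 1) p q"
    "(delete_at {0, r - 1} R, delete_at {0, r - 1} S) = cpair_at (r - 2) (p + 1) (q + 1)"
    unfolding R S d cpair_at_def r(2,3) prod.inject
    by (intro conjI map_cong refl arg_cong[of _ _ "wrap n"]; simp)+
qed

text \<open>Reduction modulo \<open>n\<close> preserves the order on a window of length
  \<open>n\<close> except at one place, and cutting the list there is a rotation.\<close>

lemma sorted_rotation:
  assumes s: "sorted_wrt (<) xs" and b: "\<And>x. x \<in> set xs \<Longrightarrow> c \<le> x \<and> x < c + int n"
  shows "\<exists>r. sorted_wrt (<) (rotate r (map (wrap n) xs))"
proof -
  \<comment> \<open>The element of the window that is congruent to 1, where the reduced values start
    again from 1.\<close>
  define T where "T = c + (1 - c) mod int n"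
  have T: "c \<le> T" "T < c + int n"
    using n_pos by (auto simp: T_def)
  have Tm: "int n dvd T - 1"
  proof -
    have "T - 1 = - ((1 - c) div int n * int n)"
      unfolding T_def using div_mult_mod_eq[of "1 - c" "int n"] by linarith
    then show ?thesis by simp
  qed
  define as bs where "as = takeWhile (\<lambda>x. x < T) xs" and "bs = dropWhile (\<lambda>x. x < T) xs"
  have xs: "xs = as @ bs"
    by (simp add: as_def bs_def)
  have as: "x < T" if "x \<in> set as" for x
    using that unfolding as_def by (auto dest: set_takeWhileD)
  have bs: "T \<le> x" if "x \<in> set bs" for x
  proof (cases bs)
    case (Cons y ys)
    have "T \<le> y"
      using hd_dropWhile[of "\<lambda>x. x < T" xs] Cons unfolding bs_def by (metis list.discI list.sel(1) not_less)
    moreover have "y \<le> x"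
      using s that unfolding xs Cons sorted_wrt_append by auto
    ultimately show ?thesis by simp
  qed (use that in simp)
  have w: "int (wrap n x) = x - T + 1 + (if x < T then int n else 0)" if "c \<le> x" "x < c + int n" for x
  proof -
    let ?y = "x - T + 1 + (if x < T then int n else 0)"
    have "int n dvd (T - 1) + (if x < T then - int n else 0)"
      using Tm by simp
    then have "wrap n x = wrap n ?y"
      unfolding wrap_n_eq by (simp add: algebra_simps split: if_splits)
    moreover have "1 \<le> ?y" "?y \<le> int n"
      using that T by auto
    then have "int (wrap n ?y) = ?y"
      using int_wrap[OF n_pos, of ?y] by simp
    ultimately show ?thesis by simp
  qed
  have wa: "int (wrap n x) = x - T + 1 + int n" if "x \<in> set as" for x
    using w[of x] b[of x] as[OF that] that by (simp add: xs)
  have wb: "int (wrap n x) = x - T + 1" if "x \<in> set bs" for x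
    using w[of x] b[of x] bs[OF that] that by (simp add: xs)
  have sa: "sorted_wrt (<) as" "sorted_wrt (<) bs"
    using s by (simp_all add: xs sorted_wrt_append)
  have less: "wrap n x < wrap n y" if "x \<in> set as \<and> y \<in> set as \<or> x \<in> set bs \<and> y \<in> set bs" "x < y" for x y
  proof -
    from that(1) have "int (wrap n x) - int (wrap n y) = x - y"
      using wa[of x] wa[of y] wb[of x] wb[of y] by (elim disjE conjE) linarith+
    then show ?thesis
      using that(2) by linarith
  qed
  have "sorted_wrt (<) (map (wrap n) bs @ map (wrap n) as)"
    unfolding sorted_wrt_append sorted_wrt_map
  proof (intro conjI ballI)
    show "sorted_wrt (\<lambda>x y. wrap n x < wrap n y) bs"
      by (rule sorted_wrt_mono_rel[OF _ sa(2)]) (use less in blast)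
    show "sorted_wrt (\<lambda>x y. wrap n x < wrap n y) as"
      by (rule sorted_wrt_mono_rel[OF _ sa(1)]) (use less in blast)
  next
    fix x y assume "x \<in> set (map (wrap n) bs)" "y \<in> set (map (wrap n) as)"
    then obtain x' y' where xy: "x = wrap n x'" "x' \<in> set bs" "y = wrap n y'" "y' \<in> set as"
      by auto
    have "int x < int y"
      unfolding xy(1,3) wa[OF xy(4)] wb[OF xy(2)] using b[of x'] b[of y'] xy by (simp add: xs)
    then show "x < y"
      by simp
  qed
  then have "sorted_wrt (<) (rotate (length as) (map (wrap n) xs))"
    using rotate_append[of "map (wrap n) as" "map (wrap n) bs"] by (simp add: xs)
  then show ?thesis ..
qed

text \<open>For \<open>k \<le> h\<close> the rows from \<open>p\<close> and the columns from
  \<open>q\<close> are disjoint intervals within \<open>n\<close> consecutive integers, as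
  \<open>q\<close> is \<open>p + int h\<close> or one more.\<close>

lemma circular_pair_pair:
  assumes k: "1 \<le> k" "k \<le> h"
  shows "circular_pair n (pair k t)"
proof -
  obtain p where p: "pair k t = cpair_at k p (if even (t - int k) then p + int h else p + int h + 1)"
    using pair_shape[of k t] by metis
  define q where "q = (if even (t - int k) then p + int h else p + int h + 1)"
  define xs where "xs = map (\<lambda>i. p + int i) [0..<k] @ map (\<lambda>i. q + int i) [0..<k]"
  obtain P Q where PQ: "cpair_at k p q = (P, Q)"
    by fastforce
  have "rev Q = fst (cpair_at k q p)"
    using symmetric_cpair_at[of k p q] by (simp add: PQ symmetric_pair_def) (metis fst_conv)
  then have list: "P @ rev Q = map (wrap n) xs"
    using PQ by (simp add: xs_def cpair_at_def o_def)
  have q: "p + int k \<le> q" "q + int k \<le> p + int n"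
    using k int_n by (auto simp: q_def)
  have "sorted_wrt (<) xs"
    unfolding xs_def sorted_wrt_append sorted_wrt_map using q by auto
  moreover have "p \<le> x \<and> x < p + int n" if "x \<in> set xs" for x
    using that q k by (auto simp: xs_def)
  ultimately have "\<exists>r. sorted_wrt (<) (rotate r (P @ rev Q))"
    unfolding list by (rule sorted_rotation)
  moreover have "length P = length Q" "set P \<union> set Q \<subseteq> {1..n}"
    using PQ wrap_range[OF n_pos] by (auto simp: cpair_at_def)
  ultimately show ?thesis
    unfolding p q_def[symmetric] PQ circular_pair_def by simp
qed

text \<open>Deleting extreme rows and columns of \<open>pair r t\<close> gives the relation centred
  at \<open>pair (r - 1) t\<close>. The parity of \<open>t - int r\<close> tells which left-hand
  factor is that pair. The other one is off centre: its offset from first row to last column exceeds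
  \<open>h\<close> by -1 or 2 modulo \<open>n\<close>, where \<open>D_dagger n\<close> requires 0 or
  1.\<close>

lemma pair_neighbours:
  assumes "1 < r" "pair r t = (R, S)"
  shows "(delete_at {0} R, delete_at {r - 1} S) = pair (r - 1) (t + 1)"
    and "(delete_at {r - 1} R, delete_at {0} S) = pair (r - 1) (t - 1)"
    and "(delete_at {0, r - 1} R, delete_at {0, r - 1} S) = pair (r - 2) t"
    and "pair (r - 1) t = (if even (t - int r) then (delete_at {r - 1} R, delete_at {r - 1} S)
      else (delete_at {0} R, delete_at {0} S))"
    and "(if even (t - int r) then (delete_at {0} R, delete_at {0} S)
      else (delete_at {r - 1} R, delete_at {r - 1} S)) \<notin> D_dagger n"
proof -
  let ?p = "(t - int r) div 2 + int h + 2" and ?q = "(t - int r + 1) div 2 + 1"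
  have "cpair_at r ?p ?q = (R, S)"
    using assms(2) by (simp add: pair_def)
  note d = delete_at_cpair_at[OF assms(1) this]
  have r: "int (r - 1) = int r - 1" "int (r - 2) = int r - 2"
    using assms(1) by auto
  have half: "(x + 2) div 2 = x div 2 + 1" "even x \<Longrightarrow> (x + 1) div 2 = x div 2" "odd x \<Longrightarrow> (x + 1) div 2 = x div 2 + 1" for x :: int
    by (auto elim!: evenE oddE)
  define u where "u = t - int r"
  have u: "t + 1 - (int r - 1) = u + 2" "t - 1 - (int r - 1) = u" "t - (int r - 2) = u + 2" "t - (int r - 1) = u + 1"
    by (simp_all add: u_def)
  have u3: "u + 2 + 1 = (u + 1) + 2" "u + 1 + 1 = u + 2"
    by simp_all
  show "(delete_at {0} R, delete_at {r - 1} S) = pair (r - 1) (t + 1)"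
    "(delete_at {r - 1} R, delete_at {0} S) = pair (r - 1) (t - 1)"
    "(delete_at {0, r - 1} R, delete_at {0, r - 1} S) = pair (r - 2) t"
    unfolding d pair_def r u u3 half(1) u_def[symmetric] by (simp_all add: algebra_simps)
  show "pair (r - 1) t = (if even (t - int r) then (delete_at {r - 1} R, delete_at {r - 1} S)
      else (delete_at {0} R, delete_at {0} S))"
    unfolding d pair_def r u u3 half(1) u_def[symmetric]
    by (cases "even u") (simp_all only: half(2,3) if_True if_False simp_thms, simp_all add: algebra_simps)
  have ndvd: "\<not> int n dvd x" if "x \<in> {1, - 1, 2, - 2}" for x
  proof
    assume "int n dvd x"
    then have "int n \<le> \<bar>x\<bar>"
      using zdvd_imp_le[of "int n" "\<bar>x\<bar>"] that by auto
    then show False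
      using that int_n h_pos by auto
  qed
  show "(if even (t - int r) then (delete_at {0} R, delete_at {0} S)
      else (delete_at {r - 1} R, delete_at {r - 1} S)) \<notin> D_dagger n"
  proof (cases "even u")
    case True
    have 1: "?q - (?p + 1) - int h = - int n - 1" "?q - (?p + 1) - int h - 1 = - int n - 2"
      using half(2)[OF True] int_n unfolding u_def by simp_all
    have "int n dvd - int n - x \<longleftrightarrow> int n dvd x" for x
      using dvd_minus_iff[of "int n" "- int n - x"] by (simp add: dvd_add_right_iff)
    from this[of 1] this[of 2] have "\<not> int n dvd - int n - 1" "\<not> int n dvd - int n - 2"
      using ndvd[of 1] ndvd[of 2] by blast+
    then have "\<not> (int n dvd ?q - (?p + 1) - int h \<or> int n dvd ?q - (?p + 1) - int h - 1)"
      by (metis 1)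
    then have "cpair_at (r - 1) (?p + 1) ?q \<notin> D_dagger n"
      using cpair_at_in_D_dagger by blast
    then show ?thesis
      using True unfolding d u_def by simp
  next
    case False
    have 1: "(?q + 1) - ?p - int h = - int n + 2" "(?q + 1) - ?p - int h - 1 = - int n + 1"
      using half(3)[OF False] int_n unfolding u_def by simp_all
    have "int n dvd - int n + x \<longleftrightarrow> int n dvd x" for x
      by (metis dvd_add_right_iff dvd_minus_iff dvd_refl)
    from this[of 1] this[of 2] have "\<not> int n dvd - int n + 1" "\<not> int n dvd - int n + 2"
      using ndvd[of 1] ndvd[of 2] by blast+
    then have "\<not> (int n dvd (?q + 1) - ?p - int h \<or> int n dvd (?q + 1) - ?p - int h - 1)"
      by (metis 1)
    then have "cpair_at (r - 1) ?p (?q + 1) \<notin> D_dagger n"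
      using cpair_at_in_D_dagger by blast
    then show ?thesis
      using False unfolding d u_def by simp
  qed
qed


section \<open>Exchange relations among central pairs and the orientation of the quiver\<close>

lemma cm_mutable_eq: "cm_mutable n = {pair k t |k t. 1 \<le> k \<and> k < h}"
proof -
  have "x \<in> cm_mutable n \<longleftrightarrow> x \<in> {pair k t |k t. 1 \<le> k \<and> k < h}" for x
    unfolding cm_mutable_def D_dagger_eq half_n by (auto simp: less_le)
  then show ?thesis by blast
qed

definition neighbours :: "nat \<Rightarrow> int \<Rightarrow> cpair set" where
  "neighbours k t = {pair k (t - 1), pair k (t + 1), pair (k + 1) t, pair (k - 1) t}"

text \<open>Rows and columns are brought to the common form of \<open>delete_at_contiguous\<close>,
  with steps 1 and -1.\<close>

lemma D_dagger_map:
  assumes "(xs, ys) \<in> D_dagger n"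
  shows "\<exists>k x y. 1 \<le> k \<and> k \<le> h \<and> xs = map (\<lambda>i. wrap n (x + 1 * int i)) [0..<k] \<and>
    ys = map (\<lambda>i. wrap n (y + (- 1) * int i)) [0..<k]"
proof -
  obtain k t where k: "1 \<le> k" "k \<le> h" and "(xs, ys) = pair k t"
    using assms unfolding D_dagger_eq by blast
  then obtain p q where "(xs, ys) = cpair_at k p q"
    by (metis pair_def)
  then have "xs = map (\<lambda>i. wrap n (p + 1 * int i)) [0..<k]"
    "ys = map (\<lambda>i. wrap n ((q + int k - 1) + (- 1) * int i)) [0..<k]"
    by (simp_all add: cpair_at_def)
  with k show ?thesis by blast
qed

lemma length_delete_at_one: "a < length xs \<Longrightarrow> length (delete_at {a} xs) = length xs - 1"
proof -
  assume a: "a < length xs"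
  have "delete_at {a} xs = delete_at {a} (map ((!) xs) [0..<length xs])"
    by (simp add: map_nth)
  then show ?thesis
    using a by (simp add: delete_at_one)
qed

text \<open>Since \<open>(R, S)\<close> itself is a right-hand factor, \<open>R\<close> and
  \<open>S\<close> are intervals. They must remain intervals after a deletion, which forces the
  deleted rows and columns to be the extreme ones; the relation is then the one of
  \<open>pair_neighbours\<close>.\<close>

lemma gp_relation_unique:
  assumes gp: "gp_relation n L M" and M: "M \<subseteq> D_dagger n \<union> {([], [])}"
  shows "\<exists>r t. 1 < r \<and> r \<le> h \<and> M = neighbours (r - 1) t \<and> L \<inter> D_dagger n = {pair (r - 1) t}"
proof -
  obtain R S a b c d where circ: "circular_pair n (R, S)"
    and ab: "a < b" "b < length R" "c < d" "d < length S"
    and L: "L = {(delete_at {a} R, delete_at {c} S), (delete_at {b} R, delete_at {d} S)}"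
    and Meq: "M = {(delete_at {a} R, delete_at {d} S), (delete_at {b} R, delete_at {c} S),
             (delete_at {a, b} R, delete_at {c, d} S), (R, S)}"
    using gp unfolding gp_relation_def by blast
  define r where "r = length R"
  have r: "1 < r"
    using ab by (simp add: r_def)
  have "(R, S) \<in> D_dagger n"
    using M ab unfolding Meq by auto
  then obtain r' t where r': "1 \<le> r'" "r' \<le> h" and RS: "pair r' t = (R, S)"
    unfolding D_dagger_eq by force
  then have rr: "r' = r"
    using pair_size_pair[of r' t] by (simp add: RS pair_size_def r_def)
  have lenS: "length S = r"
    using circ by (simp add: circular_pair_def r_def)
  have R: "\<exists>x. R = map (\<lambda>i. wrap n (x + 1 * int i)) [0..<r]" and S: "\<exists>y. S = map (\<lambda>i. wrap n (y + (- 1) * int i)) [0..<r]"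
    using D_dagger_map[OF \<open>(R, S) \<in> D_dagger n\<close>] lenS r_def by fastforce+
  have len: "length (delete_at {a} R) = r - 1" "length (delete_at {b} R) = r - 1"
    "length (delete_at {c} S) = r - 1" "length (delete_at {d} S) = r - 1"
    using ab lenS r_def by (simp_all add: length_delete_at_one)
  \<comment> \<open>Since \<open>r > 1\<close> at least one row remains, so these factors are not
    the empty pair.\<close>
  have ne: "delete_at {a} R \<noteq> []" "delete_at {b} R \<noteq> []"
    using len r by (metis list.size(3) not_less_eq_eq zero_less_diff less_numeral_extra(3))+
  have in1: "(delete_at {a} R, delete_at {d} S) \<in> D_dagger n" and in2: "(delete_at {b} R, delete_at {c} S) \<in> D_dagger n"
    using M ne unfolding Meq by auto
  have contR: "i = 0 \<or> i = r - 1" if i: "i < r" "(delete_at {i} R, ys) \<in> D_dagger n" "length (delete_at {i} R) = r - 1" for i ys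
  proof -
    obtain x where x: "R = map (\<lambda>i. wrap n (x + 1 * int i)) [0..<r]"
      using R by blast
    obtain k y where "delete_at {i} R = map (\<lambda>i. wrap n (y + 1 * int i)) [0..<k]"
      using D_dagger_map[OF i(2)] by blast
    moreover from this have "k = r - 1"
      using i(3) by simp
    ultimately show ?thesis
      using delete_at_contiguous[of 1 i r x y] i(1) unfolding x by simp
  qed
  have contS: "i = 0 \<or> i = r - 1" if i: "i < r" "(xs, delete_at {i} S) \<in> D_dagger n" "length (delete_at {i} S) = r - 1" for i xs
  proof -
    obtain x where x: "S = map (\<lambda>i. wrap n (x + (- 1) * int i)) [0..<r]"
      using S by blast
    obtain k y where "delete_at {i} S = map (\<lambda>i. wrap n (y + (- 1) * int i)) [0..<k]"
      using D_dagger_map[OF i(2)] by blast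
    moreover from this have "k = r - 1"
      using i(3) by simp
    ultimately show ?thesis
      using delete_at_contiguous[of "- 1" i r x y] i(1) unfolding x by simp
  qed
  have "a = 0 \<or> a = r - 1" "b = 0 \<or> b = r - 1"
    using contR[OF _ in1 len(1)] contR[OF _ in2 len(2)] ab r_def by auto
  then have a: "a = 0" and b: "b = r - 1"
    using ab(1,2) r_def by auto
  have "c = 0 \<or> c = r - 1" "d = 0 \<or> d = r - 1"
    using contS[OF _ in2 len(3)] contS[OF _ in1 len(4)] ab lenS by auto
  then have c: "c = 0" and d: "d = r - 1"
    using ab(3,4) lenS by auto
  note P = pair_neighbours[OF r RS[unfolded rr]]
  have "r - 1 + 1 = r" "r - 1 - 1 = r - 2"
    using r by auto
  then have "M = neighbours (r - 1) t"
    unfolding Meq a b c d P(1-3) unfolding neighbours_def RS[unfolded rr, symmetric] by auto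
  moreover have "L \<inter> D_dagger n = {pair (r - 1) t}"
  proof -
    have "pair (r - 1) t \<in> D_dagger n"
      using r r' unfolding D_dagger_eq rr by force
    moreover define u v where "u = (delete_at {0} R, delete_at {0} S)"
      and "v = (delete_at {r - 1} R, delete_at {r - 1} S)"
    have "pair (r - 1) t = (if even (t - int r) then v else u)" "(if even (t - int r) then u else v) \<notin> D_dagger n"
      "L = {u, v}"
      unfolding u_def v_def L a b c d by (rule P(4), rule P(5), rule refl)
    ultimately show ?thesis
      by (cases "even (t - int r)") simp_all
  qed
  ultimately show ?thesis
    using r r' rr by blast
qed

lemma gp_relation_pair:
  assumes k: "1 \<le> k" "k < h"
  shows "\<exists>L. gp_relation n L (neighbours k t) \<and> pair k t \<in> L"
proof -
  define r where "r = k + 1"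
  have r: "1 < r" "r \<le> h" "r - 1 = k" "r - 2 = k - 1"
    using k by (auto simp: r_def)
  obtain R S where RS: "pair r t = (R, S)"
    by fastforce
  note P = pair_neighbours[OF r(1) RS]
  have circ: "circular_pair n (R, S)"
    using circular_pair_pair[of r t] r by (simp add: RS)
  have len: "length R = r" "length S = r"
    using circ pair_size_pair[of r t] by (simp_all add: RS pair_size_def circular_pair_def)
  let ?L = "{(delete_at {0} R, delete_at {0} S), (delete_at {r - 1} R, delete_at {r - 1} S)}"
  have M: "neighbours k t = {(delete_at {0} R, delete_at {r - 1} S), (delete_at {r - 1} R, delete_at {0} S),
             (delete_at {0, r - 1} R, delete_at {0, r - 1} S), (R, S)}"
    unfolding P(1-3) unfolding neighbours_def RS[symmetric] r(3,4) r_def by auto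
  have "gp_relation n ?L (neighbours k t)"
    unfolding gp_relation_def M
    by (rule exI[of _ R], rule exI[of _ S], rule exI[of _ 0], rule exI[of _ "r - 1"],
        rule exI[of _ 0], rule exI[of _ "r - 1"]) (use circ len r in auto)
  moreover have "pair k t \<in> ?L"
    using P(4) unfolding r(3) by (auto split: if_splits)
  ultimately show ?thesis by blast
qed

lemma neighbours_subset: "1 \<le> k \<Longrightarrow> k < h \<Longrightarrow> neighbours k t \<subseteq> D_dagger n \<union> {([], [])}"
proof -
  assume k: "1 \<le> k" "k < h"
  have D: "pair j s \<in> D_dagger n" if "1 \<le> j" "j \<le> h" for j s
    using that unfolding D_dagger_eq by blast
  have "pair (k - 1) t \<in> D_dagger n \<union> {([], [])}"
    using D[of "k - 1" t] k by (cases "k = 1") auto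
  then show ?thesis
    using D[of k] D[of "k + 1" t] k unfolding neighbours_def by auto
qed

lemma exchange_neighbour_iff:
  "cm_exchange_neighbour n x y \<longleftrightarrow> (\<exists>k t. 1 \<le> k \<and> k < h \<and> x = pair k t \<and> y \<in> neighbours k t)"
proof
  assume "cm_exchange_neighbour n x y"
  then obtain L M where x: "x \<in> cm_mutable n" and LM: "gp_relation n L M" "x \<in> L"
    "M \<subseteq> D_dagger n \<union> {([], [])}" "y \<in> M"
    unfolding cm_exchange_neighbour_def by blast
  obtain r t where r: "1 < r" "r \<le> h" "M = neighbours (r - 1) t" "L \<inter> D_dagger n = {pair (r - 1) t}"
    using gp_relation_unique[OF LM(1,3)] by blast
  have "x \<in> D_dagger n"
    using x by (simp add: cm_mutable_def)
  with LM r have "x = pair (r - 1) t" "y \<in> neighbours (r - 1) t" "1 \<le> r - 1" "r - 1 < h"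
    by auto
  then show "\<exists>k t. 1 \<le> k \<and> k < h \<and> x = pair k t \<and> y \<in> neighbours k t"
    by blast
next
  assume "\<exists>k t. 1 \<le> k \<and> k < h \<and> x = pair k t \<and> y \<in> neighbours k t"
  then obtain k t where k: "1 \<le> k" "k < h" "x = pair k t" "y \<in> neighbours k t"
    by blast
  obtain L where "gp_relation n L (neighbours k t)" "pair k t \<in> L"
    using gp_relation_pair[OF k(1,2)] by blast
  moreover have "x \<in> cm_mutable n"
    unfolding cm_mutable_eq using k by blast
  ultimately show "cm_exchange_neighbour n x y"
    unfolding cm_exchange_neighbour_def using k neighbours_subset[OF k(1,2)] by blast
qed

text \<open>A pair \<open>pair k t\<close> with \<open>k + t\<close> even sends arrows along its circle and receives radial ones.\<close>

definition pair_sign :: "cpair \<Rightarrow> int" where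
  "pair_sign x = (if \<exists>k t. 1 \<le> k \<and> x = pair k t \<and> even (int k + t) then 1 else - 1)"

text \<open>The empty pair gets only a default value from \<open>pair_sign\<close>, so an arrow at
  the centre takes its direction from the other end.\<close>

definition cm_B :: "cpair \<Rightarrow> cpair \<Rightarrow> int" where
  "cm_B x y = (if \<not> cm_edge n x y then 0
     else if pair_size x = pair_size y then pair_sign x
     else if x = ([], []) then pair_sign y else - pair_sign x)"

lemma pair_sign_pair: "1 \<le> k \<Longrightarrow> pair_sign (pair k t) = (if even (int k + t) then 1 else - 1)"
proof -
  assume k: "1 \<le> k"
  have "even (int k + t) \<longleftrightarrow> even (int k' + t')" if "pair k t = pair k' t'" for k' t'
  proof -
    have "k = k'" "t mod N = t' mod N"
      using that pair_eq_iff[OF k] by auto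
    then have "even t \<longleftrightarrow> even t'"
      by (metis even_mod_even dvd_triv_left)
    with \<open>k = k'\<close> show ?thesis by simp
  qed
  then have "(\<exists>k' t'. 1 \<le> k' \<and> pair k t = pair k' t' \<and> even (int k' + t')) \<longleftrightarrow> even (int k + t)"
    using k by metis
  then show ?thesis
    unfolding pair_sign_def by (simp only:)
qed

lemma pair_nonempty: "1 \<le> k \<Longrightarrow> pair k t \<noteq> ([], [])"
  using pair_size_pair[of k t] by (auto simp: pair_size_def)

text \<open>The signs colour the pairs like a chessboard: a step along a circle or a ray changes the
  parity of \<open>k + t\<close>. This is what makes \<open>cm_B\<close> antisymmetric.\<close>

lemma edge_signs:
  assumes "1 \<le> k" "y \<in> neighbours k t"
  shows "pair_size y = k \<Longrightarrow> y \<noteq> ([], []) \<and> pair_sign y = - pair_sign (pair k t)"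
    and "pair_size y \<noteq> k \<Longrightarrow> y \<noteq> ([], []) \<Longrightarrow> pair_sign y = - pair_sign (pair k t)"
proof -
  have k: "int (k - 1) = int k - 1"
    using assms(1) by simp
  consider "y = pair k (t - 1)" | "y = pair k (t + 1)" | "y = pair (k + 1) t" | "1 \<le> k - 1" "y = pair (k - 1) t"
    | "k = 1" "y = ([], [])"
    using assms unfolding neighbours_def by (cases "k = 1") auto
  then have "(pair_size y = k \<longrightarrow> y \<noteq> ([], [])) \<and> (y \<noteq> ([], []) \<longrightarrow> pair_sign y = - pair_sign (pair k t))"
  proof cases
    case 1
    then show ?thesis using pair_nonempty[OF assms(1)] assms(1) by (simp add: pair_sign_pair)
  next
    case 2
    then show ?thesis using pair_nonempty[OF assms(1)] assms(1) by (simp add: pair_sign_pair)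
  next
    case 3
    then show ?thesis using assms(1) by (simp add: pair_sign_pair)
  next
    case 4
    then show ?thesis using assms(1) pair_nonempty[OF 4(1)] pair_nonempty[OF assms(1)] by (auto simp: pair_sign_pair k)
  next
    case 5
    then show ?thesis by (simp add: pair_size_def)
  qed
  then show "pair_size y = k \<Longrightarrow> y \<noteq> ([], []) \<and> pair_sign y = - pair_sign (pair k t)"
    and "pair_size y \<noteq> k \<Longrightarrow> y \<noteq> ([], []) \<Longrightarrow> pair_sign y = - pair_sign (pair k t)"
    by blast+
qed

lemma cm_B_neighbours:
  assumes "1 \<le> k" "k < h" "y \<in> neighbours k t"
  shows "cm_B (pair k t) y = (if pair_size y = k then pair_sign (pair k t) else - pair_sign (pair k t))"
    and "cm_B y (pair k t) = - cm_B (pair k t) y"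
proof -
  have e: "cm_edge n (pair k t) y" "cm_edge n y (pair k t)"
    unfolding cm_edge_def exchange_neighbour_iff using assms by blast+
  show 1: "cm_B (pair k t) y = (if pair_size y = k then pair_sign (pair k t) else - pair_sign (pair k t))"
    using e pair_nonempty[OF assms(1)] by (auto simp: cm_B_def)
  show "cm_B y (pair k t) = - cm_B (pair k t) y"
    unfolding 1 using e pair_nonempty[OF assms(1)] edge_signs[OF assms(1,3)]
    by (auto simp: cm_B_def)
qed

lemma cm_edge_cases:
  assumes "cm_edge n x y"
  obtains k t where "1 \<le> k" "k < h" "x = pair k t" "y \<in> neighbours k t"
    | k t where "1 \<le> k" "k < h" "y = pair k t" "x \<in> neighbours k t"
  using assms unfolding cm_edge_def exchange_neighbour_iff by blast

lemma cm_B_quiver: "cm_B \<in> cm_quivers n"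
proof -
  have sym: "cm_edge n x y \<longleftrightarrow> cm_edge n y x" for x y
    by (auto simp: cm_edge_def)
  have anti: "cm_B y x = - cm_B x y" for x y
  proof (cases "cm_edge n x y")
    case True
    then show ?thesis
      by (cases rule: cm_edge_cases) (use cm_B_neighbours(2) in auto)
  next
    case False
    then show ?thesis
      using sym by (auto simp: cm_B_def)
  qed
  have abs: "\<bar>cm_B x y\<bar> = (if cm_edge n x y then 1 else 0)" for x y
    by (auto simp: cm_B_def pair_sign_def)
  have alt: "\<exists>s\<in>{1, - 1}. \<forall>y. cm_edge n x y \<longrightarrow> cm_B x y = (if pair_size y = pair_size x then s else - s)"
    if x: "x \<in> cm_mutable n" for x
  proof
    obtain k t where "1 \<le> k" "x = pair k t"
      using x unfolding cm_mutable_eq by blast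
    then have "x \<noteq> ([], [])"
      using pair_nonempty by simp
    then show "\<forall>y. cm_edge n x y \<longrightarrow> cm_B x y = (if pair_size y = pair_size x then pair_sign x else - pair_sign x)"
      by (auto simp: cm_B_def)
    show "pair_sign x \<in> {1, - 1}"
      by (auto simp: pair_sign_def)
  qed
  show ?thesis
    unfolding cm_quivers_def using anti abs alt by blast
qed

section \<open>The sets I(P;Q) as face labels\<close>

lemma in_lab_even:
  assumes "even j" "k \<le> h" "\<delta> = (t - j) mod N"
  shows "in_lab k t j \<longleftrightarrow> \<not> (\<delta> \<le> int k \<or> N - int k - 1 \<le> \<delta>)"
proof -
  have \<delta>: "0 \<le> \<delta>" "\<delta> < N"
    using assms N_pos by simp_all
  have "(\<delta> + (int k + 1)) mod N = (if \<delta> + (int k + 1) < N then \<delta> + (int k + 1) else \<delta> + (int k + 1) - N)"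
    using mod_add_small[OF \<delta>, of "int k + 1"] assms(2) int_n \<delta>(1) by auto
  then show ?thesis
    using assms(1,2) int_n \<delta> unfolding in_lab_diff assms(3)[symmetric] by auto
qed

lemma in_lab_odd:
  assumes "odd j" "k \<le> h" "\<delta> = (t - j) mod N"
  shows "in_lab k t j \<longleftrightarrow> int n - int k \<le> \<delta> \<and> \<delta> < int n + int k"
proof -
  have \<delta>: "0 \<le> \<delta>" "\<delta> < N"
    using assms N_pos by simp_all
  have "(\<delta> + (int n + int k)) mod N = (if \<delta> + (int n + int k) < N then \<delta> + (int n + int k) else \<delta> + (int n + int k) - N)"
    using mod_add_small[OF \<delta>, of "int n + int k"] assms(2) int_n \<delta>(1) by auto
  then show ?thesis
    using assms(1,2) int_n \<delta> unfolding in_lab_diff assms(3)[symmetric] by auto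
qed

text \<open>Lifted to the integers, I(P;Q) has one block of \<open>k\<close> consecutive odd numbers
  and one block of consecutive even numbers, and these end where the windows of
  \<open>lab k t\<close> end.\<close>

lemma I_set_pair:
  assumes k: "1 \<le> k" "k \<le> h"
  shows "I_set n (pair k t) = lab k t"
proof -
  define u where "u = t - int k"
  define p where "p = u div 2 + int h + 2"
  define q where "q = (u + 1) div 2 + 1"
  \<comment> \<open>The distance from the first row to the last column, once both are lifted to
    integers starting at \<open>p1\<close>.\<close>
  define e where "e = (if even u then int h else int h + 1)"
  have pq: "int n dvd q - p - e"
  proof -
    have "q - p - e = - int n"
      using int_n by (auto simp: p_def q_def e_def elim!: evenE oddE)
    then show ?thesis by simp
  qed
  define p1 where "p1 = int (wrap n p)"
  obtain P Q where PQ: "pair k t = (P, Q)"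
    by fastforce
  then have P: "P = map (\<lambda>i. wrap n (p + int i)) [0..<k]" and Q: "Q = map (\<lambda>i. wrap n (q + int k - 1 - int i)) [0..<k]"
    by (simp_all add: pair_def cpair_at_def p_def q_def u_def)
  have nths: "hd P = wrap n p" "last P = wrap n (p + int k - 1)" "hd Q = wrap n (q + int k - 1)" "last Q = wrap n q"
    using k unfolding P Q by (simp_all add: hd_map last_map of_nat_diff add_diff_eq)
  have rep: "p1 + (int (wrap n x) - p1) mod int n = p1 + c" if "0 \<le> c" "c < int n" "int n dvd x - p - c" for x c
  proof -
    have "int (wrap n x) - p1 - c = (int (wrap n x) - x) - (p1 - p) + (x - p - c)"
      by simp
    also have "int n dvd \<dots>"
      unfolding p1_def by (rule dvd_add[OF dvd_diff[OF wrap_n_int wrap_n_int] that(3)])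
    finally have "(int (wrap n x) - p1) mod int n = c mod int n"
      by (simp add: mod_eq_dvd_iff)
    then show ?thesis
      using that by simp
  qed
  have e: "int h \<le> e" "e \<le> int h + 1"
    by (auto simp: e_def)
  have reps: "p1 + (int (last P) - p1) mod int n = p1 + (int k - 1)"
    "p1 + (int (last Q) - p1) mod int n = p1 + e"
    "p1 + (int (hd Q) - p1) mod int n = p1 + (e + int k - 1)"
    unfolding nths using k e int_n pq by (intro rep; simp add: algebra_simps)+
  define X where "X = {2 * p1 - 1..2 * (p1 + (int k - 1)) - 1} \<union>
           {x \<in> {2 * (p1 + (int k - 1))..2 * (p1 + e) - 4}. even x} \<union>
           {x \<in> {2 * (p1 + (e + int k - 1) - int n) + 2..2 * p1 - 2}. even x}"
  have I: "I_set n (pair k t) = wrap (2 * n) ` X"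
    unfolding PQ I_set_def Let_def case_prod_conv p1_def[symmetric] nths(1) X_def reps[unfolded p1_def, folded p1_def]
    by (simp add: nths(1) flip: p1_def)
  obtain z where z: "p1 = p + int n * z"
    using wrap_n_int[of p] unfolding p1_def by (metis add.commute diff_add_cancel dvdE)
  \<comment> \<open>The lift of \<open>t\<close> for which \<open>X\<close> lies within the
    \<open>N\<close> integers up to and including \<open>T\<close>.\<close>
  define T where "T = t + N * (z + 1)"
  have T: "2 * p1 = (if even u then T - int k + 3 - int n else T - int k + 2 - int n)"
  proof -
    have "2 * p = (if even u then u + 2 * int h + 4 else u + 2 * int h + 3)"
      by (auto simp: p_def elim!: evenE oddE)
    then show ?thesis
      using int_n by (auto simp: z T_def u_def algebra_simps)
  qed
  have parT: "even T \<longleftrightarrow> even t"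
    by (simp add: T_def)
  have X: "x \<in> X \<longleftrightarrow> (if even x then int k < T - x \<and> T - x < N - int k - 1 else int n - int k \<le> T - x \<and> T - x < int n + int k)" for x
  proof -
    \<comment> \<open>The even numbers of the first interval fill the gap between the two even
      pieces, so all even elements form one block.\<close>
    have "x \<in> X \<longleftrightarrow> (if even x then 2 * (p1 + e + int k - int n) \<le> x \<and> x \<le> 2 * p1 + 2 * e - 4
        else 2 * p1 - 1 \<le> x \<and> x \<le> 2 * p1 + 2 * int k - 3)"
      using k e int_n by (auto simp: X_def algebra_simps elim!: evenE, presburger+)
    also have "\<dots> \<longleftrightarrow> (if even x then int k < T - x \<and> T - x < N - int k - 1 else int n - int k \<le> T - x \<and> T - x < int n + int k)"
    proof (cases "even u")
      case True
      then show ?thesis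
        using T parT int_n by (auto simp: e_def u_def; presburger)
    next
      case False
      then show ?thesis
        using T parT int_n by (auto simp: e_def u_def; presburger)
    qed
    finally show ?thesis .
  qed
  have Tm: "T mod N = t mod N"
    by (simp add: T_def)
  have Txm: "(t - x) mod N = (T - x) mod N" for x
    using Tm by (intro mod_diff_cong) auto
  have inX: "x \<in> X \<longleftrightarrow> in_lab k t x" if "0 \<le> T - x" "T - x < N" for x
  proof -
    have "T - x = (t - x) mod N"
      using that by (simp add: Txm)
    from in_lab_even[OF _ k(2) this] in_lab_odd[OF _ k(2) this] show ?thesis
      unfolding X by auto
  qed
  have range: "0 \<le> T - x \<and> T - x < N" if "x \<in> X" for x
    using that k int_n unfolding X by (auto split: if_splits)
  have "i \<in> wrap (2 * n) ` X \<longleftrightarrow> i \<in> lab k t" for i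
  proof
    assume "i \<in> wrap (2 * n) ` X"
    then obtain x where x: "x \<in> X" "i = wrap (2 * n) x"
      by blast
    then have "in_lab k t x"
      using inX range by blast
    then show "i \<in> lab k t"
      unfolding x(2) wrap_in_lab .
  next
    assume i: "i \<in> lab k t"
    define x where "x = T - (T - int i) mod N"
    have "0 \<le> T - x" "T - x < N"
      using N_pos by (simp_all add: x_def)
    moreover have xi: "wrap (2 * n) x = i"
    proof -
      have "x mod N = int i mod N"
        unfolding x_def mod_diff_right_eq by simp
      moreover have "i \<in> {1..2 * n}"
        using i by (simp add: lab_def)
      ultimately show ?thesis
        using wrap_cong[OF N_pos', of x "int i"] wrap_of_range[of i "2 * n"] by simp
    qed
    moreover have "in_lab k t x"
      using i unfolding xi[symmetric] wrap_in_lab .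
    ultimately show "i \<in> wrap (2 * n) ` X"
      using inX by blast
  qed
  then show ?thesis
    unfolding I by blast
qed

end

section \<open>The annular plabic graph\<close>

text \<open>Darts of the annular square grid.  The centre of the disk is thought of as pointing down, so
  that clockwise is to the right.  \<open>Up k t\<close> leads from level \<open>k - 1\<close> to level \<open>k\<close> along the ray at
  angle \<open>t\<close>, where level \<open>0\<close> of \<open>Up\<close> starts at the centre; \<open>Rt k t\<close> leads clockwise from the vertex
  at level \<open>k\<close> and angle \<open>t\<close>.  The boundary circle is level \<open>h\<close>.\<close>

datatype dart = Up nat int | Dn nat int | Rt nat int | Lt nat int

instance dart :: countable
  by countable_datatype

text \<open>On the invariant set \<open>D\<close> the map \<open>J\<close> intertwines
  \<open>f\<close> with \<open>g\<close>. This moves orbit computations from the encoded disk to the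
  grid.\<close>

lemma orbit_transport:
  assumes "\<And>d. d \<in> D \<Longrightarrow> f d \<in> D \<and> g (J d) = J (f d)" "d \<in> D"
  shows "orbit g (J d) = J ` orbit f d"
proof -
  have D: "e \<in> D" if "e \<in> orbit f d" for e
    using that by induction (use assms in auto)
  have "x \<in> J ` orbit f d" if "x \<in> orbit g (J d)" for x
    using that
  proof induction
    case base
    then show ?case
      using assms orbit.base[of f d] by auto
  next
    case (step x)
    then obtain e where e: "e \<in> orbit f d" "x = J e"
      by auto
    then have "g x = J (f e)"
      using D assms(1) by auto
    then show ?case
      using e orbit.step[of e f d] by auto
  qed
  moreover have "J e \<in> orbit g (J d)" if "e \<in> orbit f d" for e
    using that
  proof induction
    case base
    have "J (f d) = g (J d)"
      using assms by simp
    then show ?case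
      using orbit.base[of g "J d"] by simp
  next
    case (step e)
    have "J (f e) = g (J e)"
      using D[OF step.hyps] assms(1) by simp
    then show ?case
      using orbit.step[OF step.IH] by simp
  qed
  ultimately show ?thesis
    by blast
qed

text \<open>Both functions induce the same partition of \<open>D\<close>. In the Euler count this
  replaces orbits by explicit indices.\<close>

lemma card_image_eq_card_image:
  assumes "\<And>d e. d \<in> D \<Longrightarrow> e \<in> D \<Longrightarrow> f d = f e \<longleftrightarrow> g d = g e"
  shows "card (f ` D) = card (g ` D)"
proof -
  have "bij_betw (\<lambda>y. g (SOME d. d \<in> D \<and> f d = y)) (f ` D) (g ` D)"
  proof -
    have *: "g (SOME d'. d' \<in> D \<and> f d' = f d) = g d" if "d \<in> D" for d
    proof -
      have "(SOME d'. d' \<in> D \<and> f d' = f d) \<in> D \<and> f (SOME d'. d' \<in> D \<and> f d' = f d) = f d"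
        by (rule someI[of _ d]) (use that in simp)
      then show ?thesis
        using assms that by blast
    qed
    have "inj_on (\<lambda>y. g (SOME d. d \<in> D \<and> f d = y)) (f ` D)"
      by (rule inj_onI) (use * assms in auto)
    moreover have "(\<lambda>y. g (SOME d. d \<in> D \<and> f d = y)) ` f ` D = g ` D"
      using * by (simp add: image_image)
    ultimately show ?thesis
      by (simp add: bij_betw_def)
  qed
  then show ?thesis
    by (rule bij_betw_same_card)
qed

context annulus
begin

fun is_dart :: "dart \<Rightarrow> bool" where
  "is_dart (Up k t) \<longleftrightarrow> k \<le> h \<and> 0 \<le> t \<and> t < N \<and> (k = 0 \<longrightarrow> odd t)"
| "is_dart (Dn k t) \<longleftrightarrow> k \<le> h \<and> 0 \<le> t \<and> t < N \<and> (k = 0 \<longrightarrow> odd t)"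
| "is_dart (Rt k t) \<longleftrightarrow> k \<le> h \<and> 0 \<le> t \<and> t < N"
| "is_dart (Lt k t) \<longleftrightarrow> k \<le> h \<and> 0 \<le> t \<and> t < N"

text \<open>Level \<open>h\<close> runs along the boundary of the disk; its circular darts are arcs
  of this boundary and not edges of the plabic graph.\<close>

fun on_circle :: "dart \<Rightarrow> bool" where
  "on_circle (Rt k t) \<longleftrightarrow> k = h"
| "on_circle (Lt k t) \<longleftrightarrow> k = h"
| "on_circle _ \<longleftrightarrow> False"

definition graph_darts :: "dart set" where
  "graph_darts = {d. is_dart d \<and> \<not> on_circle d}"

fun rev_dart :: "dart \<Rightarrow> dart" where
  "rev_dart (Up k t) = Dn k t"
| "rev_dart (Dn k t) = Up k t"
| "rev_dart (Rt k t) = Lt k ((t + 1) mod N)"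
| "rev_dart (Lt k t) = Rt k ((t - 1) mod N)"

text \<open>The clockwise order is up, right, down, left. At level 0 an even angle lacks the edge to
  the centre, level \<open>h\<close> has no outward edge, and the rays at the centre are the odd
  ones, whence the step by 2.\<close>

fun rot_dart :: "dart \<Rightarrow> dart" where
  "rot_dart (Up 0 t) = Up 0 ((t + 2) mod N)"
| "rot_dart (Up (Suc k) t) = Rt k t"
| "rot_dart (Rt k t) = (if k = 0 \<and> even t then Lt 0 t else Dn k t)"
| "rot_dart (Dn k t) = Lt k t"
| "rot_dart (Lt k t) = (if k = h then Rt h t else Up (Suc k) t)"

fun rot_inv_dart :: "dart \<Rightarrow> dart" where
  "rot_inv_dart (Up 0 t) = Up 0 ((t - 2) mod N)"
| "rot_inv_dart (Up (Suc k) t) = Lt k t"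
| "rot_inv_dart (Rt k t) = (if k = h then Lt h t else Up (Suc k) t)"
| "rot_inv_dart (Dn k t) = Rt k t"
| "rot_inv_dart (Lt k t) = (if k = 0 \<and> even t then Rt 0 t else Dn k t)"

text \<open>The chessboard colouring, with level \<open>k\<close> and angle \<open>t\<close> black
  iff \<open>k + t\<close> is even. The centre is black as it is joined to the white vertices of
  level 0; boundary vertices count as not black.\<close>

fun is_black :: "dart \<Rightarrow> bool" where
  "is_black (Up 0 t) \<longleftrightarrow> True"
| "is_black (Up (Suc k) t) \<longleftrightarrow> even (int k + t)"
| "is_black (Dn k t) \<longleftrightarrow> k < h \<and> even (int k + t)"
| "is_black (Rt k t) \<longleftrightarrow> even (int k + t)"
| "is_black (Lt k t) \<longleftrightarrow> even (int k + t)"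

text \<open>The shift by \<open>h + 1\<close> numbers the boundary vertices so that the face in ring
  \<open>k\<close> at angle \<open>t\<close> receives the label \<open>lab k t\<close>.\<close>

definition bdart :: "nat \<Rightarrow> dart" where
  "bdart i = Dn h ((int i + int h + 1) mod N)"

text \<open>A boundary vertex has degree three together with the boundary circle, but degree one in
  the plabic graph.\<close>

definition graph_rot :: "dart \<Rightarrow> dart" where
  "graph_rot d = (if d \<in> range (Dn h) then d else rot_dart d)"

definition graph_rot_inv_dart :: "dart \<Rightarrow> dart" where
  "graph_rot_inv_dart d = (if d \<in> range (Dn h) then d else rot_inv_dart d)"

text \<open>Acting as the identity off the encoded darts is part of what \<open>permutes\<close>
  demands.\<close>

definition ext :: "(dart \<Rightarrow> dart) \<Rightarrow> nat \<Rightarrow> nat" where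
  "ext f x = (if x \<in> to_nat ` graph_darts then to_nat (f (from_nat x)) else x)"

definition G :: plabic where
  "G = \<lparr>darts = to_nat ` graph_darts, opp = ext rev_dart, rot = ext graph_rot,
        bdry = (\<lambda>i. to_nat (bdart i)), black = to_nat ` {d \<in> graph_darts. is_black d}\<rparr>"

lemma G_sel [simp]:
  "darts G = to_nat ` graph_darts" "opp G = ext rev_dart" "rot G = ext graph_rot"
  "bdry G = (\<lambda>i. to_nat (bdart i))" "black G = to_nat ` {d \<in> graph_darts. is_black d}"
  by (simp_all add: G_def)

lemma ext_to_nat: "d \<in> graph_darts \<Longrightarrow> ext f (to_nat d) = to_nat (f d)"
  by (simp add: ext_def)

lemma mod_simps_N:
  assumes "0 \<le> t" "t < N"
  shows "(t + 1) mod N = (if t = N - 1 then 0 else t + 1)" "(t - 1) mod N = (if t = 0 then N - 1 else t - 1)"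
    "(t + 2) mod N = (if t + 2 < N then t + 2 else t + 2 - N)"
    "(t - 2) mod N = (if t < 2 then t - 2 + N else t - 2)"
  using mod_add_small[OF assms, of 1] mod_add_small[OF assms, of "-1"]
    mod_add_small[OF assms, of 2] mod_add_small[OF assms, of "-2"] assms int_n h_pos
  by auto

lemma parity_mod: "even (x mod N) \<longleftrightarrow> even x"
  by (rule even_mod_even) simp

lemma mod_bounds [simp]: "0 \<le> x mod N" "x mod N < N"
  using N_pos by simp_all

lemma is_dart_closed: "is_dart d \<Longrightarrow> is_dart (rev_dart d) \<and> is_dart (rot_dart d) \<and> is_dart (rot_inv_dart d)"
  by (cases d rule: rot_dart.cases) (use h_pos in \<open>auto simp: parity_mod\<close>)

lemma rev_dart_rev_dart: "is_dart d \<Longrightarrow> rev_dart (rev_dart d) = d"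
  by (cases d) (auto simp: mod_diff_left_eq mod_add_left_eq)

lemma rev_dart_neq: "rev_dart d \<noteq> d"
  by (cases d) auto

lemma rot_inv_dart_rot_dart: "is_dart d \<Longrightarrow> rot_inv_dart (rot_dart d) = d" and rot_dart_rot_inv_dart: "is_dart d \<Longrightarrow> rot_dart (rot_inv_dart d) = d"
  using h_pos by (cases d rule: rot_dart.cases; auto simp: mod_diff_left_eq mod_add_left_eq)+

lemma graph_closed:
  assumes "d \<in> graph_darts"
  shows "rev_dart d \<in> graph_darts" "graph_rot d \<in> graph_darts" "graph_rot_inv_dart d \<in> graph_darts"
    "graph_rot (graph_rot_inv_dart d) = d" "graph_rot_inv_dart (graph_rot d) = d"
  using assms h_pos is_dart_closed[of d] rot_inv_dart_rot_dart[of d] rot_dart_rot_inv_dart[of d]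
  by (cases d rule: rot_dart.cases; auto simp: graph_darts_def graph_rot_def graph_rot_inv_dart_def split: if_splits)+

lemma ext_permutes:
  assumes "\<And>d. d \<in> graph_darts \<Longrightarrow> f d \<in> graph_darts \<and> g d \<in> graph_darts \<and> f (g d) = d \<and> g (f d) = d"
  shows "ext f permutes to_nat ` graph_darts"
proof (rule bij_imp_permutes)
  have "bij_betw f graph_darts graph_darts"
    by (rule bij_betw_byWitness[where f' = g]) (use assms in auto)
  then show "bij_betw (ext f) (to_nat ` graph_darts) (to_nat ` graph_darts)"
    unfolding bij_betw_def inj_on_def
    by (force simp: ext_to_nat image_image)
qed (auto simp: ext_def)

lemma bdart_in: "bdart i \<in> graph_darts"
  using h_pos by (auto simp: bdart_def graph_darts_def)

lemma bdart_eq_iff: "0 \<le> t \<Longrightarrow> t < N \<Longrightarrow> bdart i = Dn h t \<longleftrightarrow> wrap (2 * n) (int i) = wrap (2 * n) (t - int h - 1)"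
proof -
  assume t: "0 \<le> t" "t < N"
  have "bdart i = Dn h t \<longleftrightarrow> (int i + int h + 1) mod N = t mod N"
    using t by (simp add: bdart_def)
  also have "\<dots> \<longleftrightarrow> int i mod N = (t - int h - 1) mod N"
    by (simp add: mod_eq_dvd_iff algebra_simps)
  finally show ?thesis
    using wrap_cong[OF N_pos'] by simp
qed

lemma bdart_wrap: "0 \<le> t \<Longrightarrow> t < N \<Longrightarrow> bdart (wrap (2 * n) (t - int h - 1)) = Dn h t"
  using bdart_eq_iff[of t] wrap_mod[OF N_pos', of "t - int h - 1"] by (simp add: wrap_cong[OF N_pos'])

lemma bdart_ex: "\<exists>t. 0 \<le> t \<and> t < N \<and> bdart i = Dn h t"
  by (auto simp: bdart_def)

lemma inj_bdart: "inj_on bdart {1..2 * n}"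
proof (rule inj_onI)
  fix i j assume ij: "i \<in> {1..2 * n}" "j \<in> {1..2 * n}" "bdart i = bdart j"
  obtain t where t: "0 \<le> t" "t < N" "bdart i = Dn h t"
    using bdart_ex by blast
  then have "wrap (2 * n) (int i) = wrap (2 * n) (int j)"
    using bdart_eq_iff[OF t(1,2), of i] bdart_eq_iff[OF t(1,2), of j] ij by simp
  then show "i = j"
    using wrap_of_range ij by metis
qed

lemma bdart_image: "bdart ` {1..2 * n} = {Dn h t |t. 0 \<le> t \<and> t < N}"
proof -
  have "Dn h t \<in> bdart ` {1..2 * n}" if "0 \<le> t" "t < N" for t
    using bdart_wrap[OF that] wrap_range[OF N_pos', of "t - int h - 1"] by (metis imageI)
  then show ?thesis
    using bdart_ex by fastforce
qed

lemma bdry_image: "bdry G ` {1..2 * n} = to_nat ` {Dn h t |t. 0 \<le> t \<and> t < N}"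
  unfolding bdart_image[symmetric] G_sel by (simp add: image_image)

lemma inv_bdry:
  assumes "0 \<le> t" "t < N"
  shows "inv_into {1..2 * n} (bdry G) (to_nat (Dn h t)) = wrap (2 * n) (t - int h - 1)"
proof (rule inv_into_f_eq)
  show "inj_on (bdry G) {1..2 * n}"
    using comp_inj_on[OF inj_bdart inj_on_subset[OF inj_to_nat subset_UNIV]] unfolding G_sel o_def .
  show "wrap (2 * n) (t - int h - 1) \<in> {1..2 * n}"
    by (rule wrap_range[OF N_pos'])
  show "bdry G (wrap (2 * n) (t - int h - 1)) = to_nat (Dn h t)"
    unfolding G_sel bdart_wrap[OF assms] ..
qed

text \<open>Under \<open>J\<close>, level \<open>h\<close> of the grid becomes the boundary circle of the disk.\<close>

fun J :: "dart \<Rightarrow> disk_dart" where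
  "J (Rt k t) = (if k = h then CW (wrap (2 * n) (t - int h - 1)) else Edge (to_nat (Rt k t)))"
| "J (Lt k t) = (if k = h then CCW (wrap (2 * n) (t - int h - 1)) else Edge (to_nat (Lt k t)))"
| "J d = Edge (to_nat d)"

lemma J_graph: "d \<in> graph_darts \<Longrightarrow> J d = Edge (to_nat d)"
  by (cases d) (auto simp: graph_darts_def)

lemma wrap_shift_eq:
  assumes "0 \<le> t" "t < N" "0 \<le> t'" "t' < N"
  shows "wrap (2 * n) (t - int h - 1) = wrap (2 * n) (t' - int h - 1) \<longleftrightarrow> t = t'"
proof -
  have "(t - int h - 1) mod int (2 * n) = (t' - int h - 1) mod int (2 * n) \<longleftrightarrow> t mod N = t' mod N"
    by (simp add: mod_eq_dvd_iff)
  with assms show ?thesis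
    unfolding wrap_cong[OF N_pos'] by simp
qed

lemma wrap_shift_surj:
  assumes "i \<in> {1..2 * n}"
  shows "\<exists>t. 0 \<le> t \<and> t < N \<and> wrap (2 * n) (t - int h - 1) = i"
proof (intro exI conjI)
  let ?t = "(int i + int h + 1) mod N"
  have "(?t - int h - 1) mod N = int i mod N"
    unfolding diff_diff_eq mod_diff_left_eq by (simp add: add.assoc)
  then show "wrap (2 * n) (?t - int h - 1) = i"
    using wrap_cong[OF N_pos', of "?t - int h - 1" "int i"] wrap_of_range[OF assms] by simp
qed simp_all

lemma inj_J: "inj_on J (Collect is_dart)"
proof (rule inj_onI)
  fix d e assume "d \<in> Collect is_dart" "e \<in> Collect is_dart" "J d = J e"
  then show "d = e"
    by (cases d; cases e) (auto simp: wrap_shift_eq split: if_splits)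
qed

lemma J_image: "J ` Collect is_dart = disk_darts (2 * n) G"
proof -
  have "J d \<in> disk_darts (2 * n) G" if "is_dart d" for d
    using that wrap_range[OF N_pos']
    by (cases d) (auto simp: disk_darts_def graph_darts_def)
  moreover have "x \<in> J ` Collect is_dart" if x: "x \<in> disk_darts (2 * n) G" for x
  proof (cases x)
    case (Edge y)
    then obtain d where "d \<in> graph_darts" "y = to_nat d"
      using x by (auto simp: disk_darts_def)
    then show ?thesis
      using J_graph[of d] Edge by (metis (mono_tags, lifting) graph_darts_def imageI mem_Collect_eq)
  next
    case (CW i)
    then obtain t where "0 \<le> t" "t < N" "wrap (2 * n) (t - int h - 1) = i"
      using x wrap_shift_surj[of i] by (auto simp: disk_darts_def)
    then show ?thesis
      using CW by (intro image_eqI[of _ _ "Rt h t"]) auto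
  next
    case (CCW i)
    then obtain t where "0 \<le> t" "t < N" "wrap (2 * n) (t - int h - 1) = i"
      using x wrap_shift_surj[of i] by (auto simp: disk_darts_def)
    then show ?thesis
      using CCW by (intro image_eqI[of _ _ "Lt h t"]) auto
  qed
  ultimately show ?thesis
    by blast
qed

lemma disk_opp_J: "is_dart d \<Longrightarrow> disk_opp (2 * n) G (J d) = J (rev_dart d)"
proof -
  assume d: "is_dart d"
  have "wrap (2 * n) (int (wrap (2 * n) (t - int h - 1)) + c) = wrap (2 * n) ((t + c) mod N - int h - 1)" for t c
  proof -
    have "(int (wrap (2 * n) (t - int h - 1)) + c) mod N = (t - int h - 1 + c) mod N"
      using wrap_mod[OF N_pos', of "t - int h - 1"] by (metis mod_add_left_eq of_nat_mult of_nat_numeral)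
    also have "\<dots> = (t + c - int h - 1) mod N"
      by (simp add: algebra_simps)
    also have "\<dots> = ((t + c) mod N - int h - 1) mod N"
      by (simp add: mod_diff_left_eq diff_diff_eq)
    finally show ?thesis
      by (simp add: wrap_cong[OF N_pos'])
  qed
  note this[of _ 1] this[of _ "- 1"]
  then show ?thesis
    using d by (cases d) (auto simp: ext_to_nat graph_darts_def)
qed

lemma disk_rot_J: "is_dart d \<Longrightarrow> disk_rot (2 * n) G (J d) = J (rot_dart d)"
proof (cases "d \<in> range (Dn h)")
  case True
  assume "is_dart d"
  with True obtain t where "d = Dn h t" "0 \<le> t" "t < N"
    by auto
  then show ?thesis
    using inv_bdry[of t] bdry_image by (auto simp: image_iff)
next
  case False
  assume d: "is_dart d"
  show ?thesis
  proof (cases "on_circle d")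
    case True
    with d show ?thesis
      using h_pos bdart_wrap by (cases d) auto
  next
    case circ: False
    then have g: "d \<in> graph_darts"
      using d by (simp add: graph_darts_def)
    then have r: "graph_rot d \<in> graph_darts" "graph_rot d = rot_dart d"
      using graph_closed(2)[OF g] False by (auto simp: graph_rot_def)
    have "to_nat d \<notin> bdry G ` {1..2 * n}"
      unfolding bdry_image using False by auto
    then show ?thesis
      using g r by (simp add: J_graph ext_to_nat del: G_sel(4))
  qed
qed


text \<open>Face \<open>(k, t)\<close> lies below level \<open>k\<close> between the angles
  \<open>t\<close> and \<open>t + 1\<close>. In ring 0 the cells on both sides of an even angle form
  one face, named by this even angle; everything beyond level \<open>h\<close> is the outer
  face.\<close>

definition face :: "nat \<Rightarrow> int \<Rightarrow> nat \<times> int" where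
  "face k t = (if k = 0 then (0, (if even t then t else t + 1) mod N)
     else if k \<le> h then (k, t mod N) else (Suc h, 0))"

fun left_idx :: "dart \<Rightarrow> nat \<times> int" where
  "left_idx (Up k t) = face k (t - 1)"
| "left_idx (Dn k t) = face k t"
| "left_idx (Rt k t) = face (Suc k) t"
| "left_idx (Lt k t) = face k (t - 1)"

text \<open>Index 0 is the centre, where the angles of the darts are forgotten; level
  \<open>k\<close> has index \<open>k + 1\<close>.\<close>

fun vertex_idx :: "dart \<Rightarrow> nat \<times> int" where
  "vertex_idx (Up k t) = (k, if k = 0 then 0 else t)"
| "vertex_idx (Dn k t) = (Suc k, t)"
| "vertex_idx (Rt k t) = (Suc k, t)"
| "vertex_idx (Lt k t) = (Suc k, t)"

lemma face_cong: "t mod N = t' mod N \<Longrightarrow> face k t = face k t'"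
proof -
  assume eq: "t mod N = t' mod N"
  then have "even t \<longleftrightarrow> even t'"
    by (metis parity_mod)
  with eq show ?thesis
    by (auto simp: face_def intro: mod_add_cong)
qed

lemma face_mod: "face k (t mod N) = face k t"
  by (rule face_cong) simp

lemma face_mod_diff: "face k ((t + c) mod N - c') = face k (t + c - c')"
  by (rule face_cong) (simp add: mod_diff_left_eq)

lemma left_idx_step: "is_dart d \<Longrightarrow> left_idx (rot_dart (rev_dart d)) = left_idx d"
proof (cases d)
  case (Up k t)
  then show ?thesis by simp
next
  case (Dn k t)
  assume d: "is_dart d"
  show ?thesis
  proof (cases k)
    case 0
    have "t + 2 - 1 = t + 1"
      by simp
    then have "face 0 ((t + 2) mod N - 1) = face 0 (t + 1)"
      using face_mod_diff[of 0 t 2 1] by metis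
    moreover have "face 0 (t + 1) = face 0 t"
      using d Dn 0 by (simp add: face_def)
    ultimately show ?thesis
      using Dn 0 by simp
  qed (use Dn in simp)
next
  case (Rt k t)
  assume d: "is_dart d"
  have "face (Suc k) ((t + 1) mod N - 1) = face (Suc k) t"
    using face_mod_diff[of "Suc k" t 1 1] by simp
  then show ?thesis
    using Rt d by (auto simp: face_def)
next
  case (Lt k t)
  then show ?thesis
    using face_mod[of k "t - 1"] face_mod_diff[of k t "-1" 1] parity_mod[of "t - 1"]
    by (auto simp: face_def mod_diff_left_eq)
qed

lemma vertex_idx_rot_dart: "is_dart d \<Longrightarrow> vertex_idx (rot_dart d) = vertex_idx d"
  by (cases d rule: rot_dart.cases) auto

lemma funpow_Up_0: "(rot_dart ^^ j) (Up 0 t) = Up 0 ((t + 2 * int j) mod N)" if "0 \<le> t" "t < N"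
  using that by (induction j) (auto simp: mod_add_left_eq mod_add_right_eq algebra_simps)

lemma funpow_Rt_h: "((rot_dart \<circ> rev_dart) ^^ j) (Rt h t) = Rt h ((t + int j) mod N)" if "0 \<le> t" "t < N"
  using that by (induction j) (auto simp: mod_add_left_eq mod_add_right_eq algebra_simps)

lemma in_orbit_funpow: "0 < j \<Longrightarrow> (f ^^ j) x = y \<Longrightarrow> y \<in> orbit f x"
  by (auto simp: orbit_altdef)

lemma orbit_4_cycle:
  assumes "f a = b" "f b = c" "f c = d" "f d = a" "x \<in> {a, b, c, d}" "y \<in> {a, b, c, d}"
  shows "y \<in> orbit f x"
proof -
  have "y \<in> {f x, f (f x), f (f (f x)), f (f (f (f x)))}"
    using assms by auto
  then show ?thesis
    by (auto intro: orbit.intros)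
qed

lemma orbit_3_cycle:
  assumes "f a = b" "f b = c" "f c = a" "x \<in> {a, b, c}" "y \<in> {a, b, c}"
  shows "y \<in> orbit f x"
proof -
  have "y \<in> {f x, f (f x), f (f (f x))}"
    using assms by auto
  then show ?thesis
    by (auto intro: orbit.intros)
qed

lemma vertex_idx_fiber:
  assumes "is_dart d" "vertex_idx d = (Suc k, t)"
  shows "k \<le> h \<and> d \<in> {Up (Suc k) t, Rt k t, Dn k t, Lt k t} \<and>
    (k = h \<longrightarrow> d \<noteq> Up (Suc k) t) \<and> (k = 0 \<and> even t \<longrightarrow> d \<noteq> Dn k t)"
  using assms by (cases d) (auto split: if_splits)

text \<open>The index is invariant under rotation. Conversely, darts with one index form a single
  cycle, of length 3 or 4 on the grid and of length \<open>n\<close> at the centre.\<close>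

lemma orbit_rot_dart:
  assumes d: "is_dart d"
  shows "orbit rot_dart d = {e. is_dart e \<and> vertex_idx e = vertex_idx d}"
proof -
  have "is_dart e \<and> vertex_idx e = vertex_idx d" if "e \<in> orbit rot_dart d" for e
    using that by induction (use d is_dart_closed vertex_idx_rot_dart in auto)
  moreover have "e \<in> orbit rot_dart d" if e: "is_dart e" "vertex_idx e = vertex_idx d" for e
  proof (cases "fst (vertex_idx d)")
    case 0
    then obtain t t' where dt: "d = Up 0 t" "e = Up 0 t'"
      using e by (cases d; cases e) auto
    have b: "0 \<le> t" "t < N" "0 \<le> t'" "t' < N" "odd t" "odd t'"
      using d e dt by auto
    then have "even (t' - t)"
      by simp
    then obtain q where q: "t' - t = 2 * q"
      by (rule evenE)
    \<comment> \<open>The summand \<open>n\<close> is one full turn in steps of 2; it makes the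
      number of steps positive.\<close>
    define j where "j = nat (q + int n)"
    have j: "int j = q + int n" "0 < j"
      using q b by (auto simp: j_def)
    have "(t + 2 * int j) mod N = (t' + N) mod N"
      using q j by (simp add: algebra_simps)
    also have "\<dots> = t'"
      using b by simp
    finally have "(rot_dart ^^ j) d = e"
      using funpow_Up_0[OF b(1,2), of j] dt by simp
    then show ?thesis
      by (rule in_orbit_funpow[OF j(2)])
  next
    case (Suc k)
    define t where "t = snd (vertex_idx d)"
    have v: "vertex_idx d = (Suc k, t)" "vertex_idx e = (Suc k, t)"
      using Suc e by (auto simp: t_def prod_eq_iff)
    note F = vertex_idx_fiber[OF d v(1)] vertex_idx_fiber[OF e(1) v(2)]
    consider "k = h" | "k = 0" "even t" | "k < h" "\<not> (k = 0 \<and> even t)"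
      using F by linarith
    then show ?thesis
    proof cases
      case 1
      show ?thesis
        by (rule orbit_3_cycle[of rot_dart "Rt k t" "Dn k t" "Lt k t"]) (use F 1 h_pos in auto)
    next
      case 2
      show ?thesis
        by (rule orbit_3_cycle[of rot_dart "Up (Suc k) t" "Rt k t" "Lt k t"]) (use F 2 h_pos in auto)
    next
      case 3
      show ?thesis
        by (rule orbit_4_cycle[of rot_dart "Up (Suc k) t" "Rt k t" "Dn k t" "Lt k t"]) (use F 3 in auto)
    qed
  qed
  ultimately show ?thesis
    by blast
qed

lemma mod_succ_pred: "0 \<le> t \<Longrightarrow> t < N \<Longrightarrow> ((t - 1) mod N + 1) mod N = t"
  "0 \<le> t \<Longrightarrow> t < N \<Longrightarrow> ((t + 1) mod N - 1) mod N = t"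
  by (simp_all add: mod_add_left_eq mod_diff_left_eq)

lemma left_idx_fiber:
  assumes "is_dart d" "left_idx d = (k, t)" "1 \<le> k" "k \<le> h"
  shows "0 \<le> t \<and> t < N \<and> d \<in> {Up k ((t + 1) mod N), Lt k ((t + 1) mod N), Dn k t, Rt (k - 1) t}"
  using assms by (cases d) (auto simp: face_def mod_succ_pred split: if_splits)

lemma left_idx_fiber_0:
  assumes "is_dart d" "left_idx d = (0, t)"
  shows "0 \<le> t \<and> t < N \<and> even t \<and> d \<in> {Up 0 ((t + 1) mod N), Lt 0 ((t + 1) mod N), Lt 0 t, Dn 0 ((t - 1) mod N)}"
  using assms by (cases d) (auto simp: face_def mod_succ_pred parity_mod split: if_splits)

text \<open>Every bounded face has four darts; in ring 0 these are two radial darts and two circular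
  darts of level 0. The outer face is the cycle of all clockwise darts of level
  \<open>h\<close>.\<close>

lemma orbit_left_face:
  assumes d: "is_dart d"
  shows "orbit (rot_dart \<circ> rev_dart) d = {e. is_dart e \<and> left_idx e = left_idx d}"
proof -
  have "is_dart e \<and> left_idx e = left_idx d" if "e \<in> orbit (rot_dart \<circ> rev_dart) d" for e
    using that by induction (use d is_dart_closed left_idx_step in auto)
  moreover have "e \<in> orbit (rot_dart \<circ> rev_dart) d" if e: "is_dart e" "left_idx e = left_idx d" for e
  proof -
    obtain k t where kt: "left_idx d = (k, t)"
      by fastforce
    consider "k = 0" | "1 \<le> k" "k \<le> h" | "k = Suc h"
      using d kt by (cases d) (auto simp: face_def split: if_splits)
    then show ?thesis
    proof cases
      case 1
      have t: "0 \<le> t" "t < N" "even t"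
        using left_idx_fiber_0[OF d] kt 1 by auto
      show ?thesis
      proof (rule orbit_4_cycle)
        show "d \<in> {Up 0 ((t + 1) mod N), Lt 0 ((t + 1) mod N), Lt 0 t, Dn 0 ((t - 1) mod N)}"
          using left_idx_fiber_0[OF d] kt 1 by auto
        show "e \<in> {Up 0 ((t + 1) mod N), Lt 0 ((t + 1) mod N), Lt 0 t, Dn 0 ((t - 1) mod N)}"
          using left_idx_fiber_0[OF e(1)] e(2) kt 1 by auto
        have "((t - 1) mod N + 2) mod N = (t + 1) mod N"
          unfolding mod_add_left_eq by (rule arg_cong[of _ _ "\<lambda>x. x mod N"]) simp
        then show "(rot_dart \<circ> rev_dart) (Dn 0 ((t - 1) mod N)) = Up 0 ((t + 1) mod N)"
          by simp
      qed (use t h_pos mod_succ_pred[of t] parity_mod[of "t - 1"] in auto)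
    next
      case 2
      have t: "0 \<le> t" "t < N"
        using left_idx_fiber[OF d _ 2] kt by auto
      show ?thesis
      proof (rule orbit_4_cycle)
        show "d \<in> {Up k ((t + 1) mod N), Lt k ((t + 1) mod N), Dn k t, Rt (k - 1) t}"
          using left_idx_fiber[OF d _ 2] kt by auto
        show "e \<in> {Up k ((t + 1) mod N), Lt k ((t + 1) mod N), Dn k t, Rt (k - 1) t}"
          using left_idx_fiber[OF e(1) _ 2] e(2) kt by auto
      qed (use t 2 mod_succ_pred[of t] in \<open>cases k; auto\<close>)+
    next
      case 3
      then obtain s s' where dt: "d = Rt h s" "e = Rt h s'"
        using d e kt by (cases d; cases e) (auto simp: face_def split: if_splits)
      have b: "0 \<le> s" "s < N" "0 \<le> s'" "s' < N"
        using d e dt by auto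
      define j where "j = nat (s' - s + N)"
      have j: "int j = s' - s + N" "0 < j"
        using b by (auto simp: j_def)
      have "(s + int j) mod N = (s' + N) mod N"
        using j by (simp add: algebra_simps)
      also have "\<dots> = s'"
        using b by simp
      finally have "((rot_dart \<circ> rev_dart) ^^ j) d = e"
        using funpow_Rt_h[OF b(1,2), of j] dt by simp
      then show ?thesis
        by (rule in_orbit_funpow[OF j(2)])
    qed
  qed
  ultimately show ?thesis
    by blast
qed

lemma left_face_J:
  assumes "is_dart d"
  shows "left_face (2 * n) G (J d) = J ` {e. is_dart e \<and> left_idx e = left_idx d}"
proof -
  have "orbit (disk_rot (2 * n) G \<circ> disk_opp (2 * n) G) (J d) = J ` orbit (rot_dart \<circ> rev_dart) d"
    by (rule orbit_transport[of "Collect is_dart"])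
      (use assms is_dart_closed in \<open>auto simp: disk_opp_J disk_rot_J\<close>)
  then show ?thesis
    by (simp add: left_face_def orbit_left_face[OF assms])
qed

lemma left_face_eq_iff:
  assumes "is_dart d" "is_dart e"
  shows "left_face (2 * n) G (J d) = left_face (2 * n) G (J e) \<longleftrightarrow> left_idx d = left_idx e"
proof -
  have "{x. is_dart x \<and> left_idx x = left_idx d} = {x. is_dart x \<and> left_idx x = left_idx e} \<longleftrightarrow> left_idx d = left_idx e"
    unfolding Set.set_eq_iff mem_Collect_eq using assms by metis
  then show ?thesis
    unfolding left_face_J[OF assms(1)] left_face_J[OF assms(2)]
    by (subst inj_on_image_eq_iff[OF inj_J]) auto
qed

lemma orbit_rot_eq_iff:
  assumes "is_dart d" "is_dart e"
  shows "orbit (disk_rot (2 * n) G) (J d) = orbit (disk_rot (2 * n) G) (J e) \<longleftrightarrow> vertex_idx d = vertex_idx e"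
proof -
  have *: "orbit (disk_rot (2 * n) G) (J d) = J ` {e. is_dart e \<and> vertex_idx e = vertex_idx d}" if "is_dart d" for d
    unfolding orbit_rot_dart[OF that, symmetric]
    by (rule orbit_transport[of "Collect is_dart"]) (use that is_dart_closed in \<open>auto simp: disk_rot_J\<close>)
  have "{x. is_dart x \<and> vertex_idx x = vertex_idx d} = {x. is_dart x \<and> vertex_idx x = vertex_idx e} \<longleftrightarrow> vertex_idx d = vertex_idx e"
    unfolding Set.set_eq_iff mem_Collect_eq using assms by metis
  then show ?thesis
    unfolding *[OF assms(1)] *[OF assms(2)]
    by (subst inj_on_image_eq_iff[OF inj_J]) auto
qed

section \<open>Connectedness of the graph\<close>

definition adj :: "(dart \<times> dart) set" where
  "adj = {(d, e). is_dart d \<and> (e = rot_dart d \<or> e = rev_dart d)}"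

lemma same_vertex_connected:
  assumes "is_dart d" "is_dart e" "vertex_idx d = vertex_idx e"
  shows "(d, e) \<in> adj\<^sup>*"
proof -
  have "is_dart x \<and> (d, x) \<in> adj\<^sup>*" if "x \<in> orbit rot_dart d" for x
    using that
  proof induction
    case base
    then show ?case
      using assms is_dart_closed by (auto simp: adj_def)
  next
    case (step x)
    then have "(x, rot_dart x) \<in> adj"
      by (auto simp: adj_def)
    with step.IH show ?case
      using is_dart_closed[of x] by (meson rtrancl.rtrancl_into_rtrancl)
  qed
  moreover have "e \<in> orbit rot_dart d"
    unfolding orbit_rot_dart[OF assms(1)] using assms by simp
  ultimately show ?thesis
    by blast
qed

text \<open>A rotation is undone by further rotations, because the darts at a vertex form one
  cycle.\<close>

lemma sym_adj: "sym (adj\<^sup>*)"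
proof -
  have *: "(e, d) \<in> adj\<^sup>*" if "(d, e) \<in> adj" for d e
  proof -
    have d: "is_dart d" and e: "e = rot_dart d \<or> e = rev_dart d"
      using that by (auto simp: adj_def)
    show ?thesis
      using e
    proof
      assume "e = rot_dart d"
      then show ?thesis
        using same_vertex_connected[of e d] d is_dart_closed vertex_idx_rot_dart by auto
    next
      assume "e = rev_dart d"
      then have "(e, d) \<in> adj"
        using d is_dart_closed rev_dart_rev_dart by (auto simp: adj_def)
      then show ?thesis by blast
    qed
  qed
  have "(e, d) \<in> adj\<^sup>*" if "(d, e) \<in> adj\<^sup>*" for d e
    using that by induction (auto intro: * rtrancl_trans)
  then show ?thesis
    by (auto intro: symI)
qed

lemma adj_rev_dart: "is_dart d \<Longrightarrow> (d, rev_dart d) \<in> adj\<^sup>*"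
  by (auto simp: adj_def)

lemma connected_Rt_angle: "k \<le> h \<Longrightarrow> 0 \<le> t \<Longrightarrow> t < N \<Longrightarrow> (Rt k 0, Rt k t) \<in> adj\<^sup>*"
proof (induction "nat t" arbitrary: t)
  case 0
  then have "t = 0" by simp
  then show ?case by simp
next
  case (Suc j)
  then have t: "0 \<le> t - 1" "t - 1 < N" "(t - 1 + 1) mod N = t" "0 \<le> t" "t < N"
    by auto
  have "(Rt k 0, Rt k (t - 1)) \<in> adj\<^sup>*"
    by (rule Suc.hyps(1)) (use Suc t in auto)
  also have "(Rt k (t - 1), Lt k t) \<in> adj\<^sup>*"
    using adj_rev_dart[of "Rt k (t - 1)"] Suc.prems t by simp
  also have "(Lt k t, Rt k t) \<in> adj\<^sup>*"
    by (rule same_vertex_connected) (use Suc.prems in auto)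
  finally show ?case .
qed

lemma connected_Rt_level: "k \<le> h \<Longrightarrow> (Rt 0 0, Rt k 0) \<in> adj\<^sup>*"
proof (induction k)
  case (Suc k)
  have "(Rt 0 0, Rt k 0) \<in> adj\<^sup>*"
    using Suc by simp
  also have "(Rt k 0, Up (Suc k) 0) \<in> adj\<^sup>*"
    by (rule same_vertex_connected) (use Suc.prems N_pos in auto)
  also have "(Up (Suc k) 0, Dn (Suc k) 0) \<in> adj\<^sup>*"
    using adj_rev_dart[of "Up (Suc k) 0"] Suc.prems N_pos by simp
  also have "(Dn (Suc k) 0, Rt (Suc k) 0) \<in> adj\<^sup>*"
    by (rule same_vertex_connected) (use Suc.prems N_pos in auto)
  finally show ?case .
qed simp

lemma connected_Rt: "k \<le> h \<Longrightarrow> 0 \<le> t \<Longrightarrow> t < N \<Longrightarrow> (Rt 0 0, Rt k t) \<in> adj\<^sup>*"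
  by (rule rtrancl_trans[OF connected_Rt_level connected_Rt_angle])

lemma connected_base: "is_dart d \<Longrightarrow> (Rt 0 0, d) \<in> adj\<^sup>*"
proof (cases "vertex_idx d")
  case (Pair k t)
  assume d: "is_dart d"
  show ?thesis
  proof (cases k)
    case 0
    then obtain s where s: "d = Up 0 s"
      using Pair by (cases d) auto
    have "(Rt 0 0, Rt 0 s) \<in> adj\<^sup>*"
      by (rule connected_Rt) (use d s in auto)
    also have "(Rt 0 s, Dn 0 s) \<in> adj\<^sup>*"
      by (rule same_vertex_connected) (use d s in auto)
    also have "(Dn 0 s, d) \<in> adj\<^sup>*"
      using adj_rev_dart[of "Dn 0 s"] d s by simp
    finally show ?thesis .
  next
    case (Suc j)
    have "is_dart (Rt j t)" "vertex_idx (Rt j t) = vertex_idx d"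
      using d Pair Suc by (cases d; auto split: if_splits)+
    then show ?thesis
      using connected_Rt[of j t] same_vertex_connected[of "Rt j t" d] d by (auto intro: rtrancl_trans)
  qed
qed

lemma connected_darts: "is_dart d \<Longrightarrow> is_dart e \<Longrightarrow> (d, e) \<in> adj\<^sup>*"
  using connected_base sym_adj by (meson rtrancl_trans symE)


section \<open>Counting vertices, edges and faces\<close>

lemma finite_darts: "finite (Collect is_dart)"
proof (rule finite_subset)
  let ?A = "{0..h} \<times> {0..<N}"
  show "Collect is_dart \<subseteq> case_prod Up ` ?A \<union> case_prod Dn ` ?A \<union> case_prod Rt ` ?A \<union> case_prod Lt ` ?A"
  proof
    fix d assume "d \<in> Collect is_dart"
    then show "d \<in> case_prod Up ` ?A \<union> case_prod Dn ` ?A \<union> case_prod Rt ` ?A \<union> case_prod Lt ` ?A"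
      by (cases d) force+
  qed
qed simp

lemma finite_parity [simp]: "finite {t. 0 \<le> t \<and> t < N \<and> even t}" "finite {t. 0 \<le> t \<and> t < N \<and> odd t}"
  by (rule finite_subset[of _ "{0..<N}"]; auto)+

lemma card_parity: "card {t \<in> {0..<N}. even t} = n" "card {t \<in> {0..<N}. odd t} = n"
proof -
  have "{t \<in> {0..<N}. even t} = (\<lambda>x. 2 * int x) ` {..<n}"
    by (auto elim!: evenE intro!: image_eqI[of _ _ "nat _"])
  then show 1: "card {t \<in> {0..<N}. even t} = n"
    by (simp add: card_image inj_on_def)
  have "{t \<in> {0..<N}. odd t} = (\<lambda>x. 2 * int x + 1) ` {..<n}"
    by (auto elim!: oddE intro!: image_eqI[of _ _ "nat _"])
  then show "card {t \<in> {0..<N}. odd t} = n"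
    by (simp add: card_image inj_on_def)
qed

lemma card_vertices: "card (vertex_idx ` Collect is_dart) = 1 + (h + 1) * (2 * n)"
proof -
  have "vertex_idx ` Collect is_dart = {(0, 0)} \<union> {1..h + 1} \<times> {0..<N}" (is "_ = ?R")
  proof
    show "vertex_idx ` Collect is_dart \<subseteq> ?R"
    proof
      fix v assume "v \<in> vertex_idx ` Collect is_dart"
      then obtain d where "is_dart d" "v = vertex_idx d"
        by auto
      then show "v \<in> ?R"
        by (cases d) auto
    qed
    show "?R \<subseteq> vertex_idx ` Collect is_dart"
    proof
      fix v assume v: "v \<in> ?R"
      obtain k t where kt: "v = (k, t)"
        by fastforce
      consider "v = (0, 0)" | "1 \<le> k" "k \<le> h + 1" "0 \<le> t" "t < N"
        using v kt by auto
      then show "v \<in> vertex_idx ` Collect is_dart"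
      proof cases
        case 1
        then have "vertex_idx (Up 0 1) = v" "is_dart (Up 0 1)"
          using int_n by auto
        then show ?thesis by (metis imageI mem_Collect_eq)
      next
        case 2
        then have "vertex_idx (Rt (k - 1) t) = v" "is_dart (Rt (k - 1) t)"
          using kt by auto
        then show ?thesis by (metis imageI mem_Collect_eq)
      qed
    qed
  qed
  then show ?thesis
    by (simp add: card_cartesian_product nat_mult_distrib)
qed

lemma left_idx_image: "left_idx ` Collect is_dart = {0} \<times> {t \<in> {0..<N}. even t} \<union> {1..h} \<times> {0..<N} \<union> {(Suc h, 0)}"
  (is "_ = ?R")
proof
  show "left_idx ` Collect is_dart \<subseteq> ?R"
  proof
    fix f assume "f \<in> left_idx ` Collect is_dart"
    then obtain d where "is_dart d" "f = left_idx d"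
      by auto
    then show "f \<in> ?R"
      by (cases d) (auto simp: face_def parity_mod)
  qed
  show "?R \<subseteq> left_idx ` Collect is_dart"
  proof
    fix f assume f: "f \<in> ?R"
    obtain k t where kt: "f = (k, t)"
      by fastforce
    consider "k = 0" "0 \<le> t" "t < N" "even t" | "1 \<le> k" "k \<le> h" "0 \<le> t" "t < N" | "f = (Suc h, 0)"
      using f kt by auto
    then show "f \<in> left_idx ` Collect is_dart"
    proof cases
      case 1
      then have "left_idx (Lt 0 ((t + 1) mod N)) = f" "is_dart (Lt 0 ((t + 1) mod N))"
        using kt face_mod_diff[of 0 t 1 1] by (auto simp: face_def)
      then show ?thesis by (metis imageI mem_Collect_eq)
    next
      case 2
      then have "left_idx (Rt (k - 1) t) = f" "is_dart (Rt (k - 1) t)"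
        using kt by (auto simp: face_def)
      then show ?thesis by (metis imageI mem_Collect_eq)
    next
      case 3
      then have "left_idx (Rt h 0) = f" "is_dart (Rt h 0)"
        using N_pos by (auto simp: face_def)
      then show ?thesis by (metis imageI mem_Collect_eq)
    qed
  qed
qed

lemma card_faces: "card (left_idx ` Collect is_dart) = n + h * (2 * n) + 1"
proof -
  have "card ({0::nat} \<times> {t \<in> {0..<N}. even t} \<union> {1..h} \<times> {0..<N} \<union> {(Suc h, 0)}) =
      card ({0::nat} \<times> {t \<in> {0..<N}. even t} \<union> {1..h} \<times> {0..<N}) + 1"
    by (subst card_Un_disjoint) auto
  also have "card ({0::nat} \<times> {t \<in> {0..<N}. even t} \<union> {1..h} \<times> {0..<N}) = n + h * (2 * n)"
    by (subst card_Un_disjoint) (auto simp: card_cartesian_product card_parity[simplified] nat_mult_distrib)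
  finally show ?thesis
    by (simp add: left_idx_image)
qed

fun edge_index :: "dart \<Rightarrow> bool \<times> nat \<times> int" where
  "edge_index (Up k t) = (False, k, t)"
| "edge_index (Dn k t) = (False, k, t)"
| "edge_index (Rt k t) = (True, k, t)"
| "edge_index (Lt k t) = (True, k, (t - 1) mod N)"

lemma edge_index_eq_iff:
  assumes "is_dart d" "is_dart e"
  shows "{d, rev_dart d} = {e, rev_dart e} \<longleftrightarrow> edge_index d = edge_index e"
proof -
  have 1: "edge_index (rev_dart d) = edge_index d" if "is_dart d" for d
    using that by (cases d) (auto simp: mod_diff_left_eq)
  have 2: "d = e \<or> d = rev_dart e" if "edge_index d = edge_index e" "is_dart d" "is_dart e" for d e
    using that by (cases d; cases e) (auto simp: mod_succ_pred, metis mod_succ_pred(1))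
  show ?thesis
    using 1 2[OF _ assms] rev_dart_rev_dart[OF assms(1)] rev_dart_rev_dart[OF assms(2)] assms by (metis doubleton_eq_iff)
qed

lemma card_edges: "card (edge_index ` Collect is_dart) = n + h * (2 * n) + (h + 1) * (2 * n)"
proof -
  let ?A = "{False} \<times> ({0} \<times> {t \<in> {0..<N}. odd t} \<union> {1..h} \<times> {0..<N})"
  let ?B = "{True} \<times> ({0..h} \<times> {0..<N})"
  have "edge_index ` Collect is_dart = ?A \<union> ?B"
  proof
    show "edge_index ` Collect is_dart \<subseteq> ?A \<union> ?B"
    proof
      fix e assume "e \<in> edge_index ` Collect is_dart"
      then obtain d where "is_dart d" "e = edge_index d"
        by auto
      then show "e \<in> ?A \<union> ?B"
        by (cases d) auto
    qed
    have "x \<in> edge_index ` Collect is_dart" if "x \<in> ?A" for x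
      using that by (auto intro!: image_eqI[of _ _ "Up _ _"])
    moreover have "x \<in> edge_index ` Collect is_dart" if "x \<in> ?B" for x
      using that by (auto intro!: image_eqI[of _ _ "Rt _ _"])
    ultimately show "?A \<union> ?B \<subseteq> edge_index ` Collect is_dart"
      by blast
  qed
  moreover have "card (?A \<union> ?B) = card ?A + card ?B"
    by (rule card_Un_disjoint) auto
  moreover have "card ({0::nat} \<times> {t \<in> {0..<N}. odd t} \<union> {1..h} \<times> {0..<N}) = n + h * (2 * n)"
    by (subst card_Un_disjoint) (auto simp: card_cartesian_product card_parity[simplified] nat_mult_distrib)
  ultimately show ?thesis
    by (simp add: card_cartesian_product nat_mult_distrib)
qed

text \<open>Euler's formula holds with \<open>1 + 2 * n * (h + 1)\<close> vertices,
  \<open>n + 2 * n * h + 1\<close> faces and \<open>n + 2 * n * h + 2 * n * (h + 1)\<close> edges,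
  counting the boundary circle and the outer face.\<close>

lemma embedded: "embedded_in_disk (2 * n) G"
  unfolding embedded_in_disk_def
proof
  let ?R = "{(x, y). x \<in> disk_darts (2 * n) G \<and> (y = disk_rot (2 * n) G x \<or> y = disk_opp (2 * n) G x)}"
  have *: "(J d, J e) \<in> ?R\<^sup>*" if "(d, e) \<in> adj\<^sup>*" for d e
    using that
  proof induction
    case (step x y)
    then have "(J x, J y) \<in> ?R"
      using disk_rot_J disk_opp_J J_image by (auto simp: adj_def)
    with step.IH show ?case
      by (rule rtrancl.rtrancl_into_rtrancl)
  qed simp
  show "\<forall>d\<in>disk_darts (2 * n) G. \<forall>e\<in>disk_darts (2 * n) G. (d, e) \<in> ?R\<^sup>*"
  proof (intro ballI)
    fix d e assume "d \<in> disk_darts (2 * n) G" "e \<in> disk_darts (2 * n) G"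
    then obtain d' e' where "is_dart d'" "is_dart e'" "d = J d'" "e = J e'"
      unfolding J_image[symmetric] by auto
    then show "(d, e) \<in> ?R\<^sup>*"
      using *[OF connected_darts] by simp
  qed
  have "card (orbit (disk_rot (2 * n) G) ` disk_darts (2 * n) G) = card (vertex_idx ` Collect is_dart)"
    unfolding J_image[symmetric] image_image
    by (rule card_image_eq_card_image) (use orbit_rot_eq_iff in auto)
  moreover have "card (left_face (2 * n) G ` disk_darts (2 * n) G) = card (left_idx ` Collect is_dart)"
    unfolding J_image[symmetric] image_image
    by (rule card_image_eq_card_image) (use left_face_eq_iff in auto)
  moreover have "card ((\<lambda>d. {d, disk_opp (2 * n) G d}) ` disk_darts (2 * n) G) = card (edge_index ` Collect is_dart)"
    unfolding J_image[symmetric] image_image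
  proof (rule card_image_eq_card_image)
    fix d e assume de: "d \<in> Collect is_dart" "e \<in> Collect is_dart"
    then have D: "is_dart d" "is_dart e" "is_dart (rev_dart d)" "is_dart (rev_dart e)"
      using is_dart_closed by auto
    have "{J d, J (rev_dart d)} = {J e, J (rev_dart e)} \<longleftrightarrow> J ` {d, rev_dart d} = J ` {e, rev_dart e}"
      by simp
    also have "\<dots> \<longleftrightarrow> {d, rev_dart d} = {e, rev_dart e}"
      by (rule inj_on_image_eq_iff[OF inj_J]) (use D in auto)
    finally show "{J d, disk_opp (2 * n) G (J d)} = {J e, disk_opp (2 * n) G (J e)} \<longleftrightarrow>
        edge_index d = edge_index e"
      using D by (simp add: disk_opp_J edge_index_eq_iff)
  qed
  ultimately show "card (orbit (disk_rot (2 * n) G) ` disk_darts (2 * n) G) +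
      card (left_face (2 * n) G ` disk_darts (2 * n) G) =
      card ((\<lambda>d. {d, disk_opp (2 * n) G d}) ` disk_darts (2 * n) G) + 2"
    by (simp add: card_vertices card_faces card_edges)
qed

lemma rev_dart_rev_dart_graph: "d \<in> graph_darts \<Longrightarrow> rev_dart (rev_dart d) = d"
  by (simp add: graph_darts_def rev_dart_rev_dart)

lemma is_black_graph_rot: "d \<in> graph_darts \<Longrightarrow> is_black (graph_rot d) \<longleftrightarrow> is_black d"
  by (cases d rule: rot_dart.cases) (auto simp: graph_darts_def graph_rot_def)

lemma is_black_rev_dart:
  assumes "d \<in> graph_darts" "d \<notin> range (Dn h)" "d \<notin> range (Up h)"
  shows "is_black (rev_dart d) \<longleftrightarrow> \<not> is_black d"
proof -
  show ?thesis
    using assms h_pos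
    by (cases d rule: rot_dart.cases; cases "rev_dart d" rule: rot_dart.cases) (auto simp: graph_darts_def parity_mod image_iff)
qed

lemma to_nat_in_image: "to_nat d \<in> to_nat ` D \<longleftrightarrow> d \<in> D"
  by auto

lemma inner_edge_G: "d \<in> graph_darts \<Longrightarrow> inner_edge (2 * n) G (to_nat d) \<longleftrightarrow> d \<notin> range (Dn h) \<and> d \<notin> range (Up h)"
proof -
  assume d: "d \<in> graph_darts"
  have "\<And>k t. d = Dn k t \<Longrightarrow> 0 \<le> t \<and> t < N" "\<And>k t. d = Up k t \<Longrightarrow> 0 \<le> t \<and> t < N"
    using d by (auto simp: graph_darts_def)
  moreover have "rev_dart d \<in> {Dn h t |t. 0 \<le> t \<and> t < N} \<longleftrightarrow> d \<in> {Up h t |t. 0 \<le> t \<and> t < N}"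
    by (cases d) auto
  ultimately show ?thesis
    using d unfolding inner_edge_def bdry_image by (auto simp: ext_to_nat to_nat_in_image)
qed

lemma plabic_graph_G: "plabic_graph (2 * n) G"
  unfolding plabic_graph_def
proof (intro conjI)
  have "finite graph_darts"
    using finite_darts by (rule rev_finite_subset) (auto simp: graph_darts_def)
  then show "finite (darts G)"
    by simp
  show "opp G permutes darts G"
    unfolding G_sel by (rule ext_permutes[of _ rev_dart]) (use graph_closed(1) rev_dart_rev_dart_graph in auto)
  show "rot G permutes darts G"
    unfolding G_sel by (rule ext_permutes[of _ graph_rot_inv_dart]) (auto simp: graph_closed)
  show "\<forall>d\<in>darts G. opp G d \<noteq> d \<and> opp G (opp G d) = d"
    using rev_dart_neq graph_closed(1) rev_dart_rev_dart by (auto simp: ext_to_nat graph_darts_def)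
  show "inj_on (bdry G) {1..2 * n}"
    using comp_inj_on[OF inj_bdart inj_on_subset[OF inj_to_nat subset_UNIV]] unfolding G_sel o_def .
  show "bdry G ` {1..2 * n} \<subseteq> darts G"
    using bdart_in by auto
  show "\<forall>i\<in>{1..2 * n}. rot G (bdry G i) = bdry G i"
    using bdart_in bdart_ex by (auto simp: ext_to_nat graph_rot_def bdart_def)
  show "black G \<subseteq> darts G - bdry G ` {1..2 * n}"
    unfolding bdry_image by auto
  show "\<forall>d\<in>darts G. (rot G d \<in> black G) = (d \<in> black G)"
    using graph_closed(2) is_black_graph_rot by (auto simp: ext_to_nat to_nat_in_image)
  show "\<forall>d. inner_edge (2 * n) G d \<longrightarrow> (opp G d \<in> black G) = (d \<notin> black G)"
  proof (intro allI impI)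
    fix x assume x: "inner_edge (2 * n) G x"
    then obtain d where d: "d \<in> graph_darts" "x = to_nat d"
      by (auto simp: inner_edge_def)
    then show "(opp G x \<in> black G) = (x \<notin> black G)"
      using x graph_closed(1)[OF d(1)] is_black_rev_dart[OF d(1)] inner_edge_G[OF d(1)]
      by (auto simp: ext_to_nat to_nat_in_image)
  qed
  show "embedded_in_disk (2 * n) G"
    by (rule embedded)
qed

end

section \<open>Strands\<close>

context annulus
begin

definition zigzag :: "dart \<Rightarrow> dart" where
  "zigzag d = (if is_black (rev_dart d) then graph_rot_inv_dart (rev_dart d) else graph_rot (rev_dart d))"

lemma zigzag_closed: "d \<in> graph_darts \<Longrightarrow> zigzag d \<in> graph_darts"
  using graph_closed by (simp add: zigzag_def)

lemma zigzag_Dn: "Suc k \<le> h \<Longrightarrow> zigzag (Dn (Suc k) t) = (if even (int k + t) then Lt k t else Rt k t)"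
  "zigzag (Dn 0 t) = Up 0 ((t - 2) mod N)"
  by (auto simp: zigzag_def graph_rot_inv_dart_def graph_rot_def)

lemma zigzag_Up: "k < h \<Longrightarrow> zigzag (Up k t) = (if even (int k + t) then Rt k t else Lt k t)"
  by (auto simp: zigzag_def graph_rot_inv_dart_def graph_rot_def)

lemma zigzag_Rt: "k < h \<Longrightarrow> zigzag (Rt k t) = (if odd (int k + t) then if k = 0 then Rt 0 ((t + 1) mod N) else Dn k ((t + 1) mod N)
    else Up (Suc k) ((t + 1) mod N))"
  using parity_mod[of "t + 1"] by (auto simp: zigzag_def graph_rot_inv_dart_def graph_rot_def)

lemma zigzag_Lt: "k < h \<Longrightarrow> zigzag (Lt k t) = (if odd (int k + t) then Up (Suc k) ((t - 1) mod N) else Dn k ((t - 1) mod N))"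
  using parity_mod[of "t - 1"] by (auto simp: zigzag_def graph_rot_inv_dart_def graph_rot_def)

text \<open>\<open>on_strand i \<tau> d\<close> says that \<open>d\<close> is the dart traversed by strand \<open>i\<close> at time \<open>\<tau>\<close>.  The strands
  with even source turn counterclockwise and pass through the centre, the ones with odd
  source turn clockwise and touch level \<open>0\<close>.\<close>

fun on_strand :: "nat \<Rightarrow> nat \<Rightarrow> dart \<Rightarrow> bool" where
  "on_strand i \<tau> (Dn k t) \<longleftrightarrow>
     (if even i then k \<le> h \<and> t = (int i + 1 + int k) mod N \<and> \<tau> + 2 * k = 2 * h
      else 1 \<le> k \<and> k \<le> h \<and> t = (int i + int n - int k) mod N \<and> \<tau> + 2 * k = 2 * h)"
| "on_strand i \<tau> (Up k t) \<longleftrightarrow>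
     (if even i then k \<le> h \<and> t = (int i - 1 - int k) mod N \<and> \<tau> = 2 * h + 1 + 2 * k
      else 1 \<le> k \<and> k \<le> h \<and> t = (int i + int n + int k) mod N \<and> \<tau> + 1 = 2 * h + 2 * k)"
| "on_strand i \<tau> (Lt k t) \<longleftrightarrow> even i \<and> k < h \<and>
     (t = (int i + 2 + int k) mod N \<and> \<tau> + 2 * k + 1 = 2 * h \<or>
      t = (int i - 1 - int k) mod N \<and> \<tau> = 2 * h + 2 + 2 * k)"
| "on_strand i \<tau> (Rt k t) \<longleftrightarrow> odd i \<and> k < h \<and>
     (t = (int i + int n - 1 - int k) mod N \<and> \<tau> + 2 * k + 1 = 2 * h \<or>
      t = (int i + int n + int k) mod N \<and> \<tau> = 2 * h + 2 * k)"

text \<open>Inward and outward, each of the \<open>h\<close> circles costs one radial and one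
  circular dart. Even strands have two more darts, into the centre and out of it.\<close>

definition strand_len :: "nat \<Rightarrow> nat" where
  "strand_len i = (if even i then 4 * h + 2 else 4 * h)"

lemma on_strand_bound: "on_strand i \<tau> d \<Longrightarrow> \<tau> < strand_len i"
  using h_pos by (cases d) (auto simp: strand_len_def split: if_splits)

lemma on_strand_graph: "on_strand i \<tau> d \<Longrightarrow> d \<in> graph_darts"
  using odd_n by (cases d) (auto simp: graph_darts_def parity_mod split: if_splits)

lemma on_strand_unique: "on_strand i \<tau> d \<Longrightarrow> on_strand i \<tau> e \<Longrightarrow> d = e"
proof -
  have 1: "\<tau> + 2 * a = 2 * h \<Longrightarrow> \<tau> + 2 * b = 2 * h \<Longrightarrow> a = b"
    and 2: "Suc (\<tau> + 2 * a) = 2 * h \<Longrightarrow> Suc (\<tau> + 2 * b) = 2 * h \<Longrightarrow> a = b" for a b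
    by simp_all
  show "on_strand i \<tau> d \<Longrightarrow> on_strand i \<tau> e \<Longrightarrow> d = e"
    by (cases d; cases e) (auto split: if_splits dest: 1 2, presburger+)
qed

lemma on_strand_last: "on_strand i \<tau> d \<Longrightarrow> d \<in> range (Up h) \<longleftrightarrow> Suc \<tau> = strand_len i"
  using h_pos by (cases d) (auto simp: strand_len_def image_iff split: if_splits; presburger)+

lemma on_strand_0: "on_strand i 0 (bdart i)"
proof -
  have "(int i + int n - int h) mod N = (int i + 1 + int h) mod N"
    using int_n by (simp add: algebra_simps)
  then show ?thesis
    using h_pos by (simp add: bdart_def algebra_simps)
qed

lemma on_strand_Suc:
  assumes "on_strand i \<tau> d" "Suc \<tau> < strand_len i"
  shows "on_strand i (Suc \<tau>) (zigzag d)"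
proof (cases d)
  case (Dn k t)
  show ?thesis
  proof (cases k)
    case 0
    have "((int i + 1) mod N - 2) mod N = (int i - 1) mod N"
      unfolding mod_diff_left_eq by simp
    then show ?thesis
      using assms Dn 0 by (auto simp: zigzag_Dn split: if_splits)
  next
    case (Suc j)
    have "even (int j + (int i + 1 + int k) mod N) \<longleftrightarrow> even i"
      "even (int j + (int i + int n - int k) mod N) \<longleftrightarrow> even i"
      using Suc odd_n by (auto simp: parity_mod)
    then show ?thesis
      using assms Dn Suc by (auto simp: zigzag_Dn algebra_simps split: if_splits)
  qed
next
  case (Up k t)
  have "k < h"
    using assms Up on_strand_last[OF assms(1)] by (auto split: if_splits)
  moreover have "even (int k + (int i - 1 - int k) mod N) \<longleftrightarrow> odd i"
    "even (int k + (int i + int n + int k) mod N) \<longleftrightarrow> odd i"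
    using odd_n by (auto simp: parity_mod)
  ultimately show ?thesis
    using assms Up by (auto simp: zigzag_Up algebra_simps split: if_splits)
next
  case (Rt k t)
  have i: "odd i" and k: "k < h"
    using assms Rt by auto
  have par: "odd (int k + (int i + int n - 1 - int k) mod N)"
    "even (int k + (int i + int n + int k) mod N)"
    using odd_n i by (simp_all add: parity_mod)
  have m: "((int i + int n - 1 - int k) mod N + 1) mod N = (int i + int n - int k) mod N"
    "((int i + int n + int k) mod N + 1) mod N = (int i + int n + int (Suc k)) mod N"
    unfolding mod_add_left_eq by (simp_all add: algebra_simps)
  show ?thesis
    using assms(1) i k par m by (auto simp: Rt zigzag_Rt)
next
  case (Lt k t)
  have i: "even i" and k: "k < h"
    using assms Lt by auto
  have par: "even (int k + (int i + 2 + int k) mod N)" "odd (int k + (int i - 1 - int k) mod N)"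
    using i by (simp_all add: parity_mod)
  have m: "((int i + 2 + int k) mod N - 1) mod N = (int i + 1 + int k) mod N"
    "((int i - 1 - int k) mod N - 1) mod N = (int i - 1 - int (Suc k)) mod N"
    unfolding mod_diff_left_eq by (simp_all add: algebra_simps)
  show ?thesis
    using assms(1) i k par m by (auto simp: Lt zigzag_Lt)
qed

definition strand_dart :: "nat \<Rightarrow> nat \<Rightarrow> dart" where
  "strand_dart i \<tau> = (zigzag ^^ \<tau>) (bdart i)"

lemma on_strand_strand_dart: "\<tau> < strand_len i \<Longrightarrow> on_strand i \<tau> (strand_dart i \<tau>)"
proof (induction \<tau>)
  case (Suc \<tau>)
  then show ?case
    using on_strand_Suc[of i \<tau> "strand_dart i \<tau>"] by (simp add: strand_dart_def)
qed (simp add: strand_dart_def on_strand_0)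

lemma on_strand_iff: "on_strand i \<tau> d \<longleftrightarrow> \<tau> < strand_len i \<and> strand_dart i \<tau> = d"
  using on_strand_strand_dart on_strand_unique on_strand_bound by blast

lemma strand_dart_graph: "strand_dart i \<tau> \<in> graph_darts"
  unfolding strand_dart_def by (induction \<tau>) (auto simp: bdart_in zigzag_closed)

lemma inj_rot: "inj (rot G)"
proof -
  have "rot G permutes darts G"
    unfolding G_sel by (rule ext_permutes[of _ graph_rot_inv_dart]) (auto simp: graph_closed)
  then show ?thesis
    by (rule permutes_inj)
qed

lemma zigzag_step_G:
  assumes "d \<in> graph_darts"
  shows "zigzag_step G (to_nat d) = to_nat (zigzag d)"
proof -
  have r: "rev_dart d \<in> graph_darts"
    using assms by (rule graph_closed)
  have "inv_into UNIV (rot G) (to_nat (rev_dart d)) = to_nat (graph_rot_inv_dart (rev_dart d))"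
    by (rule inv_into_f_eq[OF inj_rot]) (use graph_closed[OF r] in \<open>auto simp: ext_to_nat\<close>)
  then show ?thesis
    using assms r by (auto simp: zigzag_step_def zigzag_def ext_to_nat)
qed

lemma zigzag_funpow:
  assumes "d \<in> graph_darts"
  shows "(zigzag_step G ^^ \<tau>) (to_nat d) = to_nat ((zigzag ^^ \<tau>) d) \<and> (zigzag ^^ \<tau>) d \<in> graph_darts"
  by (induction \<tau>) (auto simp: assms zigzag_step_G zigzag_closed)

lemma opp_in_bdry:
  assumes "d \<in> graph_darts"
  shows "opp G (to_nat d) \<in> bdry G ` {1..2 * n} \<longleftrightarrow> d \<in> range (Up h)"
proof -
  have "\<And>k t. d = Up k t \<Longrightarrow> 0 \<le> t \<and> t < N"
    using assms by (auto simp: graph_darts_def)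
  then have "rev_dart d \<in> {Dn h t |t. 0 \<le> t \<and> t < N} \<longleftrightarrow> d \<in> range (Up h)"
    by (cases d) (auto simp: image_iff)
  moreover have "to_nat (rev_dart d) \<in> to_nat ` {Dn h t |t. 0 \<le> t \<and> t < N} \<longleftrightarrow> rev_dart d \<in> {Dn h t |t. 0 \<le> t \<and> t < N}"
    by auto
  ultimately show ?thesis
    unfolding bdry_image using assms by (simp add: ext_to_nat)
qed

lemma strand_len_pos: "0 < strand_len i"
  using h_pos by (simp add: strand_len_def)

lemma strand_G: "strand (2 * n) G i = map (\<lambda>\<tau>. to_nat (strand_dart i \<tau>)) [0..<strand_len i]"
proof -
  have z: "(zigzag_step G ^^ t) (bdry G i) = to_nat (strand_dart i t)" for t
    using zigzag_funpow[OF bdart_in] by (simp add: strand_dart_def)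
  have "(LEAST t. opp G ((zigzag_step G ^^ t) (bdry G i)) \<in> bdry G ` {1..2 * n}) = strand_len i - 1"
    unfolding z opp_in_bdry[OF strand_dart_graph]
  proof (rule Least_equality)
    show "strand_dart i (strand_len i - 1) \<in> range (Up h)"
      using on_strand_strand_dart[of "strand_len i - 1" i] on_strand_last[of i "strand_len i - 1"] strand_len_pos[of i]
      by simp
  next
    fix t assume t: "strand_dart i t \<in> range (Up h)"
    show "strand_len i - 1 \<le> t"
    proof (rule ccontr)
      assume "\<not> ?thesis"
      then have "t < strand_len i" "Suc t \<noteq> strand_len i"
        by auto
      with t on_strand_last[OF on_strand_strand_dart[of t i]] show False
        by simp
    qed
  qed
  then show ?thesis
    unfolding strand_def z using strand_len_pos[of i] by simp
qed

lemma set_strand_G: "x \<in> set (strand (2 * n) G i) \<longleftrightarrow> (\<exists>\<tau> d. x = to_nat d \<and> on_strand i \<tau> d)"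
  by (auto simp: strand_G on_strand_iff)

lemma strand_end_G: "strand_end (2 * n) G i = wrap (2 * n) (int i + int n - 1)"
proof -
  let ?e = "strand_dart i (strand_len i - 1)"
  have e: "on_strand i (strand_len i - 1) ?e" "?e \<in> range (Up h)"
    using on_strand_strand_dart[of "strand_len i - 1" i] on_strand_last[of i "strand_len i - 1"] strand_len_pos[of i]
    by simp_all
  then obtain t where t: "?e = Up h t"
    by auto
  have "t = (int i + int n + int h) mod N"
  proof (cases "even i")
    case True
    \<comment> \<open>An even strand turns counterclockwise, yet ends at the same shift of its
      source as an odd one, since \<open>N = 4 * h + 2\<close>.\<close>
    have "int i - 1 - int h + N = int i + int n + int h"
      using int_n by simp
    then have "(int i - 1 - int h) mod N = (int i + int n + int h) mod N"
      by (metis mod_add_self2)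
    then show ?thesis
      using e(1) True unfolding t by simp
  next
    case False
    then show ?thesis
      using e(1) unfolding t by simp
  qed
  then have b: "0 \<le> t" "t < N" and "(t - (int h + 1)) mod N = (int i + int n - 1) mod N"
    using mod_diff_left_eq[of "int i + int n + int h" N "int h + 1"]
    by (simp_all add: add_diff_eq)
  then have b3: "wrap (2 * n) (t - int h - 1) = wrap (2 * n) (int i + int n - 1)"
    by (simp add: wrap_cong[OF N_pos'] diff_diff_eq)
  have "last (strand (2 * n) G i) = to_nat (Up h t)"
    unfolding strand_G t[symmetric] using strand_len_pos[of i] by (simp add: last_map)
  moreover have "Up h t \<in> graph_darts"
    using strand_dart_graph t by metis
  ultimately show ?thesis
    unfolding strand_end_def using inv_bdry[OF b] b3 by (simp add: ext_to_nat)
qed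

text \<open>Radial and circular darts alternate, apart from a turn near the centre. A path that has
  started outward keeps going outward, and an inward one reaches the centre or level 0 and then
  turns outward.\<close>

lemma reaches_boundary:
  assumes "d \<in> graph_darts"
  shows "\<exists>\<tau>. (zigzag ^^ \<tau>) d \<in> range (Up h)"
proof -
  have later: "\<exists>\<tau>. (zigzag ^^ \<tau>) d \<in> range (Up h)" if "\<exists>\<tau>. (zigzag ^^ \<tau>) (zigzag d) \<in> range (Up h)" for d
    using that by (metis funpow_Suc_right o_apply)
  have up: "\<exists>\<tau>. (zigzag ^^ \<tau>) (Up k t) \<in> range (Up h)" if "k \<le> h" for k t
    using that
  proof (induction k arbitrary: t rule: inc_induct)
    case base
    show ?case
      by (rule exI[of _ 0]) simp
  next
    case (step k)
    have "zigzag (zigzag (Up k t)) \<in> range (Up (Suc k))"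
      using step.hyps by (cases "even (int k + t)") (simp_all add: zigzag_Up zigzag_Rt zigzag_Lt)
    then obtain s where s: "zigzag (zigzag (Up k t)) = Up (Suc k) s"
      by auto
    show ?case
      by (rule later, rule later) (simp only: s step.IH)
  qed
  have dn: "\<exists>\<tau>. (zigzag ^^ \<tau>) (Dn k t) \<in> range (Up h)" if "k \<le> h" for k t
    using that
  proof (induction k arbitrary: t)
    case 0
    show ?case
      by (rule later) (simp add: zigzag_Dn up)
  next
    case (Suc k)
    have k: "k < h"
      using Suc.prems by simp
    have IH: "\<exists>\<tau>. (zigzag ^^ \<tau>) (Dn k s) \<in> range (Up h)" for s
      by (rule Suc.IH) (use k in simp)
    show ?case
    proof (rule later)
      show "\<exists>\<tau>. (zigzag ^^ \<tau>) (zigzag (Dn (Suc k) t)) \<in> range (Up h)"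
      proof (rule later)
        show "\<exists>\<tau>. (zigzag ^^ \<tau>) (zigzag (zigzag (Dn (Suc k) t))) \<in> range (Up h)"
        \<comment> \<open>At level 0 and an even angle there is no edge to the centre, so the path
          follows the circle for one more dart and then turns outward.\<close>
        proof (cases "zigzag (zigzag (Dn (Suc k) t)) \<in> range (Rt 0)")
          case True
          then obtain s where s: "zigzag (zigzag (Dn (Suc k) t)) = Rt 0 s" "odd (int k + t)" "k = 0" "s = (t + 1) mod N"
            using k by (auto simp: zigzag_Dn zigzag_Rt zigzag_Lt split: if_splits)
          then have "zigzag (Rt 0 s) = Up (Suc 0) ((s + 1) mod N)"
            using h_pos by (auto simp: zigzag_Rt parity_mod)
          then show ?thesis
            using later[of "Rt 0 s"] up[of "Suc 0"] h_pos s(1) by simp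
        next
          case False
          then show ?thesis
            using k IH up[of "Suc k"] by (auto simp: zigzag_Dn zigzag_Rt zigzag_Lt split: if_splits)
        qed
      qed
    qed
  qed
  have rt: "\<exists>\<tau>. (zigzag ^^ \<tau>) (Rt k t) \<in> range (Up h)" if "k < h" "k \<noteq> 0 \<or> even t" for k t
    by (rule later) (use that up[of "Suc k"] dn[of k] in \<open>auto simp: zigzag_Rt\<close>)
  have rt': "\<exists>\<tau>. (zigzag ^^ \<tau>) (Rt k t) \<in> range (Up h)" if "k < h" for k t
  proof (cases "k \<noteq> 0 \<or> even t")
    case False
    show ?thesis
      by (rule later) (use that False rt[of 0 "(t + 1) mod N"] parity_mod[of "t + 1"] in \<open>auto simp: zigzag_Rt\<close>)
  qed (use rt that in blast)
  have lt: "\<exists>\<tau>. (zigzag ^^ \<tau>) (Lt k t) \<in> range (Up h)" if "k < h" for k t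
    by (rule later) (use that up[of "Suc k"] dn[of k] in \<open>auto simp: zigzag_Lt\<close>)
  show ?thesis
    using assms up dn rt' lt by (cases d) (auto simp: graph_darts_def)
qed

lemma no_closed_strand: "\<not> has_closed_strand (2 * n) G"
proof
  assume "has_closed_strand (2 * n) G"
  then obtain d where d: "d \<in> graph_darts" "\<And>\<tau>. opp G ((zigzag_step G ^^ \<tau>) (to_nat d)) \<notin> bdry G ` {1..2 * n}"
    by (auto simp: has_closed_strand_def)
  have "(zigzag ^^ \<tau>) d \<notin> range (Up h)" for \<tau>
    using d(2)[of \<tau>] zigzag_funpow[OF d(1), of \<tau>] opp_in_bdry by metis
  then show False
    using reaches_boundary[OF d(1)] by blast
qed

section \<open>Crossings of strands\<close>

lemma mod_eq_cases:
  assumes "x mod N = y mod N"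
  shows "N dvd x - y" "even (x - y)"
proof -
  show "N dvd x - y"
    using assms by (simp add: mod_eq_dvd_iff)
  then show "even (x - y)"
    by (meson dvd_trans dvd_triv_left)
qed

lemma dvd_small: "N dvd x \<Longrightarrow> \<bar>x\<bar> < N \<Longrightarrow> x = 0"
  using zdvd_imp_le[of N "\<bar>x\<bar>"] by force

text \<open>All circular darts of a strand point the same way, so it could only retrace a radial
  edge. At level \<open>k\<close> its inward and outward passages are \<open>2 * k + 2\<close> or
  \<open>2 * k\<close> angles apart, which is not a multiple of \<open>N\<close>.\<close>

lemma no_self_intersection: "\<not> (on_strand i \<tau> d \<and> on_strand i \<tau>' (rev_dart d))"
proof
  assume *: "on_strand i \<tau> d \<and> on_strand i \<tau>' (rev_dart d)"
  have 1: False if "(int i + 1 + int k) mod N = (int i - 1 - int k) mod N" "k \<le> h" for k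
    using mod_eq_cases(1)[OF that(1)] dvd_small[of "2 * int k + 2"] that(2) int_n h_pos by (simp add: algebra_simps)
  have 2: False if "(int i + int n - int k) mod N = (int i + int n + int k) mod N" "1 \<le> k" "k \<le> h" for k
    using mod_eq_cases(1)[OF that(1)] dvd_small[of "- 2 * int k"] that(2,3) int_n by (simp add: algebra_simps)
  show False
    using * by (cases d) (auto split: if_splits dest: 1 2 1[OF sym] 2[OF sym])
qed

lemma on_strand_time:
  "on_strand i \<tau> (Dn k t) \<Longrightarrow> \<tau> + 2 * k = 2 * h"
  "on_strand i \<tau> (Up k t) \<Longrightarrow> \<tau> + (if even i then 0 else 2) = 2 * h + 1 + 2 * k"
  "on_strand i \<tau> (Rt k t) \<Longrightarrow> odd i" "on_strand i \<tau> (Lt k t) \<Longrightarrow> even i"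
  by (auto split: if_splits)

text \<open>Two strands of equal parity can meet only on radial edges, one running inward and the
  other outward, hence they meet any two crossings in opposite orders. Strands of different parity
  can meet only on circular edges, both still inward or both already outward; the congruences for
  the level then allow at most one crossing.\<close>

lemma no_lens:
  assumes "on_strand i a p" "on_strand i b q" "on_strand j c (rev_dart p)" "on_strand j d (rev_dart q)" "a < b" "c < d"
  shows False
proof -
  have same: False if "even i \<longleftrightarrow> even j"
    using assms that
    by (cases p; cases q) (auto simp del: on_strand.simps dest!: on_strand_time split: if_splits)
  have mixed: False if ij: "even i'" "odd j'" and on: "on_strand i' a' p" "on_strand i' b' q"
    "on_strand j' c' (rev_dart p)" "on_strand j' d' (rev_dart q)" and ab: "a' < b'" "c' < d'" for i' j' a' b' c' d' p q
  proof -
    \<comment> \<open>Here \<open>k\<close> is the level of the crossing; the first alternative is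
      the inward half of both strands, the second the outward half.\<close>
    have cross: "(\<exists>k. N dvd 2 * int k + int i' - int j' - int n + 2 \<and> k < h \<and> \<tau> + 2 * k + 1 = 2 * h \<and> \<tau>' + 2 * k + 1 = 2 * h) \<or>
        (\<exists>k. N dvd 2 * int k + int j' - int i' + int n + 2 \<and> k < h \<and> \<tau> = 2 * h + 2 + 2 * k \<and> \<tau>' = 2 * h + 2 * k)"
      if p: "on_strand i' \<tau> p" "on_strand j' \<tau>' (rev_dart p)" for \<tau> \<tau>' p
    proof (cases p)
      case (Up k t)
      have "(int i' - 1 - int k) mod N = (int j' + int n - int k) mod N"
        using p ij Up by auto
      from mod_eq_cases(2)[OF this] show ?thesis
        using ij odd_n by simp
    next
      case (Dn k t)
      have "(int i' + 1 + int k) mod N = (int j' + int n + int k) mod N"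
        using p ij Dn by auto
      from mod_eq_cases(2)[OF this] show ?thesis
        using ij odd_n by simp
    next
      case (Rt k t)
      then show ?thesis using p ij by auto
    next
      case (Lt k t)
      have k: "k < h"
        using p Lt by simp
      consider "t = (int i' + 2 + int k) mod N" "\<tau> + 2 * k + 1 = 2 * h"
        | "t = (int i' - 1 - int k) mod N" "\<tau> = 2 * h + 2 + 2 * k"
        using p Lt by auto
      then show ?thesis
      proof cases
        case 1
        have m: "(t - 1) mod N = (int i' + 1 + int k) mod N"
          unfolding 1 mod_diff_left_eq by (simp add: algebra_simps)
        consider "(t - 1) mod N = (int j' + int n - 1 - int k) mod N" "\<tau>' + 2 * k + 1 = 2 * h"
          | "(t - 1) mod N = (int j' + int n + int k) mod N"
          using p Lt by auto
        then show ?thesis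
        proof cases
          case a: 1
          from mod_eq_cases(1)[OF a(1)[unfolded m]] have "N dvd 2 * int k + int i' - int j' - int n + 2"
            by (simp add: algebra_simps)
          then show ?thesis using k 1 a by blast
        next
          case a: 2
          from mod_eq_cases(2)[OF a[unfolded m]] show ?thesis
            using ij odd_n by simp
        qed
      next
        case 2
        have m: "(t - 1) mod N = (int i' - 2 - int k) mod N"
          unfolding 2 mod_diff_left_eq by (simp add: algebra_simps)
        consider "(t - 1) mod N = (int j' + int n - 1 - int k) mod N"
          | "(t - 1) mod N = (int j' + int n + int k) mod N" "\<tau>' = 2 * h + 2 * k"
          using p Lt by auto
        then show ?thesis
        proof cases
          case a: 2
          from mod_eq_cases(1)[OF a(1)[unfolded m]]
          have "N dvd - (2 * int k + int j' - int i' + int n + 2)"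
            by (simp add: algebra_simps)
          then have "N dvd 2 * int k + int j' - int i' + int n + 2"
            by (simp only: dvd_minus_iff)
          then show ?thesis using k 2 a by blast
        next
          case a: 1
          from mod_eq_cases(2)[OF a[unfolded m]] show ?thesis
            using ij odd_n by simp
        qed
      qed
    qed
    have eq: "k = k'" if "N dvd 2 * int k + x" "N dvd 2 * int k' + x" "k < h" "k' < h" for k k' x
    proof -
      have "N dvd 2 * int k - 2 * int k'"
        using dvd_diff[OF that(1,2)] by simp
      then have "2 * int k - 2 * int k' = 0"
        by (rule dvd_small) (use that int_n in auto)
      then show ?thesis by simp
    qed
    have opposite: False if "N dvd 2 * int k + int i' - int j' - int n + 2" "N dvd 2 * int k' + int j' - int i' + int n + 2"
      "k < h" "k' < h" for k k'
    proof -
      have "N dvd 2 * int k + 2 * int k' + 4"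
        using dvd_add[OF that(1,2)] by (simp add: algebra_simps)
      then have "2 * int k + 2 * int k' + 4 = 0"
        by (rule dvd_small) (use that int_n in auto)
      then show False by simp
    qed
    have eq1: "k = k'" if "N dvd 2 * int k + int i' - int j' - int n + 2" "N dvd 2 * int k' + int i' - int j' - int n + 2"
      "k < h" "k' < h" for k k'
      using eq[of k "int i' - int j' - int n + 2" k'] that by (simp add: algebra_simps)
    have eq2: "k = k'" if "N dvd 2 * int k + int j' - int i' + int n + 2" "N dvd 2 * int k' + int j' - int i' + int n + 2"
      "k < h" "k' < h" for k k'
      using eq[of k "int j' - int i' + int n + 2" k'] that by (simp add: algebra_simps)
    show False
      using cross[OF on(1,3)] cross[OF on(2,4)] ab
      by (elim disjE exE conjE) (auto dest: opposite eq1 eq2)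
  qed
  have r: "rev_dart (rev_dart p) = p" "rev_dart (rev_dart q) = q"
    using on_strand_graph[OF assms(1)] on_strand_graph[OF assms(2)] rev_dart_rev_dart by (auto simp: graph_darts_def)
  show False
  proof (cases "even i \<longleftrightarrow> even j")
    case False
    show ?thesis
    proof (cases "even i")
      case True
      then show ?thesis
        using mixed[of i j a p b q c d] assms False by blast
    next
      case even: False
      then show ?thesis
        using mixed[of j i c "rev_dart p" d "rev_dart q" a b] assms False r by metis
    qed
  qed (use same in blast)
qed

lemma reduced_G: "reduced (2 * n) G"
  unfolding reduced_def
proof (intro conjI ballI impI)
  fix i
  show "\<not> self_intersecting (2 * n) G (strand (2 * n) G i)"
  proof
    assume "self_intersecting (2 * n) G (strand (2 * n) G i)"
    then obtain \<tau> d \<tau>' e where "on_strand i \<tau> d" "on_strand i \<tau>' e" "opp G (to_nat d) = to_nat e"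
      unfolding self_intersecting_def Bex_def set_strand_G by blast
    then show False
      using no_self_intersection[of i \<tau> d] on_strand_graph[of i \<tau> d] by (simp add: ext_to_nat)
  qed
next
  fix i j
  show "\<not> oriented_lens G (strand (2 * n) G i) (strand (2 * n) G j)"
  proof
    assume "oriented_lens G (strand (2 * n) G i) (strand (2 * n) G j)"
    then obtain a b c d where *: "a < b" "b < strand_len i" "c < d" "d < strand_len j"
        "strand_dart i a = rev_dart (strand_dart j c)" "strand_dart i b = rev_dart (strand_dart j d)"
      unfolding oriented_lens_def strand_G by (auto simp: ext_to_nat strand_dart_graph)
    have "rev_dart (strand_dart i a) = strand_dart j c" "rev_dart (strand_dart i b) = strand_dart j d"
      unfolding *(5,6) using strand_dart_graph rev_dart_rev_dart by (auto simp: graph_darts_def)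
    then have "on_strand i a (strand_dart i a)" "on_strand i b (strand_dart i b)"
      "on_strand j c (rev_dart (strand_dart i a))" "on_strand j d (rev_dart (strand_dart i b))"
      using on_strand_strand_dart *(1-4) by simp_all
    then show False
      using no_lens *(1,3) by blast
  qed
qed (rule no_closed_strand)

end

section \<open>Winding numbers and face labels\<close>

lemma count_list_distinct: "distinct xs \<Longrightarrow> count_list xs x = (if x \<in> set xs then 1 else 0)"
  by (induction xs) auto

context annulus
begin

text \<open>The second alternative is the boundary arc closing the strand: \<open>n + 1\<close>
  consecutive clockwise darts, as the strand itself advances by \<open>n - 1\<close> of
  \<open>2 * n\<close>.\<close>

definition on_circuit :: "nat \<Rightarrow> dart \<Rightarrow> bool" where
  "on_circuit i d \<longleftrightarrow> (\<exists>\<tau>. on_strand i \<tau> d) \<or>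
     (\<exists>t. d = Rt h t \<and> 0 \<le> t \<and> t < N \<and> (t - int i + int h + 1) mod N < int n + 1)"

lemma on_strand_time_unique:
  assumes "on_strand i \<tau> d" "on_strand i \<tau>' d"
  shows "\<tau> = \<tau>'"
proof -
  have 1: False if "(int i + 2 + int k) mod N = (int i - 1 - int k) mod N" for k
    using mod_eq_cases(2)[OF that] by simp
  have 2: False if "(int i + int n - 1 - int k) mod N = (int i + int n + int k) mod N" for k
    using mod_eq_cases(2)[OF that] by simp
  show ?thesis
    using assms by (cases d) (auto split: if_splits dest: 1 2 1[OF sym] 2[OF sym])
qed

lemma circuit_G: "circuit (2 * n) G i =
    map (\<lambda>\<tau>. Edge (to_nat (strand_dart i \<tau>))) [0..<strand_len i] @
    map (\<lambda>s. CW (wrap (2 * n) (int i + int n - 1 + int s))) [0..<n + 1]"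
proof -
  have len: "(int i - int (strand_end (2 * n) G i)) mod N = int n + 1"
  proof -
    have "(int i - int (wrap (2 * n) (int i + int n - 1))) mod N = (int i - (int i + int n - 1)) mod N"
      using wrap_mod[OF N_pos', of "int i + int n - 1"] by (intro mod_diff_cong) auto
    also have "\<dots> = (1 - int n + N) mod N"
      by (simp only: mod_add_self2) (simp add: algebra_simps)
    also have "\<dots> = int n + 1"
      using int_n h_pos by simp
    finally show ?thesis
      by (simp add: strand_end_G)
  qed
  have w: "wrap (2 * n) (int (wrap (2 * n) x) + y) = wrap (2 * n) (x + y)" for x y
    unfolding wrap_cong[OF N_pos'] using wrap_mod[OF N_pos', of x] by (intro mod_add_cong) auto
  have "nat (int n + 1) = n + 1"
    by simp
  then show ?thesis
    unfolding circuit_def using len by (simp add: strand_G strand_end_G w o_def)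
qed

lemma J_in_circuit:
  assumes d: "is_dart d"
  shows "J d \<in> set (circuit (2 * n) G i) \<longleftrightarrow> on_circuit i d"
proof -
  have "J d = Edge (to_nat (strand_dart i \<tau>)) \<longleftrightarrow> d = strand_dart i \<tau>" for \<tau>
  proof -
    have "is_dart (strand_dart i \<tau>)"
      using strand_dart_graph by (simp add: graph_darts_def)
    then show ?thesis
      using inj_J d unfolding J_graph[OF strand_dart_graph, symmetric] by (auto dest: inj_onD)
  qed
  then have e: "J d \<in> (\<lambda>\<tau>. Edge (to_nat (strand_dart i \<tau>))) ` {0..<strand_len i} \<longleftrightarrow> (\<exists>\<tau>. on_strand i \<tau> d)"
    by (auto simp: on_strand_iff image_iff)
  have c: "J d \<in> (\<lambda>s. CW (wrap (2 * n) (int i + int n - 1 + int s))) ` {0..<n + 1} \<longleftrightarrow>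
      (\<exists>t. d = Rt h t \<and> 0 \<le> t \<and> t < N \<and> (t - int i + int h + 1) mod N < int n + 1)"
  proof (cases "d \<in> range (Rt h)")
    case True
    then obtain t where t: "d = Rt h t"
      by auto
    have "J d = CW (wrap (2 * n) (int i + int n - 1 + int s)) \<longleftrightarrow> (t - int i + int h + 1) mod N = int s"
      if "s < n + 1" for s
    proof -
      have "J d = CW (wrap (2 * n) (int i + int n - 1 + int s)) \<longleftrightarrow>
          N dvd (t - int h - 1) - (int i + int n - 1 + int s)"
        by (simp add: t wrap_cong[OF N_pos'] mod_eq_dvd_iff)
      also have "\<dots> \<longleftrightarrow> N dvd (t - int h - 1) - (int i + int n - 1 + int s) + N * 1"
        by (subst dvd_add_left_iff) simp_all
      also have "(t - int h - 1) - (int i + int n - 1 + int s) + N * 1 = (t - int i + int h + 1) - int s"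
        using int_n by simp
      also have "N dvd \<dots> \<longleftrightarrow> (t - int i + int h + 1) mod N = int s mod N"
        by (simp add: mod_eq_dvd_iff)
      also have "int s mod N = int s"
        using that n_eq h_pos by simp
      finally show ?thesis .
    qed
    then have "J d \<in> (\<lambda>s. CW (wrap (2 * n) (int i + int n - 1 + int s))) ` {0..<n + 1} \<longleftrightarrow>
        (\<exists>s<n + 1. (t - int i + int h + 1) mod N = int s)"
      by (auto simp: image_iff)
    also have "\<dots> \<longleftrightarrow> (t - int i + int h + 1) mod N < int n + 1"
    proof
      assume "(t - int i + int h + 1) mod N < int n + 1"
      then show "\<exists>s<n + 1. (t - int i + int h + 1) mod N = int s"
        by (intro exI[of _ "nat ((t - int i + int h + 1) mod N)"]) (auto simp: nat_less_iff)
    qed auto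
    finally show ?thesis
      using t d by auto
  next
    case False
    then show ?thesis
      by (cases d) auto
  qed
  show ?thesis
    unfolding circuit_G on_circuit_def set_append set_map set_upt Un_iff e c ..
qed

lemma distinct_circuit: "distinct (circuit (2 * n) G i)"
proof -
  have "inj_on (\<lambda>\<tau>. Edge (to_nat (strand_dart i \<tau>))) {0..<strand_len i}"
  proof (rule inj_onI)
    fix \<tau> \<tau>' assume *: "\<tau> \<in> {0..<strand_len i}" "\<tau>' \<in> {0..<strand_len i}"
      "Edge (to_nat (strand_dart i \<tau>)) = Edge (to_nat (strand_dart i \<tau>'))"
    then have "strand_dart i \<tau> = strand_dart i \<tau>'"
      by simp
    then have "on_strand i \<tau> (strand_dart i \<tau>)" "on_strand i \<tau>' (strand_dart i \<tau>)"
      using on_strand_strand_dart[of \<tau> i] on_strand_strand_dart[of \<tau>' i] * by simp_all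
    then show "\<tau> = \<tau>'"
      by (rule on_strand_time_unique)
  qed
  moreover have "inj_on (\<lambda>s. CW (wrap (2 * n) (int i + int n - 1 + int s))) {0..<n + 1}"
  proof (rule inj_onI)
    fix s s' assume s: "s \<in> {0..<n + 1}" "s' \<in> {0..<n + 1}"
      "CW (wrap (2 * n) (int i + int n - 1 + int s)) = CW (wrap (2 * n) (int i + int n - 1 + int s'))"
    then have "N dvd int s - int s'"
      by (simp add: wrap_cong[OF N_pos'] mod_eq_dvd_iff)
    then have "int s - int s' = 0"
      by (rule dvd_small) (use s n_eq h_pos in auto)
    then show "s = s'"
      by simp
  qed
  ultimately show ?thesis
    unfolding circuit_G distinct_append distinct_map set_map set_upt
    by (simp only: distinct_upt simp_thms) auto
qed

text \<open>The circuit closes along the boundary clockwise and so has the encircled faces on its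
  right; this gives winding number -1 for the faces whose label lacks \<open>i\<close>.\<close>

definition face_wn :: "nat \<Rightarrow> nat \<times> int \<Rightarrow> int" where
  "face_wn i = (\<lambda>(k, t). if k \<le> h \<and> \<not> in_lab k t (int i) then - 1 else 0)"

text \<open>The two angles naming one face of ring 0 must give the same label: for odd
  \<open>t\<close> both windows contain \<open>t + 1\<close> as their only even number.\<close>

lemma in_lab_0_shift: "odd t \<Longrightarrow> in_lab 0 (t + 1) j \<longleftrightarrow> in_lab 0 t j"
proof (cases "even j")
  case True
  assume t: "odd t"
  define \<delta> where "\<delta> = (t - j + 1) mod N"
  have "even \<delta>" "0 \<le> \<delta>" "\<delta> < N"
    using True t N_pos by (auto simp: \<delta>_def parity_mod)
  moreover from this have "\<delta> + 1 < N"
    by presburger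
  moreover have "(t + 1 - j + 1) mod N = (\<delta> + 1) mod N"
    unfolding \<delta>_def mod_add_left_eq by (simp add: algebra_simps)
  ultimately show ?thesis
    using True by (auto simp: in_lab_def \<delta>_def[symmetric] elim!: evenE)
next
  case False
  have "\<not> x mod N < 0" for x
    by (simp add: not_less)
  with False show ?thesis
    by (simp add: in_lab_def)
qed

lemma in_lab_mod: "in_lab k (t mod N) j \<longleftrightarrow> in_lab k t j"
  by (rule in_lab_cong) (auto simp: mod_diff_left_eq)

lemma face_wn_face: "face_wn i (face k t) = (if k \<le> h \<and> \<not> in_lab k t (int i) then - 1 else 0)"
  by (auto simp: face_wn_def face_def in_lab_mod in_lab_0_shift)

text \<open>Translates the position \<open>b\<close> of a strand dart into a value of
  \<open>\<delta>\<close>, the coordinate in which the label windows are described.\<close>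

lemma eq_mod_iff:
  assumes "\<delta> = (t - int i) mod N" "0 \<le> c" "c < N" "b - int i = c \<or> b - int i + N = c"
  shows "t mod N = b mod N \<longleftrightarrow> \<delta> = c"
proof -
  have "t mod N = b mod N \<longleftrightarrow> (t - int i) mod N = (b - int i) mod N"
    by (simp add: mod_eq_dvd_iff)
  also have "(b - int i) mod N = c mod N"
    using assms(4) by (metis mod_add_self2)
  finally show ?thesis
    using assms(1-3) by simp
qed

lemma on_circuit_Up: "on_circuit i (Up k t) \<longleftrightarrow>
    (if even i then k \<le> h \<and> t = (int i - 1 - int k) mod N
     else 1 \<le> k \<and> k \<le> h \<and> t = (int i + int n + int k) mod N)"
proof -
  have "\<exists>\<tau>. \<tau> + 1 = 2 * h + 2 * k" if "1 \<le> k"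
    by (rule exI[of _ "2 * h + 2 * k - 1"]) (use that in simp)
  then show ?thesis
    by (auto simp: on_circuit_def)
qed

lemma on_circuit_Dn: "on_circuit i (Dn k t) \<longleftrightarrow>
    (if even i then k \<le> h \<and> t = (int i + 1 + int k) mod N
     else 1 \<le> k \<and> k \<le> h \<and> t = (int i + int n - int k) mod N)"
proof -
  have "\<exists>\<tau>. \<tau> + 2 * k = 2 * h" if "k \<le> h"
    by (rule exI[of _ "2 * h - 2 * k"]) (use that in simp)
  then show ?thesis
    by (auto simp: on_circuit_def)
qed

lemma on_circuit_Rt_Lt:
  assumes "k < h"
  shows "on_circuit i (Rt k t) \<longleftrightarrow> odd i \<and>
      (t = (int i + int n - 1 - int k) mod N \<or> t = (int i + int n + int k) mod N)"
    and "on_circuit i (Lt k t) \<longleftrightarrow> even i \<and>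
      (t = (int i + 2 + int k) mod N \<or> t = (int i - 1 - int k) mod N)"
proof -
  have "\<exists>\<tau>. Suc (\<tau> + 2 * k) = 2 * h"
    by (rule exI[of _ "2 * h - 2 * k - 1"]) (use assms in simp)
  then show "on_circuit i (Rt k t) \<longleftrightarrow> odd i \<and>
      (t = (int i + int n - 1 - int k) mod N \<or> t = (int i + int n + int k) mod N)"
    and "on_circuit i (Lt k t) \<longleftrightarrow> even i \<and>
      (t = (int i + 2 + int k) mod N \<or> t = (int i - 1 - int k) mod N)"
    using assms by (auto simp: on_circuit_def)
qed

text \<open>The labels on both sides differ in \<open>i\<close> exactly when the ray is an end of
  the window for \<open>i\<close>, and there strand \<open>i\<close> runs along it, outward at one
  end and inward at the other.\<close>

lemma winding_Up:
  assumes d: "is_dart (Up k t)"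
  shows "face_wn i (left_idx (Up k t)) - face_wn i (left_idx (Dn k t)) = of_bool (on_circuit i (Up k t)) - of_bool (on_circuit i (Dn k t))"
proof -
  define \<delta> where "\<delta> = (t - int i) mod N"
  have \<delta>: "0 \<le> \<delta>" "\<delta> < N"
    by (simp_all add: \<delta>_def)
  have \<delta>': "(if \<delta> = 0 then N - 1 else \<delta> - 1) = (t - 1 - int i) mod N"
    unfolding mod_simps_N(2)[OF \<delta>, symmetric] unfolding \<delta>_def mod_diff_left_eq by (simp add: algebra_simps)
  have k: "k \<le> h" and t: "t mod N = t"
    using d by auto
  note E = eq_mod_iff[OF \<delta>_def, unfolded t]
  show ?thesis
  proof (cases "even i")
    case True
    have "t = (int i - 1 - int k) mod N \<longleftrightarrow> \<delta> = N - 1 - int k"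
      by (rule E) (use k int_n h_pos in auto)
    moreover have "t = (int i + 1 + int k) mod N \<longleftrightarrow> \<delta> = 1 + int k"
      by (rule E) (use k int_n h_pos in auto)
    ultimately have "on_circuit i (Up k t) \<longleftrightarrow> \<delta> = N - 1 - int k" "on_circuit i (Dn k t) \<longleftrightarrow> \<delta> = 1 + int k"
      using True k by (simp_all add: on_circuit_Up on_circuit_Dn)
    then show ?thesis
      using True k int_n h_pos \<delta> in_lab_even[of "int i" k _ t, OF _ k \<delta>_def] in_lab_even[of "int i" k _ "t - 1", OF _ k \<delta>']
      by (auto simp: face_wn_face split: if_splits)
  next
    case False
    have "t = (int i + int n + int k) mod N \<longleftrightarrow> \<delta> = int n + int k"
      by (rule E) (use k int_n h_pos in auto)
    moreover have "t = (int i + int n - int k) mod N \<longleftrightarrow> \<delta> = int n - int k"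
      by (rule E) (use k int_n h_pos in auto)
    ultimately have "on_circuit i (Up k t) \<longleftrightarrow> 1 \<le> k \<and> \<delta> = int n + int k" "on_circuit i (Dn k t) \<longleftrightarrow> 1 \<le> k \<and> \<delta> = int n - int k"
      using False k by (simp_all add: on_circuit_Up on_circuit_Dn)
    then show ?thesis
      using False k int_n h_pos \<delta> in_lab_odd[of "int i" k _ t, OF _ k \<delta>_def] in_lab_odd[of "int i" k _ "t - 1", OF _ k \<delta>']
      by (auto simp: face_wn_face split: if_splits)
  qed
qed

text \<open>Between rings \<open>k\<close> and \<open>k + 1\<close> the window for \<open>i\<close>
  grows at its two ends, which are the two places where strand \<open>i\<close> follows the circle.
  For \<open>k = h\<close> the closing boundary arc takes over this role.\<close>

lemma winding_Rt:
  assumes d: "is_dart (Rt k t)"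
  shows "face_wn i (left_idx (Rt k t)) - face_wn i (left_idx (rev_dart (Rt k t))) = of_bool (on_circuit i (Rt k t)) - of_bool (on_circuit i (rev_dart (Rt k t)))"
proof -
  define \<delta> where "\<delta> = (t - int i) mod N"
  have \<delta>: "0 \<le> \<delta>" "\<delta> < N"
    by (simp_all add: \<delta>_def)
  have k: "k \<le> h" and t: "t mod N = t" "0 \<le> t" "t < N"
    using d by auto
  note E = eq_mod_iff[OF \<delta>_def, unfolded t(1)]
  have left_idx: "left_idx (rev_dart (Rt k t)) = face k t"
    using face_mod_diff[of k t 1 1] by simp
  have shift: "(t + 1) mod N = (a + 1) mod N \<longleftrightarrow> t = a mod N" for a
  proof -
    have "(t + 1) mod N = (a + 1) mod N \<longleftrightarrow> t mod N = a mod N"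
      by (simp add: mod_eq_dvd_iff)
    then show ?thesis
      by (simp add: t(1))
  qed
  show ?thesis
  proof (cases "k = h")
    case True
    have "(\<delta> + (int h + 1)) mod N = (t - int i + int h + 1) mod N"
      unfolding \<delta>_def mod_add_left_eq by (simp add: algebra_simps)
    moreover have "(\<delta> + (int h + 1)) mod N = (if \<delta> + (int h + 1) < N then \<delta> + (int h + 1) else \<delta> + (int h + 1) - N)"
      using mod_add_small[OF \<delta>, of "int h + 1"] int_n \<delta>(1) by auto
    ultimately have m: "(t - int i + int h + 1) mod N < int n + 1 \<longleftrightarrow> \<delta> \<le> int h \<or> N - int h - 1 \<le> \<delta>"
      using \<delta> int_n by auto
    have on: "on_circuit i (Rt k t) \<longleftrightarrow> \<delta> \<le> int h \<or> N - int h - 1 \<le> \<delta>" "\<not> on_circuit i (rev_dart (Rt k t))"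
      using True t m by (auto simp: on_circuit_def)
    \<comment> \<open>In ring \<open>h\<close> the conditions for even and odd elements coincide, so
      these labels are cyclic intervals.\<close>
    have "in_lab h t (int i) \<longleftrightarrow> \<not> (\<delta> \<le> int h \<or> N - int h - 1 \<le> \<delta>)"
      using in_lab_even[OF _ order_refl \<delta>_def] in_lab_odd[OF _ order_refl \<delta>_def] int_n
      by (cases "even (int i)") auto
    then show ?thesis
      using on True unfolding left_idx by (simp add: face_wn_face)
  next
    case False
    then have k: "k < h" "k \<le> h" "Suc k \<le> h"
      using k by auto
    show ?thesis
    proof (cases "even i")
      case True
      have "t = (int i + 1 + int k) mod N \<longleftrightarrow> \<delta> = 1 + int k"
        by (rule E) (use k int_n h_pos in auto)
      then have "(t + 1) mod N = (int i + 2 + int k) mod N \<longleftrightarrow> \<delta> = 1 + int k"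
        unfolding shift[symmetric] by (simp add: algebra_simps)
      moreover have "t = (int i - 2 - int k) mod N \<longleftrightarrow> \<delta> = N - 2 - int k"
        by (rule E) (use k int_n h_pos in auto)
      then have "(t + 1) mod N = (int i - 1 - int k) mod N \<longleftrightarrow> \<delta> = N - 2 - int k"
        unfolding shift[symmetric] by (simp add: algebra_simps)
      ultimately have on: "on_circuit i (rev_dart (Rt k t)) \<longleftrightarrow> \<delta> = 1 + int k \<or> \<delta> = N - 2 - int k" "\<not> on_circuit i (Rt k t)"
        using True k by (simp_all add: on_circuit_Rt_Lt)
      then show ?thesis
        using True k int_n h_pos \<delta> in_lab_even[of "int i" k, OF _ k(2) \<delta>_def] in_lab_even[of "int i" "Suc k", OF _ k(3) \<delta>_def]
        unfolding left_idx by (auto simp: face_wn_face split: if_splits)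
    next
      case odd: False
      have "t = (int i + int n - 1 - int k) mod N \<longleftrightarrow> \<delta> = int n - 1 - int k"
        by (rule E) (use k int_n h_pos in auto)
      moreover have "t = (int i + int n + int k) mod N \<longleftrightarrow> \<delta> = int n + int k"
        by (rule E) (use k int_n h_pos in auto)
      ultimately have on: "on_circuit i (Rt k t) \<longleftrightarrow> \<delta> = int n - 1 - int k \<or> \<delta> = int n + int k" "\<not> on_circuit i (rev_dart (Rt k t))"
        using odd k by (simp_all add: on_circuit_Rt_Lt)
      then show ?thesis
        using odd k int_n h_pos \<delta> in_lab_odd[of "int i" k, OF _ k(2) \<delta>_def] in_lab_odd[of "int i" "Suc k", OF _ k(3) \<delta>_def]
        unfolding left_idx by (auto simp: face_wn_face split: if_splits)
    qed
  qed
qed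

lemma winding_dart:
  assumes d: "is_dart d"
  shows "face_wn i (left_idx d) - face_wn i (left_idx (rev_dart d)) = of_bool (on_circuit i d) - of_bool (on_circuit i (rev_dart d))"
proof (cases d)
  case (Up k t)
  then show ?thesis using winding_Up d by simp
next
  case (Dn k t)
  then show ?thesis using winding_Up[of k t i] d by simp
next
  case (Rt k t)
  then show ?thesis using winding_Rt d by simp
next
  case (Lt k t)
  then have r: "rev_dart d = Rt k ((t - 1) mod N)"
    by simp
  have "is_dart (rev_dart d)" "rev_dart (rev_dart d) = d"
    using is_dart_closed[OF d] rev_dart_rev_dart[OF d] by blast+
  then show ?thesis
    using winding_Rt[of k "(t - 1) mod N" i, folded r] by simp
qed

lemma winding_numbers_G:
  "winding_numbers (2 * n) G (circuit (2 * n) G i) w \<longleftrightarrow>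
     w (outer_face (2 * n) G) = 0 \<and>
     (\<forall>d. is_dart d \<longrightarrow> w (left_face (2 * n) G (J d)) - w (left_face (2 * n) G (J (rev_dart d))) =
        of_bool (on_circuit i d) - of_bool (on_circuit i (rev_dart d)))"
proof -
  have c: "int (count_list (circuit (2 * n) G i) (J d)) = of_bool (on_circuit i d)" if "is_dart d" for d
    using that by (simp add: count_list_distinct[OF distinct_circuit] J_in_circuit)
  define X where "X = (\<lambda>d. w (left_face (2 * n) G d) - w (left_face (2 * n) G (disk_opp (2 * n) G d)) =
      int (count_list (circuit (2 * n) G i) d) - int (count_list (circuit (2 * n) G i) (disk_opp (2 * n) G d)))"
  have X: "X (J d) \<longleftrightarrow> w (left_face (2 * n) G (J d)) - w (left_face (2 * n) G (J (rev_dart d))) =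
      of_bool (on_circuit i d) - of_bool (on_circuit i (rev_dart d))" if "is_dart d" for d
    unfolding X_def disk_opp_J[OF that] c[OF that] using c[of "rev_dart d"] is_dart_closed[OF that] by simp
  have "(\<forall>d\<in>disk_darts (2 * n) G. X d) \<longleftrightarrow> (\<forall>d. is_dart d \<longrightarrow> X (J d))"
    unfolding J_image[symmetric] by blast
  then show ?thesis
    unfolding winding_numbers_def X_def[symmetric] using X by simp
qed

lemma outer_face_G: "\<exists>t. 0 \<le> t \<and> t < N \<and> outer_face (2 * n) G = left_face (2 * n) G (J (Rt h t))"
proof -
  obtain t where "0 \<le> t" "t < N" "wrap (2 * n) (t - int h - 1) = 1"
    using wrap_shift_surj[of 1] N_pos' by auto
  then show ?thesis
    by (intro exI[of _ t]) (simp add: outer_face_def)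
qed

text \<open>\<open>face_wn\<close> is a solution of the winding equations. The difference of two
  solutions does not change across any edge, so by connectedness it is constant, and it vanishes on
  the outer face.\<close>

lemma winding_numbers_iff:
  assumes d: "is_dart d"
  shows "(\<exists>w. winding_numbers (2 * n) G (circuit (2 * n) G i) w \<and> w (left_face (2 * n) G (J d)) = 0) \<longleftrightarrow>
    face_wn i (left_idx d) = 0"
proof -
  obtain s where s: "0 \<le> s" "s < N" "outer_face (2 * n) G = left_face (2 * n) G (J (Rt h s))"
    using outer_face_G by blast
  have out: "is_dart (Rt h s)" "face_wn i (left_idx (Rt h s)) = 0"
    using s by (auto simp: face_wn_face)
  have uniq: "w (left_face (2 * n) G (J d)) = face_wn i (left_idx d)"
    if w: "winding_numbers (2 * n) G (circuit (2 * n) G i) w" and d: "is_dart d" for w d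
  proof -
    define D where "D = (\<lambda>d. w (left_face (2 * n) G (J d)) - face_wn i (left_idx d))"
    have rev_dart: "D (rev_dart d) = D d" if "is_dart d" for d
    proof -
      have "w (left_face (2 * n) G (J d)) - w (left_face (2 * n) G (J (rev_dart d))) =
          of_bool (on_circuit i d) - of_bool (on_circuit i (rev_dart d))"
        using w that unfolding winding_numbers_G by blast
      then show ?thesis
        using winding_dart[OF that, of i] unfolding D_def by linarith
    qed
    have "D (rot_dart d) = D d" if d: "is_dart d" for d
    proof -
      have r: "is_dart (rev_dart d)" "rev_dart (rev_dart d) = d" "is_dart (rot_dart d)"
        using d is_dart_closed rev_dart_rev_dart by auto
      have "left_idx (rot_dart d) = left_idx (rev_dart d)"
        using left_idx_step[OF r(1)] r(2) by simp
      moreover from this have "left_face (2 * n) G (J (rot_dart d)) = left_face (2 * n) G (J (rev_dart d))"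
        using left_face_eq_iff r by blast
      ultimately show ?thesis
        using rev_dart[OF d] by (simp add: D_def)
    qed
    then have step: "D y = D x" if "(x, y) \<in> adj" for x y
      using that rev_dart by (auto simp: adj_def)
    have "D y = D x" if "(x, y) \<in> adj\<^sup>*" for x y
      using that by induction (auto simp: step)
    from this[OF connected_darts[OF out(1) d]] have "D d = D (Rt h s)" .
    also have "D (Rt h s) = 0"
      using w out s(3) by (simp add: D_def winding_numbers_def)
    finally show ?thesis
      by (simp add: D_def)
  qed
  \<comment> \<open>Transfers \<open>face_wn\<close> from indices to faces by choosing a dart of
    each face.\<close>
  define w where "w = (\<lambda>f. face_wn i (left_idx (SOME e. is_dart e \<and> left_face (2 * n) G (J e) = f)))"
  have w: "w (left_face (2 * n) G (J e)) = face_wn i (left_idx e)" if "is_dart e" for e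
  proof -
    define e' where "e' = (SOME x. is_dart x \<and> left_face (2 * n) G (J x) = left_face (2 * n) G (J e))"
    have "is_dart e' \<and> left_face (2 * n) G (J e') = left_face (2 * n) G (J e)"
      unfolding e'_def by (rule someI[of _ e]) (use that in simp)
    then have "left_idx e' = left_idx e"
      using left_face_eq_iff that by blast
    then show ?thesis
      by (simp add: w_def e'_def)
  qed
  have "winding_numbers (2 * n) G (circuit (2 * n) G i) w"
    unfolding winding_numbers_G
  proof (intro conjI allI impI)
    show "w (outer_face (2 * n) G) = 0"
      unfolding s(3) w[OF out(1)] by (rule out(2))
  next
    fix d assume d: "is_dart d"
    have "is_dart (rev_dart d)"
      using is_dart_closed[OF d] by blast
    then show "w (left_face (2 * n) G (J d)) - w (left_face (2 * n) G (J (rev_dart d))) =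
        of_bool (on_circuit i d) - of_bool (on_circuit i (rev_dart d))"
      unfolding w[OF d] using w winding_dart[OF d] by simp
  qed
  with uniq[OF _ d] w[OF d] show ?thesis
    by metis
qed

lemma face_label_G:
  assumes "is_dart d" "left_idx d = (k, t)" "k \<le> h"
  shows "face_label (2 * n) G (left_face (2 * n) G (J d)) = lab k t"
  using assms unfolding face_label_def winding_numbers_iff[OF assms(1)]
  by (auto simp: lab_def face_wn_def)

lemma pi_diagram_G: "pi_diagram (n - 1) (2 * n) G"
proof -
  have "int i + int (n - 1) = int i + int n - 1" for i
    using n_eq by simp
  then show ?thesis
    unfolding pi_diagram_def using plabic_graph_G reduced_G by (simp add: strand_end_G add_diff_eq)
qed

end

section \<open>The seeds\<close>

lemma hom_list_minor:
  assumes "comm_ring_hom g"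
  shows "g (list_minor a xs) = list_minor (\<lambda>j i. g (a j i)) xs"
proof -
  interpret comm_ring_hom g by fact
  show ?thesis
    unfolding list_minor_def hom_det[symmetric]
    by (intro arg_cong[of _ _ det] eq_matI) auto
qed

lemma hom_col_minor:
  assumes "comm_ring_hom g"
  shows "g (col_minor a K) = col_minor (\<lambda>j i. g (a j i)) K"
  unfolding col_minor_def by (rule hom_list_minor[OF assms])

text \<open>Only the first \<open>card K\<close> rows enter the minor, which leaves the rows below
  free for further variables.\<close>

lemma col_minor_rows_cong:
  assumes "\<And>j i. j \<in> K \<Longrightarrow> i < card K \<Longrightarrow> a j i = b j i" "finite K"
  shows "col_minor a K = col_minor b K"
  unfolding col_minor_def list_minor_def
proof (intro arg_cong[of _ _ det] eq_matI)
  fix i j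
  assume "i < dim_row (mat (length (sorted_list_of_set K)) (length (sorted_list_of_set K)) (\<lambda>(i, j). b (sorted_list_of_set K ! j) i))"
    "j < dim_col (mat (length (sorted_list_of_set K)) (length (sorted_list_of_set K)) (\<lambda>(i, j). b (sorted_list_of_set K ! j) i))"
  then have ij: "i < card K" "j < card K"
    by simp_all
  then have "sorted_list_of_set K ! j \<in> K"
    using nth_mem[of j "sorted_list_of_set K"] assms(2) by simp
  with ij assms(1) show "mat (length (sorted_list_of_set K)) (length (sorted_list_of_set K)) (\<lambda>(i, j). a (sorted_list_of_set K ! j) i) $$ (i, j) =
      mat (length (sorted_list_of_set K)) (length (sorted_list_of_set K)) (\<lambda>(i, j). b (sorted_list_of_set K ! j) i) $$ (i, j)"
    by simp
qed simp_all

section \<open>Pluecker coordinates as polynomials\<close>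

definition plucker_poly :: "nat set \<Rightarrow> (nat \<times> nat \<Rightarrow>\<^sub>0 nat) \<Rightarrow>\<^sub>0 complex" where
  "plucker_poly K = col_minor (\<lambda>j i. Poly_Mapping.single (Poly_Mapping.single (i, j) 1) 1) K"

lemma plucker_eq_Fract:
  assumes "card K = k"
  shows "plucker k K = Fract (plucker_poly K) 1"
proof -
  have "plucker k K = col_minor (\<lambda>j i. indet (i, j)) K"
    using assms by (simp add: plucker_def col_minor_def list_minor_def)
  also have "\<dots> = Fract (plucker_poly K) 1"
    unfolding plucker_poly_def hom_col_minor[OF comm_ring_hom_to_fract] by (simp add: indet_def)
  finally show ?thesis .
qed

lemma poly_eval_plucker_poly: "poly_eval (\<lambda>x. x) a (plucker_poly K) = col_minor (\<lambda>j i. a (i, j)) K"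
  unfolding plucker_poly_def hom_col_minor[OF comm_ring_hom_poly_eval[OF comm_ring_hom_ident]]
  by (simp add: poly_eval_var[OF comm_ring_hom_ident, simplified])

lemma Fract_1_inject: "Fract a 1 = Fract b 1 \<longleftrightarrow> a = (b :: 'a::idom)"
  by (simp add: eq_fract)

lemma indet_inject: "indet v = indet w \<longleftrightarrow> v = w"
proof
  assume "indet v = indet w"
  then have "Poly_Mapping.single (Poly_Mapping.single v (1::nat)) (1::complex) = Poly_Mapping.single (Poly_Mapping.single w 1) 1"
    unfolding indet_def Fract_1_inject .
  then have "Poly_Mapping.keys (Poly_Mapping.single (Poly_Mapping.single v (1::nat)) (1::complex)) =
      Poly_Mapping.keys (Poly_Mapping.single (Poly_Mapping.single w (1::nat)) (1::complex))"
    by (rule arg_cong)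
  then have "Poly_Mapping.single v (1::nat) = Poly_Mapping.single w 1"
    by simp
  then have "Poly_Mapping.keys (Poly_Mapping.single v (1::nat)) = Poly_Mapping.keys (Poly_Mapping.single w (1::nat))"
    by (rule arg_cong)
  then show "v = w"
    by simp
qed simp

text \<open>At the matrix that is the identity on the columns of \<open>K\<close> and zero
  elsewhere, the minor of \<open>K\<close> is 1, while \<open>L\<close> has a zero column.\<close>

lemma plucker_inject:
  assumes "card K = k" "card L = k" "finite K" "finite L" "plucker k K = plucker k L"
  shows "K = L"
proof (rule ccontr)
  assume "K \<noteq> L"
  then have "\<not> L \<subseteq> K"
    using assms(1-3) by (metis card_subset_eq)
  then obtain l where l: "l \<in> L" "l \<notin> K"
    by blast
  define xs where "xs = sorted_list_of_set K"
  define a where "a = (\<lambda>(i, j). if j \<in> K \<and> xs ! i = j then 1 else (0::complex))"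
  have "plucker_poly K = plucker_poly L"
    using assms by (simp add: plucker_eq_Fract Fract_1_inject)
  then have eq: "col_minor (\<lambda>j i. a (i, j)) K = col_minor (\<lambda>j i. a (i, j)) L"
    by (metis poly_eval_plucker_poly)
  have xs: "distinct xs" "set xs = K" "length xs = k"
    using assms by (auto simp: xs_def)
  have "col_minor (\<lambda>j i. a (i, j)) K = det (1\<^sub>m k)"
    unfolding col_minor_def list_minor_def xs_def[symmetric] xs(3)
    by (intro arg_cong[of _ _ det] eq_matI) (use xs in \<open>auto simp: a_def nth_eq_iff_index_eq\<close>)
  moreover have "col_minor (\<lambda>j i. a (i, j)) L = 0"
  proof -
    let ?f = "\<lambda>j i. a (i, j)"
    \<comment> \<open>The zero column is an empty linear combination, so linearity in this column
      makes the minor vanish.\<close>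
    have "?f = ?f(l := \<lambda>i. \<Sum>y\<in>({} :: nat set). (\<lambda>_. 0) y * (\<lambda>_ _. 0) y i)"
      using l(2) by (auto simp: a_def fun_eq_iff)
    then have "col_minor ?f L = col_minor (?f(l := \<lambda>i. \<Sum>y\<in>({} :: nat set). (\<lambda>_. 0) y * (\<lambda>_ _. 0) y i)) L"
      by (rule arg_cong)
    also have "\<dots> = (\<Sum>y\<in>({} :: nat set). (\<lambda>_. 0) y * col_minor (?f(l := (\<lambda>_ _. 0) y)) L)"
      by (rule col_minor_linear[OF assms(4) l(1)])
    finally show ?thesis by simp
  qed
  ultimately show False
    using eq by simp
qed

context annulus
begin

text \<open>Variables of pairs outside \<open>D_dagger n\<close> are sent to entries below the generic matrix, so that
  the map is injective on all polynomials.\<close>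

definition var_poly :: "cpair \<Rightarrow> (nat \<times> nat \<Rightarrow>\<^sub>0 nat) \<Rightarrow>\<^sub>0 complex" where
  "var_poly p = (if p \<in> D_dagger n then plucker_poly (I_set n p)
     else Poly_Mapping.single (Poly_Mapping.single (n - 1 + to_nat p, 0) 1) 1)"

lemma var_poly_inj: "inj (poly_eval (Poly_Mapping.single 0) var_poly)"
proof (rule inj_poly_eval_if_torus_surj)
  fix c :: "cpair \<Rightarrow> complex"
  assume c: "\<And>p. c p \<noteq> 0"
  have nz: "(case p of (k, t) \<Rightarrow> c (pair k t)) \<noteq> 0" for p :: "nat \<times> int"
    unfolding case_prod_beta by (rule c)
  obtain A where A: "\<forall>k\<in>{1..h}. \<forall>t\<in>{0..<N}. col_minor A (lab k t) = c (pair k t)"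
    using prescribed_label_minors[of "\<lambda>(k, t). c (pair k t)", OF nz] unfolding prod.case by (rule exE)
  \<comment> \<open>The rows of the generic matrix carry \<open>A\<close>; the rows below carry the
    values for pairs outside \<open>D_dagger n\<close>, one row per pair.\<close>
  define a where "a = (\<lambda>(i, j). if i < n - 1 then A j i else c (from_nat (i - (n - 1))))"
  have "poly_eval (\<lambda>x. x) a (var_poly p) = c p" for p
  proof (cases "p \<in> D_dagger n")
    case True
    then obtain k t where k: "1 \<le> k" "k \<le> h" and p: "p = pair k t"
      unfolding D_dagger_eq by blast
    have "poly_eval (\<lambda>x. x) a (var_poly p) = col_minor (\<lambda>j i. a (i, j)) (lab k t)"
      using True I_set_pair[OF k] by (simp add: var_poly_def poly_eval_plucker_poly p)
    also have "\<dots> = col_minor A (lab k t)"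
      by (rule col_minor_rows_cong) (auto simp: card_lab k a_def)
    also have "\<dots> = c p"
      using A[rule_format, of k "t mod N"] k N_pos by (simp add: lab_mod pair_mod p)
    finally show ?thesis .
  next
    case False
    then show ?thesis
      by (simp add: var_poly_def poly_eval_var[OF comm_ring_hom_ident, simplified] a_def)
  qed
  then show "\<exists>a. \<forall>v. poly_eval (\<lambda>x. x) a (var_poly v) = c v"
    by blast
qed

definition \<psi> :: "cpair ratfun \<Rightarrow> (nat \<times> nat) ratfun" where
  "\<psi> = fract_map (poly_eval (Poly_Mapping.single 0) var_poly)"

lemma hom_var_poly: "comm_ring_hom (poly_eval (Poly_Mapping.single 0) var_poly)"
  by (rule comm_ring_hom_poly_eval[OF comm_ring_hom_const])

lemma hom_\<psi>: "comm_ring_hom \<psi>"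
  unfolding \<psi>_def by (rule comm_ring_hom_fract_map[OF hom_var_poly var_poly_inj])

lemma \<psi>_Fract_1: "\<psi> (Fract P 1) = Fract (poly_eval (Poly_Mapping.single 0) var_poly P) 1"
proof -
  interpret comm_ring_hom "poly_eval (Poly_Mapping.single 0) var_poly"
    by (rule hom_var_poly)
  show ?thesis
    unfolding \<psi>_def by (subst fract_map_Fract[OF hom_var_poly var_poly_inj]) simp_all
qed

lemma \<psi>_scalar: "\<psi> (scalar c) = scalar c"
  unfolding scalar_def \<psi>_Fract_1 poly_eval_single[OF comm_ring_hom_const] by (simp add: monom_eval_def)

lemma card_I_set: "p \<in> D_dagger n \<Longrightarrow> card (I_set n p) = n - 1"
  unfolding D_dagger_eq using I_set_pair card_lab by auto

lemma \<psi>_indet: "p \<in> D_dagger n \<Longrightarrow> \<psi> (indet p) = plucker (n - 1) (I_set n p)"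
  unfolding indet_def \<psi>_Fract_1 poly_eval_var[OF comm_ring_hom_const]
  by (simp add: plucker_eq_Fract card_I_set var_poly_def)

lemma inj_\<psi>: "inj \<psi>"
  by (rule inj_field_hom[OF hom_\<psi>])

text \<open>Equal sets would give equal Pluecker coordinates, although the injective map
  \<open>\<psi>\<close> keeps the \<open>y\<close> variables apart.\<close>

lemma I_set_inj: "inj_on (I_set n) (D_dagger n)"
proof (rule inj_onI)
  fix p q assume "p \<in> D_dagger n" "q \<in> D_dagger n" "I_set n p = I_set n q"
  then have "\<psi> (indet p) = \<psi> (indet q)"
    by (simp add: \<psi>_indet)
  then show "p = q"
    using inj_\<psi> indet_inject by (metis injD)
qed

lemma lab_eq_iff:
  assumes "1 \<le> k" "k \<le> h" "1 \<le> k'" "k' \<le> h"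
  shows "lab k t = lab k' t' \<longleftrightarrow> k = k' \<and> t mod N = t' mod N"
proof -
  have "pair k t \<in> D_dagger n" "pair k' t' \<in> D_dagger n"
    using assms unfolding D_dagger_eq by blast+
  then have "lab k t = lab k' t' \<longleftrightarrow> pair k t = pair k' t'"
    using I_set_inj assms by (metis I_set_pair inj_onD)
  then show ?thesis
    using pair_eq_iff[OF assms(1)] by simp
qed

lemma odd_in_lab: "1 \<le> k \<Longrightarrow> k \<le> h \<Longrightarrow> \<exists>i\<in>lab k t. odd i"
  using wrap_in_lab[of "new_elt k t" k t] new_elt_in_lab[of k t] even_wrap[of "new_elt k t"] odd_new_elt[of k t]
  by auto

lemma even_lab_0: "i \<in> lab 0 t \<Longrightarrow> even i"
  by (auto simp: lab_0)

lemma lab_neq_lab_0: "1 \<le> k \<Longrightarrow> k \<le> h \<Longrightarrow> lab k t \<noteq> lab 0 t'"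
  using odd_in_lab[of k t] even_lab_0 by blast

definition even_sets :: "nat set set" where
  "even_sets = {I. I \<subseteq> {i \<in> {1..2 * n}. even i} \<and> card I = n - 1}"

lemma even_sets_eq: "even_sets = range (lab 0)"
proof
  show "range (lab 0) \<subseteq> even_sets"
    using card_lab[of 0] by (auto simp: even_sets_def lab_0)
  show "even_sets \<subseteq> range (lab 0)"
  proof
    fix I assume I: "I \<in> even_sets"
    let ?E = "(\<lambda>x. 2 * x) ` {1..n}"
    have E: "{i \<in> {1..2 * n}. even i} = ?E"
      by (auto elim!: evenE)
    have "card ?E = n"
      by (simp add: card_image inj_on_def)
    moreover have sub: "I \<subseteq> ?E"
      using I unfolding even_sets_def E by simp
    ultimately have "card (?E - I) = 1"
      using I n_pos by (simp add: card_Diff_subset finite_subset even_sets_def)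
    then obtain y where "?E - I = {y}"
      by (auto simp: card_1_singleton_iff)
    moreover from this obtain c where c: "c \<in> {1..n}" "y = 2 * c"
      by blast
    ultimately have "I = ?E - {2 * c}"
      using sub by blast
    then have "I = (\<lambda>x. 2 * x) ` ({1..n} - {c})"
      by auto
    moreover have "missing_even (2 * int c) = c"
    proof -
      have "wrap (2 * n) (int (2 * c)) = 2 * c"
        by (rule wrap_of_range) (use c in auto)
      then show ?thesis
        by (simp add: missing_even_def)
    qed
    ultimately show "I \<in> range (lab 0)"
      using lab_0[of "2 * int c"] by auto
  qed
qed

lemma card_even_sets: "card even_sets = n"
proof -
  have "even_sets = {I. I \<subseteq> (\<lambda>x. 2 * x) ` {1..n} \<and> card I = n - 1}"
    unfolding even_sets_def by (intro arg_cong[of _ _ Collect] ext conj_cong refl) (auto elim!: evenE)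
  also have "card \<dots> = card ((\<lambda>x. 2 * x) ` {1..n}) choose (n - 1)"
    by (rule n_subsets) simp
  also have "card ((\<lambda>x. 2 * x) ` {1..n}) = n"
    by (simp add: card_image inj_on_def)
  also have "n choose (n - 1) = n"
    using n_pos by (metis binomial_Suc_n diff_Suc_1 gr0_implies_Suc)
  finally show ?thesis .
qed

lemma plucker_inj_labels: "inj_on (plucker (n - 1)) {K. finite K \<and> card K = n - 1}"
  by (rule inj_onI) (use plucker_inject in auto)

section \<open>The seed of the plabic graph\<close>

abbreviation S where "S \<equiv> plabic_seed (n - 1) (2 * n) G"

lemma face_label_J: "d \<in> graph_darts \<Longrightarrow> face_label (2 * n) G (left_face (2 * n) G (J d)) = lab (fst (left_idx d)) (snd (left_idx d))"
proof -
  assume d: "d \<in> graph_darts"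
  then have "fst (left_idx d) \<le> h" "is_dart d"
    using h_pos by (cases d; auto simp: graph_darts_def face_def)+
  then show ?thesis
    using face_label_G[of d "fst (left_idx d)" "snd (left_idx d)"] by simp
qed

lemma boundary_labels: "face_label (2 * n) G ` boundary_faces (2 * n) G = range (lab h)"
proof -
  have eq: "face_label (2 * n) G (left_face (2 * n) G (J (Lt h t))) = lab h (t - 1)" if "0 \<le> t" "t < N" for t
    using that face_label_G[of "Lt h t" h "(t - 1) mod N"] h_pos by (simp add: face_def lab_mod)
  have "CCW ` {1..2 * n} = J ` Lt h ` {0..<N}"
  proof
    show "CCW ` {1..2 * n} \<subseteq> J ` Lt h ` {0..<N}"
    proof
      fix x assume "x \<in> CCW ` {1..2 * n}"
      then obtain i where i: "i \<in> {1..2 * n}" "x = CCW i"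
        by blast
      then obtain t where "0 \<le> t" "t < N" "wrap (2 * n) (t - int h - 1) = i"
        using wrap_shift_surj by blast
      then show "x \<in> J ` Lt h ` {0..<N}"
        using i by (intro image_eqI[of _ _ "Lt h t"]) auto
    qed
    show "J ` Lt h ` {0..<N} \<subseteq> CCW ` {1..2 * n}"
      using wrap_range[OF N_pos'] by auto
  qed
  then have "face_label (2 * n) G ` boundary_faces (2 * n) G =
      (\<lambda>t. face_label (2 * n) G (left_face (2 * n) G (J (Lt h t)))) ` {0..<N}"
    unfolding boundary_faces_def by (simp only: image_image)
  also have "\<dots> = (\<lambda>t. lab h (t - 1)) ` {0..<N}"
    by (rule image_cong[OF refl]) (use eq in simp)
  also have "\<dots> = range (lab h)"
  proof -
    have "lab h t \<in> (\<lambda>t. lab h (t - 1)) ` {0..<N}" for t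
    proof (rule image_eqI)
      show "lab h t = lab h ((t + 1) mod N - 1)"
        using lab_mod[of h "(t + 1) mod N - 1"] lab_mod[of h t] by (simp add: mod_diff_left_eq)
    qed simp
    then show ?thesis by blast
  qed
  finally show ?thesis .
qed

lemma left_idx_Lt_h: "0 \<le> t \<Longrightarrow> t < N \<Longrightarrow> left_idx (Lt h t) = (h, (t - 1) mod N)"
  using h_pos by (simp add: face_def)

text \<open>A face index with ring \<open>h\<close> is a boundary face and ring \<open>Suc h\<close>
  is the outer face, so rings \<open>0\<close> to \<open>h - 1\<close> remain. In ring 0 the angle
  has to be made even to name a face.\<close>

lemma mutable_labels:
  "face_label (2 * n) G ` (faces (2 * n) G - boundary_faces (2 * n) G) = {lab k t |k t. k < h}"
proof
  obtain s where s: "0 \<le> s" "s < N" "outer_face (2 * n) G = left_face (2 * n) G (J (Rt h s))"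
    using outer_face_G by blast
  have lfs: "left_idx (Rt h s) = (Suc h, 0)" "is_dart (Rt h s)"
    using s by (auto simp: face_def)
  have bf: "left_face (2 * n) G (J d) \<in> boundary_faces (2 * n) G \<longleftrightarrow> fst (left_idx d) = h" if d: "is_dart d" for d
  proof
    assume "left_face (2 * n) G (J d) \<in> boundary_faces (2 * n) G"
    then obtain i where i: "i \<in> {1..2 * n}" "left_face (2 * n) G (J d) = left_face (2 * n) G (CCW i)"
      by (auto simp: boundary_faces_def)
    obtain t where t: "0 \<le> t" "t < N" "wrap (2 * n) (t - int h - 1) = i"
      using wrap_shift_surj[OF i(1)] by blast
    then have "left_idx d = left_idx (Lt h t)"
      using left_face_eq_iff[OF d, of "Lt h t"] i by simp
    then show "fst (left_idx d) = h"
      using left_idx_Lt_h t by simp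
  next
    assume h: "fst (left_idx d) = h"
    define t where "t = (snd (left_idx d) + 1) mod N"
    have "0 \<le> snd (left_idx d) \<and> snd (left_idx d) < N"
      using left_idx_fiber[OF d, of h "snd (left_idx d)"] h h_pos by (metis order_refl prod.collapse)
    then have "left_idx (Lt h t) = left_idx d"
      using h left_idx_Lt_h[of t] mod_succ_pred(2)[of "snd (left_idx d)"] by (simp add: t_def prod_eq_iff)
    then have "left_face (2 * n) G (J d) = left_face (2 * n) G (J (Lt h t))"
      using left_face_eq_iff[OF d, of "Lt h t"] by (simp add: t_def)
    then show "left_face (2 * n) G (J d) \<in> boundary_faces (2 * n) G"
      using wrap_range[OF N_pos'] by (auto simp: boundary_faces_def)
  qed
  have of: "left_face (2 * n) G (J d) = outer_face (2 * n) G \<longleftrightarrow> fst (left_idx d) = Suc h" if d: "is_dart d" for d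
    using left_face_eq_iff[OF d lfs(2)] lfs(1) left_idx_image d unfolding s(3) by (auto simp: prod_eq_iff)
  show "face_label (2 * n) G ` (faces (2 * n) G - boundary_faces (2 * n) G) \<subseteq> {lab k t |k t. k < h}"
  proof
    fix K assume "K \<in> face_label (2 * n) G ` (faces (2 * n) G - boundary_faces (2 * n) G)"
    then obtain f where f: "K = face_label (2 * n) G f" "f \<in> faces (2 * n) G" "f \<notin> boundary_faces (2 * n) G"
      by blast
    then obtain d where d: "is_dart d" "f = left_face (2 * n) G (J d)" "f \<noteq> outer_face (2 * n) G"
      unfolding faces_def J_image[symmetric] by blast
    have "fst (left_idx d) \<noteq> h" "fst (left_idx d) \<noteq> Suc h"
      using bf[OF d(1)] of[OF d(1)] d(2,3) f(3) by auto
    moreover have "left_idx d \<in> left_idx ` Collect is_dart"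
      using d(1) by blast
    ultimately have "fst (left_idx d) < h"
      unfolding left_idx_image by auto
    moreover have "K = lab (fst (left_idx d)) (snd (left_idx d))"
      using face_label_G[OF d(1), of "fst (left_idx d)" "snd (left_idx d)"] f(1) d(2) \<open>fst (left_idx d) < h\<close> by simp
    ultimately show "K \<in> {lab k t |k t. k < h}"
      by blast
  qed
  show "{lab k t |k t. k < h} \<subseteq> face_label (2 * n) G ` (faces (2 * n) G - boundary_faces (2 * n) G)"
  proof
    fix K assume "K \<in> {lab k t |k t. k < h}"
    then obtain k t where k: "k < h" and K: "K = lab k t"
      by blast
    have "\<exists>t'. (k, t') \<in> left_idx ` Collect is_dart \<and> lab k t' = K"
    proof (cases "k = 0")
      case True
      define t' where "t' = (if even t then t else t + 1)"
      have "lab 0 t' = lab 0 t"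
        unfolding t'_def by (auto simp: lab_def in_lab_0_shift)
      then have "lab k (t' mod N) = K"
        using True K by (simp add: lab_mod)
      moreover have "even t'"
        by (simp add: t'_def)
      then have "(k, t' mod N) \<in> left_idx ` Collect is_dart"
        unfolding left_idx_image using True by (auto simp: parity_mod)
      ultimately show ?thesis by blast
    next
      case False
      then have "(k, t mod N) \<in> left_idx ` Collect is_dart"
        unfolding left_idx_image using k by auto
      then show ?thesis
        using K by (auto simp: lab_mod)
    qed
    then obtain t' where t': "(k, t') \<in> left_idx ` Collect is_dart" "lab k t' = K"
      by blast
    from t'(1) obtain d where "d \<in> Collect is_dart" "(k, t') = left_idx d"
      by (rule imageE)
    then have d: "is_dart d" "left_idx d = (k, t')" "lab k t' = K"
      using t'(2) by simp_all
    have "left_face (2 * n) G (J d) \<in> faces (2 * n) G - boundary_faces (2 * n) G"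
      using bf[OF d(1)] of[OF d(1)] d k unfolding faces_def J_image[symmetric] by auto
    moreover have "face_label (2 * n) G (left_face (2 * n) G (J d)) = K"
      using face_label_G[OF d(1,2)] k d(3) by simp
    ultimately show "K \<in> face_label (2 * n) G ` (faces (2 * n) G - boundary_faces (2 * n) G)"
      by blast
  qed
qed

lemma S_sel: "mutable S = {lab k t |k t. k < h}" "frozen S = range (lab h)" "var S = plucker (n - 1)"
  by (simp_all add: plabic_seed_def Let_def mutable_labels boundary_labels)


text \<open>The arrows as counted from black ends: faces with \<open>k + t\<close> even send them
  along their ring, the others along the ray. The restriction \<open>k < h\<close> reflects that no
  boundary dart is black and no graph edge leads beyond ring \<open>h\<close>.\<close>

definition arrow :: "nat \<Rightarrow> int \<Rightarrow> nat \<Rightarrow> int \<Rightarrow> bool" where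
  "arrow k t k' t' \<longleftrightarrow>
     even (int k + t) \<and> k' = k \<and> (t' = (t + 1) mod N \<or> k < h \<and> t' = (t - 1) mod N) \<or>
     odd (int k + t) \<and> t' = t \<and> (k = Suc k' \<or> k < h \<and> k' = Suc k)"

text \<open>Of the four darts with the given face on the left, parity makes either the radial or the
  circular ones black. Since \<open>t + 1\<close> and \<open>t - 1\<close> differ modulo
  \<open>N\<close>, the second face singles out one dart.\<close>

lemma arrow_darts:
  assumes k: "1 \<le> k" "k \<le> h" "1 \<le> k'" and t: "0 \<le> t" "t < N" "0 \<le> t'" "t' < N"
  shows "d \<in> graph_darts \<and> is_black d \<and> left_idx d = (k, t) \<and> left_idx (rev_dart d) = (k', t') \<longleftrightarrow>
    arrow k t k' t' \<and> d = (if even (int k + t) then if t' = (t + 1) mod N then Up k ((t + 1) mod N) else Dn k t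
      else if k = Suc k' then Rt (k - 1) t else Lt k ((t + 1) mod N))"
    (is "?L d \<longleftrightarrow> ?R d")
proof -
  obtain j where j: "k = Suc j"
    using k by (cases k) auto
  have ne: "(t + 1) mod N \<noteq> (t - 1) mod N"
    using mod_simps_N(1,2)[OF t(1,2)] t int_n h_pos by auto
  have par: "even ((t + 1) mod N) \<longleftrightarrow> odd t"
    by (simp add: parity_mod)
  have e1: "?L (Up k ((t + 1) mod N)) \<longleftrightarrow> even (int k + t) \<and> k' = k \<and> t' = (t + 1) mod N"
    using k t par by (auto simp: graph_darts_def j face_def mod_succ_pred)
  have e2: "?L (Dn k t) \<longleftrightarrow> k < h \<and> even (int k + t) \<and> k' = k \<and> t' = (t - 1) mod N"
    using k t by (auto simp: graph_darts_def j face_def)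
  have e3: "?L (Rt (k - 1) t) \<longleftrightarrow> odd (int k + t) \<and> k = Suc k' \<and> t' = t"
    using k t by (auto simp: graph_darts_def j face_def mod_succ_pred)
  have e4: "?L (Lt k ((t + 1) mod N)) \<longleftrightarrow> k < h \<and> odd (int k + t) \<and> k' = Suc k \<and> t' = t"
    using k t par by (auto simp: graph_darts_def face_def mod_succ_pred)
  have mem: "d \<in> {Up k ((t + 1) mod N), Lt k ((t + 1) mod N), Dn k t, Rt (k - 1) t}" if "?L d"
    using left_idx_fiber[of d k t] that k by (auto simp: graph_darts_def)
  show ?thesis
  proof
    assume L: "?L d"
    from mem[OF L] consider "d = Up k ((t + 1) mod N)" | "d = Dn k t" | "d = Rt (k - 1) t" | "d = Lt k ((t + 1) mod N)"
      by blast
    then show "?R d"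
    proof cases
      case 1
      with L e1 show ?thesis by (simp add: arrow_def)
    next
      case 2
      with L e2 ne show ?thesis by (simp add: arrow_def)
    next
      case 3
      with L e3 show ?thesis by (simp add: arrow_def)
    next
      case 4
      with L e4 show ?thesis by (simp add: arrow_def)
    qed
  next
    assume R: "?R d"
    then have arrow: "arrow k t k' t'"
      and d: "d = (if even (int k + t) then if t' = (t + 1) mod N then Up k ((t + 1) mod N) else Dn k t
        else if k = Suc k' then Rt (k - 1) t else Lt k ((t + 1) mod N))"
      by blast+
    show "?L d"
    proof (cases "even (int k + t)")
      case ev: True
      then have *: "k' = k" "t' = (t + 1) mod N \<or> k < h \<and> t' = (t - 1) mod N"
        using arrow by (simp_all add: arrow_def)
      show ?thesis
      proof (cases "t' = (t + 1) mod N")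
        case True
        with d ev have "d = Up k ((t + 1) mod N)" by simp
        then show ?thesis using ev *(1) True e1 by blast
      next
        case False
        with d ev have "d = Dn k t" by simp
        then show ?thesis using ev * False e2 by blast
      qed
    next
      case odd: False
      then have *: "t' = t" "k = Suc k' \<or> k < h \<and> k' = Suc k"
        using arrow by (simp_all add: arrow_def)
      show ?thesis
      proof (cases "k = Suc k'")
        case True
        with d odd have "d = Rt (k - 1) t" by simp
        then show ?thesis using odd *(1) True e3 by blast
      next
        case False
        with d odd have "d = Lt k ((t + 1) mod N)" by simp
        then show ?thesis using odd * False e4 by blast
      qed
    qed
  qed
qed

lemma left_idx_graph: "d \<in> graph_darts \<Longrightarrow> fst (left_idx d) \<le> h \<and> 0 \<le> snd (left_idx d) \<and> snd (left_idx d) < N"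
proof -
  assume d: "d \<in> graph_darts"
  then have "fst (left_idx d) \<le> h" "is_dart d"
    using h_pos by (cases d; auto simp: graph_darts_def face_def)+
  moreover from this have "left_idx d \<in> {0} \<times> {t \<in> {0..<N}. even t} \<union> {1..h} \<times> {0..<N} \<union> {(Suc h, 0)}"
    unfolding left_idx_image[symmetric] by blast
  ultimately show ?thesis
    by (cases "left_idx d") auto
qed

lemma lab_left_idx_iff:
  assumes "d \<in> graph_darts" "1 \<le> k" "k \<le> h" "0 \<le> t" "t < N"
  shows "lab (fst (left_idx d)) (snd (left_idx d)) = lab k t \<longleftrightarrow> left_idx d = (k, t)"
proof (cases "fst (left_idx d) = 0")
  case True
  then have "lab (fst (left_idx d)) (snd (left_idx d)) \<noteq> lab k t"
    using lab_neq_lab_0[OF assms(2,3), of t "snd (left_idx d)"] by simp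
  moreover have "left_idx d \<noteq> (k, t)"
    using True assms(2) by auto
  ultimately show ?thesis
    by blast
next
  case False
  then show ?thesis
    using lab_eq_iff[of "fst (left_idx d)" k "snd (left_idx d)" t] left_idx_graph[OF assms(1)] assms(2-) by (auto simp: prod_eq_iff)
qed

lemma plabic_arrows_G:
  assumes k: "1 \<le> k" "k \<le> h" "1 \<le> k'" "k' \<le> h" and t: "0 \<le> t" "t < N" "0 \<le> t'" "t' < N"
  shows "plabic_arrows (2 * n) G (lab k t) (lab k' t') = of_bool (arrow k t k' t')"
proof -
  let ?Y = "{d. d \<in> graph_darts \<and> is_black d \<and> left_idx d = (k, t) \<and> left_idx (rev_dart d) = (k', t')}"
  have lbl: "face_label (2 * n) G (left_face (2 * n) G (Edge (to_nat d))) = lab j s \<longleftrightarrow> left_idx d = (j, s)"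
    if "d \<in> graph_darts" "1 \<le> j" "j \<le> h" "0 \<le> s" "s < N" for d j s
    using face_label_J[OF that(1)] lab_left_idx_iff[OF that] by (simp add: J_graph[OF that(1)])
  have "x \<in> black G \<and> face_label (2 * n) G (left_face (2 * n) G (Edge x)) = lab k t \<and>
      face_label (2 * n) G (left_face (2 * n) G (Edge (opp G x))) = lab k' t' \<longleftrightarrow> x \<in> to_nat ` ?Y" for x
  proof (cases "x \<in> black G")
    case True
    then obtain d where d: "d \<in> graph_darts" "is_black d" "x = to_nat d"
      by auto
    show ?thesis
      using True d lbl[OF d(1) k(1,2) t(1,2)] lbl[OF graph_closed(1)[OF d(1)] k(3,4) t(3,4)]
      by (auto simp: ext_to_nat)
  qed auto
  then have "plabic_arrows (2 * n) G (lab k t) (lab k' t') = card (to_nat ` ?Y)"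
    unfolding plabic_arrows_def by (intro arg_cong[of _ _ card]) blast
  also have "\<dots> = card ?Y"
    by (rule card_image) (rule inj_on_subset[OF inj_to_nat subset_UNIV])
  also have "\<dots> = of_bool (arrow k t k' t')"
    unfolding arrow_darts[OF k(1-3) t] by (cases "arrow k t k' t'") auto
  finally show ?thesis .
qed

lemma pair_in_neighbours:
  assumes k: "1 \<le> k" "1 \<le> k'" and t: "0 \<le> t" "t < N" "0 \<le> t'" "t' < N"
  shows "pair k' t' \<in> neighbours k t \<longleftrightarrow>
    k' = k \<and> (t' = (t - 1) mod N \<or> t' = (t + 1) mod N) \<or> t' = t \<and> (k' = Suc k \<or> k = Suc k')"
  using k t unfolding neighbours_def by (auto simp: pair_eq_iff)

lemma mod_pred_iff: "0 \<le> t \<Longrightarrow> t < N \<Longrightarrow> 0 \<le> t' \<Longrightarrow> t' < N \<Longrightarrow> t' = (t - 1) mod N \<longleftrightarrow> t = (t' + 1) mod N"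
  using mod_succ_pred by metis

lemma neighbours_cong:
  assumes "t mod N = s mod N"
  shows "neighbours k t = neighbours k s"
proof -
  have p: "pair j x = pair j y" if "x mod N = y mod N" for j x y
    using that by (metis pair_mod)
  have "(t - 1) mod N = (s - 1) mod N" "(t + 1) mod N = (s + 1) mod N"
    using assms by (auto intro: mod_diff_cong mod_add_cong)
  then show ?thesis
    unfolding neighbours_def using p assms by metis
qed

text \<open>Away from pairs of frozen vertices both sides are supported on adjacent cells of the
  grid, and the parity of \<open>k + t\<close> fixes the direction in the same way: out along the
  ring and in along the ray for even parity, reversed for odd.\<close>

lemma arrows_match:
  assumes k: "1 \<le> k" "k \<le> h" "1 \<le> k'" "k' \<le> h" and t: "0 \<le> t" "t < N" "0 \<le> t'" "t' < N"
  shows "arrows S (lab k t) (lab k' t') = cm_B (pair k t) (pair k' t')"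
proof -
  have fr: "lab j s \<in> range (lab h) \<longleftrightarrow> j = h" if "1 \<le> j" "j \<le> h" for j s
    using lab_eq_iff[OF that, of h s] h_pos by auto
  have a: "arrows S (lab k t) (lab k' t') = (if k = h \<and> k' = h then 0
      else of_bool (arrow k t k' t') - of_bool (arrow k' t' k t))"
    using fr[OF k(1,2)] fr[OF k(3,4)] plabic_arrows_G[OF k t] plabic_arrows_G[OF k(3,4,1,2) t(3,4,1,2)]
    by (simp add: plabic_seed_def Let_def boundary_labels)
  define ring where "ring \<longleftrightarrow> k' = k \<and> (t' = (t - 1) mod N \<or> t' = (t + 1) mod N)"
  define radial where "radial \<longleftrightarrow> t' = t \<and> (k' = Suc k \<or> k = Suc k')"
  have nb: "pair k' t' \<in> neighbours k t \<longleftrightarrow> ring \<or> radial" "pair k t \<in> neighbours k' t' \<longleftrightarrow> ring \<or> radial"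
    unfolding pair_in_neighbours[OF k(1,3) t] pair_in_neighbours[OF k(3,1) t(3,4,1,2)] ring_def radial_def
    using mod_pred_iff[OF t] mod_pred_iff[OF t(3,4,1,2)] by auto
  have edge: "cm_edge n (pair k t) (pair k' t') \<longleftrightarrow> \<not> (k = h \<and> k' = h) \<and> (ring \<or> radial)"
  proof
    assume "cm_edge n (pair k t) (pair k' t')"
    then show "\<not> (k = h \<and> k' = h) \<and> (ring \<or> radial)"
    proof (cases rule: cm_edge_cases)
      case (1 j s)
      then have j: "k = j" "t mod N = s mod N"
        using pair_eq_iff[OF k(1)] by auto
      then have "pair k' t' \<in> neighbours k t"
        unfolding neighbours_cong[OF j(2)] unfolding j(1) by (intro 1(4))
      then show ?thesis
        using nb(1) 1(2) j(1) by simp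
    next
      case (2 j s)
      then have j: "k' = j" "t' mod N = s mod N"
        using pair_eq_iff[OF k(3)] by auto
      then have "pair k t \<in> neighbours k' t'"
        unfolding neighbours_cong[OF j(2)] unfolding j(1) by (intro 2(4))
      then show ?thesis
        using nb(2) 2(2) j(1) by simp
    qed
  next
    assume "\<not> (k = h \<and> k' = h) \<and> (ring \<or> radial)"
    then have "k < h \<or> k' < h" "ring \<or> radial"
      using k by auto
    then show "cm_edge n (pair k t) (pair k' t')"
      unfolding cm_edge_def exchange_neighbour_iff using nb k by blast
  qed
  have B: "cm_B (pair k t) (pair k' t') = (if k = h \<and> k' = h then 0
      else if ring \<or> radial then (if k = k' then 1 else - 1) * (if even (int k + t) then 1 else - 1) else 0)"
    unfolding cm_B_def edge pair_sign_pair[OF k(1)] using pair_nonempty[OF k(1), of t] by auto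
  have par: "ring \<Longrightarrow> even t' \<longleftrightarrow> odd t"
    unfolding ring_def by (auto simp: parity_mod)
  show ?thesis
  proof (cases "k = h \<and> k' = h")
    case True
    then show ?thesis unfolding a B by simp
  next
    case False
    have 1: "arrow k t k' t' \<longleftrightarrow> even (int k + t) \<and> ring \<or> odd (int k + t) \<and> radial"
      using False k unfolding arrow_def ring_def radial_def by auto
    have 2: "arrow k' t' k t \<longleftrightarrow> even (int k' + t') \<and> ring \<or> odd (int k' + t') \<and> radial"
      using False k mod_pred_iff[OF t] mod_pred_iff[OF t(3,4,1,2)] unfolding arrow_def ring_def radial_def by auto
    have 3: "ring \<or> radial \<Longrightarrow> even (int k' + t') \<longleftrightarrow> odd (int k + t)"
      using par unfolding ring_def radial_def by auto
    have 4: "ring \<Longrightarrow> k = k'" "radial \<Longrightarrow> k \<noteq> k'"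
      unfolding ring_def radial_def by auto
    show ?thesis
      unfolding a B 1 2 using 3 4 False by auto
  qed
qed

abbreviation E where "E \<equiv> {v \<in> mutable S. var S v \<in> plucker (n - 1) ` even_sets}"

lemma even_sets_subset: "even_sets \<subseteq> mutable S"
  unfolding even_sets_eq S_sel using h_pos by auto

text \<open>The vertices to be frozen are described by the values of their variables; distinct
  labels have distinct Pluecker coordinates, so these vertices are the even sets themselves.\<close>

lemma E_eq: "E = even_sets"
proof -
  have lab: "lab k t \<in> {K. finite K \<and> card K = n - 1}" if "k \<le> h" for k t
    using card_lab[OF that] by simp
  have "K \<in> even_sets" if K: "K \<in> mutable S" "plucker (n - 1) K \<in> plucker (n - 1) ` even_sets" for K
  proof -
    obtain k t where "k < h" "K = lab k t"
      using K(1) unfolding S_sel by blast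
    then have K': "K \<in> {K. finite K \<and> card K = n - 1}"
      using lab[of k] by simp
    obtain L where L: "L \<in> even_sets" "plucker (n - 1) K = plucker (n - 1) L"
      using K(2) by blast
    then have "L \<in> {K. finite K \<and> card K = n - 1}"
      using lab[of 0] unfolding even_sets_eq by auto
    then have "K = L"
      using plucker_inj_labels K' L(2) by (auto dest: inj_onD)
    with L show ?thesis by simp
  qed
  then show ?thesis
    using even_sets_subset unfolding S_sel(3) by blast
qed

lemma lab_in_even_sets: "1 \<le> k \<Longrightarrow> k \<le> h \<Longrightarrow> lab k t \<notin> even_sets"
  unfolding even_sets_eq using lab_neq_lab_0 by blast

section \<open>Comparison of the two reduced seeds\<close>

abbreviation S' where "S' \<equiv> trivialize even_sets (freeze even_sets S)"
abbreviation Y' where "Y' \<equiv> trivialize {([], [])} (cm_seed n cm_B)"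

lemma trivialize_freeze_sel:
  assumes "U \<subseteq> mutable X"
  shows "mutable (trivialize U (freeze U X)) = mutable X - U"
    "frozen (trivialize U (freeze U X)) = frozen X - U" "var (trivialize U (freeze U X)) = var X"
  using assms by (auto simp: trivialize_def freeze_def Let_def)

lemma S'_sel: "mutable S' = {lab k t |k t. 1 \<le> k \<and> k < h}" "frozen S' = range (lab h)" "var S' = plucker (n - 1)"
proof -
  have "mutable S' = {lab k t |k t. k < h} - even_sets"
    unfolding trivialize_freeze_sel[OF even_sets_subset] S_sel ..
  also have "\<dots> = {lab k t |k t. 1 \<le> k \<and> k < h}"
  proof -
    have "1 \<le> k" if "lab k t \<notin> even_sets" for k t
      using that unfolding even_sets_eq by (cases k) auto
    then show ?thesis
      using lab_in_even_sets by fastforce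
  qed
  finally show "mutable S' = {lab k t |k t. 1 \<le> k \<and> k < h}" .
  have "range (lab h) \<inter> even_sets = {}"
    using lab_in_even_sets[OF h_pos order_refl] by blast
  then show "frozen S' = range (lab h)"
    unfolding trivialize_freeze_sel[OF even_sets_subset] S_sel by blast
  show "var S' = plucker (n - 1)"
    unfolding trivialize_freeze_sel[OF even_sets_subset] S_sel ..
qed

text \<open>Freezing deletes only arrows between frozen vertices. Two such vertices outside
  \<open>even_sets\<close> were frozen already in \<open>S\<close>, where arrows between frozen
  labels are zero.\<close>

lemma arrows_S':
  assumes "u \<notin> even_sets" "v \<notin> even_sets"
  shows "arrows S' u v = arrows S u v"
  using assms unfolding trivialize_def freeze_def Let_def
  by (auto simp: plabic_seed_def Let_def)

lemma empty_notin_D_dagger: "([], []) \<notin> D_dagger n"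
  unfolding D_dagger_eq using pair_nonempty by force

lemma Y'_sel: "mutable Y' = cm_mutable n" "frozen Y' = D_dagger n - cm_mutable n" "var Y' = indet" "verts Y' = D_dagger n"
proof -
  show 1: "mutable Y' = cm_mutable n" "var Y' = indet"
    by (simp_all add: trivialize_def cm_seed_def Let_def)
  show 2: "frozen Y' = D_dagger n - cm_mutable n"
    using empty_notin_D_dagger by (auto simp: trivialize_def cm_seed_def Let_def)
  have "cm_mutable n \<subseteq> D_dagger n"
    by (auto simp: cm_mutable_def)
  then show "verts Y' = D_dagger n"
    unfolding verts_def 1 2 by blast
qed

lemma arrows_Y':
  assumes "p \<in> D_dagger n" "q \<in> D_dagger n"
  shows "arrows Y' p q = cm_B p q"
proof -
  have "p \<noteq> ([], [])" "q \<noteq> ([], [])"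
    using assms empty_notin_D_dagger by auto
  then show ?thesis
    by (simp add: trivialize_def cm_seed_def Let_def)
qed

lemma D_dagger_rep:
  assumes "p \<in> D_dagger n"
  obtains k t where "1 \<le> k" "k \<le> h" "0 \<le> t" "t < N" "p = pair k t" "I_set n p = lab k t"
proof -
  obtain k t where k: "1 \<le> k" "k \<le> h" "p = pair k t"
    using assms unfolding D_dagger_eq by blast
  then have "p = pair k (t mod N)"
    by (simp add: pair_mod)
  moreover from this have "I_set n p = lab k (t mod N)"
    using I_set_pair[OF k(1,2)] by simp
  ultimately show thesis
    using that[of k "t mod N"] k by simp
qed

lemma frozen_pairs: "D_dagger n - cm_mutable n = range (pair h)"
proof
  show "D_dagger n - cm_mutable n \<subseteq> range (pair h)"
  proof
    fix p assume p: "p \<in> D_dagger n - cm_mutable n"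
    then obtain k t where k: "1 \<le> k" "k \<le> h" "p = pair k t"
      unfolding D_dagger_eq by blast
    then have "\<not> k < h"
      using p unfolding cm_mutable_eq by blast
    with k show "p \<in> range (pair h)"
      by simp
  qed
  show "range (pair h) \<subseteq> D_dagger n - cm_mutable n"
  proof
    fix p assume "p \<in> range (pair h)"
    then obtain t where p: "p = pair h t"
      by blast
    then have "p \<in> D_dagger n"
      unfolding D_dagger_eq using h_pos by blast
    moreover have "p \<notin> cm_mutable n"
      by (simp add: cm_mutable_def half_n p)
    ultimately show "p \<in> D_dagger n - cm_mutable n"
      by blast
  qed
qed

lemma seed_match_Y'_S': "seed_match (I_set n) \<psi> Y' S'"
  unfolding seed_match_def
proof (intro conjI ballI)
  have m: "I_set n ` mutable Y' = mutable S'"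
  proof -
    have "I_set n ` {pair k t |k t. 1 \<le> k \<and> k < h} = {I_set n (pair k t) |k t. 1 \<le> k \<and> k < h}"
      by blast
    also have "\<dots> = {lab k t |k t. 1 \<le> k \<and> k < h}"
      using I_set_pair by (metis (no_types, lifting) less_imp_le)
    finally show ?thesis
      unfolding Y'_sel S'_sel cm_mutable_eq .
  qed
  have f: "I_set n ` frozen Y' = frozen S'"
    unfolding Y'_sel frozen_pairs S'_sel image_image using I_set_pair[OF h_pos order_refl] by simp
  show "I_set n ` mutable Y' = mutable S'" "I_set n ` frozen Y' = frozen S'"
    by (rule m, rule f)
  have "I_set n ` verts Y' = verts S'"
    unfolding verts_def image_Un m f ..
  then show "bij_betw (I_set n) (verts Y') (verts S')"
    using I_set_inj by (simp add: bij_betw_def Y'_sel)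
  fix p assume p: "p \<in> verts Y'"
  show "var S' (I_set n p) = \<psi> (var Y' p)"
    using p unfolding S'_sel Y'_sel by (rule \<psi>_indet[symmetric])
  fix q assume q: "q \<in> verts Y'"
  obtain k t where k: "1 \<le> k" "k \<le> h" "0 \<le> t" "t < N" "p = pair k t" "I_set n p = lab k t"
    using p D_dagger_rep unfolding Y'_sel by metis
  obtain k' t' where k': "1 \<le> k'" "k' \<le> h" "0 \<le> t'" "t' < N" "q = pair k' t'" "I_set n q = lab k' t'"
    using q D_dagger_rep unfolding Y'_sel by metis
  have "arrows S' (I_set n p) (I_set n q) = arrows S (lab k t) (lab k' t')"
    unfolding k(6) k'(6) by (rule arrows_S') (use lab_in_even_sets k k' in auto)
  also have "\<dots> = cm_B p q"
    unfolding k(5) k'(5) by (rule arrows_match) (use k k' in auto)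
  also have "\<dots> = arrows Y' p q"
    using p q unfolding Y'_sel by (simp add: arrows_Y')
  finally show "arrows S' (I_set n p) (I_set n q) = arrows Y' p q" .
qed

lemma S_in_grassmannian_seeds: "S \<in> grassmannian_seeds (n - 1) (2 * n)"
  unfolding grassmannian_seeds_def using pi_diagram_G mutation_class.initial by blast

lemma freeze_trivialize_coincide:
  defines "ident \<equiv> {(plucker (n - 1) (I_set n p), indet p) |p. p \<in> D_dagger n}"
  shows "card (plucker (n - 1) ` even_sets) = n" "plucker (n - 1) ` even_sets \<subseteq> var S ` mutable S"
    "seeds_coincide ident S' Y'" "cluster_structures_coincide ident S' Y'"
proof -
  have "inj_on (plucker (n - 1)) even_sets"
    by (rule inj_on_subset[OF plucker_inj_labels]) (auto simp: even_sets_eq card_lab)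
  then show "card (plucker (n - 1) ` even_sets) = n"
    by (simp add: card_image card_even_sets)
  show "plucker (n - 1) ` even_sets \<subseteq> var S ` mutable S"
    unfolding S_sel(3) using even_sets_subset by (rule image_mono)
  show "seeds_coincide ident S' Y'"
    by (rule seed_match_seeds_coincide[OF seed_match_Y'_S'])
      (auto simp: ident_def Y'_sel \<psi>_indet)
  show "cluster_structures_coincide ident S' Y'"
  proof (rule seed_match_cluster_structures_coincide[OF hom_\<psi> \<psi>_scalar seed_match_Y'_S'])
    show "mutable Y' \<inter> frozen Y' = {}"
      unfolding Y'_sel by blast
    show "a = \<psi> b" if "(a, b) \<in> ident" for a b
      using that by (auto simp: ident_def \<psi>_indet)
  qed
qed

end

theorem theorem1p1:
  fixes n :: nat
  assumes "odd n" and "n \<ge> 3"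
  shows "\<exists>S \<in> grassmannian_seeds (n - 1) (2 * n). \<exists>B \<in> cm_quivers n.
    let even_sets = {I. I \<subseteq> {i \<in> {1..2 * n}. even i} \<and> card I = n - 1};
        E = {v \<in> mutable S. var S v \<in> plucker (n - 1) ` even_sets};
        S' = trivialize E (freeze E S);
        Y' = trivialize {([], [])} (cm_seed n B);
        ident = {(plucker (n - 1) (I_set n p), indet p) |p. p \<in> D_dagger n}
    in card (plucker (n - 1) ` even_sets) = n \<and>
       plucker (n - 1) ` even_sets \<subseteq> var S ` mutable S \<and>
       seeds_coincide ident S' Y' \<and>
       cluster_structures_coincide ident S' Y'"
proof -
  obtain h where n: "n = 2 * h + 1"
    using assms(1) by (rule oddE)
  then interpret annulus n h
    using assms(2) by unfold_locales auto
  show ?thesis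
    by (rule bexI[OF bexI[OF _ cm_B_quiver] S_in_grassmannian_seeds])
      (unfold Let_def even_sets_def[symmetric] E_eq, intro conjI freeze_trivialize_coincide)
qed

end
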